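(* Let $\Lambda$ be any finite simple graph. Then there exists a finite simple graph $\Gamma'=\Gamma'(\Lambda)$ such that (1) $A_\Lambda \cong \mathrm{PSO}(A_{\Gamma'})$, (2) $\mathrm{PSO}(A_{\Gamma'})$ has finite index in $\mathrm{Out}(A_{\Gamma'})$, and (3) $\Gamma'$ has no non-trivial graph automorphisms.
   Context: All graphs are finite, undirected, without loops or multiple edges. For a graph $\Gamma$, the right-angled Artin group is $A_\Gamma = \langle V(\Gamma) \mid [v,w]=1 \text{ for } \{v,w\}\in E(\Gamma)\rangle$ (for the graph with no vertices, $A_\emptyset$ is the trivial group). An automorphism $\phi$ of $A_\Gamma$ is pure symmetric if for every vertex $v$, $\phi(v)$ is a conjugate of $v$ (the conjugating element may depend on $v$); these form a subgroup $\mathrm{PSA}(A_\Gamma)\le\mathrm{Aut}(A_\Gamma)$, and $\mathrm{PSO}(A_\Gamma)$ denotes its image in $\mathrm{Out}(A_\Gamma)$. *)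

theory Defs
  imports "HOL-Algebra.Algebra"
begin

definition simple_graph :: "'a set \<Rightarrow> ('a \<times> 'a) set \<Rightarrow> bool" where
  "simple_graph V E \<longleftrightarrow> finite V \<and> E \<subseteq> V \<times> V \<and> sym E \<and> irrefl E"

definition graph_aut :: "'a set \<Rightarrow> ('a \<times> 'a) set \<Rightarrow> ('a \<Rightarrow> 'a) \<Rightarrow> bool" where
  "graph_aut V E f \<longleftrightarrow> bij_betw f V V \<and>
     (\<forall>u\<in>V. \<forall>w\<in>V. (u, w) \<in> E \<longleftrightarrow> (f u, f w) \<in> E)"

text \<open>Words in the letters v (True) and v^-1 (False), v a vertex.\<close>

definition raag_words :: "'a set \<Rightarrow> ('a \<times> bool) list set" where
  "raag_words V = lists (V \<times> UNIV)"

definition raag_step :: "'a set \<Rightarrow> ('a \<times> 'a) set \<Rightarrow>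
    (('a \<times> bool) list \<times> ('a \<times> bool) list) set" where
  "raag_step V E =
     ({(xs @ [(v, b), (v, \<not> b)] @ ys, xs @ ys) | xs ys v b. True} \<union>
      {(xs @ [(v, b), (w, c)] @ ys, xs @ [(w, c), (v, b)] @ ys) | xs ys v b w c. (v, w) \<in> E})
     \<inter> (raag_words V \<times> raag_words V)"

definition raag_rel :: "'a set \<Rightarrow> ('a \<times> 'a) set \<Rightarrow>
    (('a \<times> bool) list \<times> ('a \<times> bool) list) set" where
  "raag_rel V E = (raag_step V E \<union> (raag_step V E)\<inverse>)\<^sup>* \<inter> (raag_words V \<times> raag_words V)"

definition RAAG :: "'a set \<Rightarrow> ('a \<times> 'a) set \<Rightarrow> ('a \<times> bool) list set monoid" where
  "RAAG V E =
     \<lparr>carrier = raag_words V // raag_rel V E,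
      monoid.mult = (\<lambda>P Q. \<Union>((\<lambda>(x, y). raag_rel V E `` {x @ y}) ` (P \<times> Q))),
      one = raag_rel V E `` {[]}\<rparr>"

definition raag_gen :: "'a set \<Rightarrow> ('a \<times> 'a) set \<Rightarrow> 'a \<Rightarrow> ('a \<times> bool) list set" where
  "raag_gen V E v = raag_rel V E `` {[(v, True)]}"

definition inn :: "('a, 'b) monoid_scheme \<Rightarrow> ('a \<Rightarrow> 'a) set" where
  "inn G = {(\<lambda>x\<in>carrier G. g \<otimes>\<^bsub>G\<^esub> x \<otimes>\<^bsub>G\<^esub> inv\<^bsub>G\<^esub> g) | g. g \<in> carrier G}"

definition OutGroup :: "('a, 'b) monoid_scheme \<Rightarrow> ('a \<Rightarrow> 'a) set monoid" where
  "OutGroup G = AutoGroup G Mod inn G"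

definition PSA :: "'a set \<Rightarrow> ('a \<times> 'a) set \<Rightarrow> (('a \<times> bool) list set \<Rightarrow> ('a \<times> bool) list set) set" where
  "PSA V E = {\<phi> \<in> auto (RAAG V E). \<forall>v\<in>V. \<exists>g\<in>carrier (RAAG V E).
      \<phi> (raag_gen V E v) =
        g \<otimes>\<^bsub>RAAG V E\<^esub> raag_gen V E v \<otimes>\<^bsub>RAAG V E\<^esub> inv\<^bsub>RAAG V E\<^esub> g}"

definition PSO_set :: "'a set \<Rightarrow> ('a \<times> 'a) set \<Rightarrow>
    (('a \<times> bool) list set \<Rightarrow> ('a \<times> bool) list set) set set" where
  "PSO_set V E = (\<lambda>\<phi>. inn (RAAG V E) #>\<^bsub>AutoGroup (RAAG V E)\<^esub> \<phi>) ` PSA V E"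

definition PSO :: "'a set \<Rightarrow> ('a \<times> 'a) set \<Rightarrow>
    (('a \<times> bool) list set \<Rightarrow> ('a \<times> bool) list set) set monoid" where
  "PSO V E = (OutGroup (RAAG V E)) \<lparr>carrier := PSO_set V E\<rparr>"

end

(* The graph Gamma' contains Lambda, two further vertices a, b joined to all of Lambda, a part P
   attached only to a and b, and a part attached to a, b and Lambda. Conjugating the generators in P by an
   element g of A_Lambda and fixing all others is an automorphism, since A_Lambda centralises a and b;
   this defines an injection of A_Lambda into PSO. It is onto because both sides of the separating pair {a, b}
   are rigid: every pure symmetric automorphism conjugates all their generators by one common element.
   Rigidity comes from long induced cycles. Commuting conjugates of generators are simultaneously conjugate,
   so each edge of the cycle carries a conjugator; consecutive ones differ by an element of a vertex star,
   and retracting the cyclic product of these differences onto each star shows that all of them agree.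

   For the finite index, no vertex of Gamma' is dominated by another one. Comparing the ranks of centralisers in the
   abelianisation shows that every automorphism permutes the generators there up to sign, and the permutation is a
   graph automorphism, hence trivial. An element that commutes with some h having non-zero exponent sum in u, but has
   itself exponent sum zero in u, is conjugate into the subgroup generated by the link of u, as the action on the
   Bass-Serre tree of u shows. Hence every automorphism sends each generator v to a conjugate of v or its inverse. *)
theory Submission
  imports Defs
begin

section \<open>Conjugation\<close>

text \<open>The Bass-Serre tree is kept algebraic. Killing \<open>u\<close> writes the group as a
  free group extended by the subgroup H of the remaining generators; a free basis consists of the
  conjugates of \<open>u\<close> under H, indexed by the cosets in H of the subgroup generated by
  the link of \<open>u\<close>. Reduced words over these cosets correspond to the vertices of the
  tree, and word length replaces distance. The graph is shaped by the fact that Lambda is arbitrary: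
  it may have symmetries, dominated vertices and no induced cycle at all. Therefore each of its
  vertices receives a long cycle of its own that meets Lambda only there, and the positions of these
  cycles along one path number the vertices. Rigidity of a cycle is read off from intersections of
  stars: at length 4 opposite vertices already have two common neighbours, so at least 5 vertices
  are required, and a vertex outside the cycle may have only one neighbour on it. The index is at
  most the number of sign vectors: modulo pure symmetric automorphisms, an automorphism is
  determined by its signs on the generators.\<close>

context group begin

definition conj_by :: "'a \<Rightarrow> 'a \<Rightarrow> 'a" where
  "conj_by g x = g \<otimes> x \<otimes> inv g"

lemma mult_inv_cancel [simp]:
  assumes "x \<in> carrier G" "y \<in> carrier G"
  shows "x \<otimes> (inv x \<otimes> y) = y" "inv x \<otimes> (x \<otimes> y) = y"
  using assms by (simp_all flip: m_assoc)

lemma conj_by_closed [simp, intro]: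
  "g \<in> carrier G \<Longrightarrow> x \<in> carrier G \<Longrightarrow> conj_by g x \<in> carrier G"
  by (simp add: conj_by_def)

lemma conj_by_one [simp]: "x \<in> carrier G \<Longrightarrow> conj_by \<one> x = x"
  by (simp add: conj_by_def)

lemma conj_by_one_right [simp]: "g \<in> carrier G \<Longrightarrow> conj_by g \<one> = \<one>"
  by (simp add: conj_by_def)

lemma conj_by_mult:
  "g \<in> carrier G \<Longrightarrow> h \<in> carrier G \<Longrightarrow> x \<in> carrier G \<Longrightarrow> conj_by (g \<otimes> h) x = conj_by g (conj_by h x)"
  by (simp add: conj_by_def inv_mult_group m_assoc)

lemma conj_by_mult_right:
  "g \<in> carrier G \<Longrightarrow> x \<in> carrier G \<Longrightarrow> y \<in> carrier G \<Longrightarrow> conj_by g (x \<otimes> y) = conj_by g x \<otimes> conj_by g y"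
  by (simp add: conj_by_def m_assoc)

lemma conj_by_hom: "g \<in> carrier G \<Longrightarrow> conj_by g \<in> hom G G"
  by (auto simp: hom_def conj_by_mult_right)

lemma conj_by_inv:
  "g \<in> carrier G \<Longrightarrow> x \<in> carrier G \<Longrightarrow> conj_by g (inv x) = inv (conj_by g x)"
  by (simp add: conj_by_def inv_mult_group m_assoc)

lemma conj_by_inv_cancel [simp]:
  assumes "g \<in> carrier G" "x \<in> carrier G"
  shows "conj_by (inv g) (conj_by g x) = x" "conj_by g (conj_by (inv g) x) = x"
  using assms by (simp_all flip: conj_by_mult)

lemma conj_by_eq_iff:
  assumes "g \<in> carrier G" "x \<in> carrier G" "y \<in> carrier G"
  shows "conj_by g x = y \<longleftrightarrow> x = conj_by (inv g) y"
  using assms by auto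

lemma conj_by_fix_iff:
  assumes "g \<in> carrier G" "x \<in> carrier G"
  shows "conj_by g x = x \<longleftrightarrow> g \<otimes> x = x \<otimes> g"
proof -
  have "conj_by g x = x \<longleftrightarrow> g \<otimes> x \<otimes> inv g = x" by (simp add: conj_by_def)
  also have "\<dots> \<longleftrightarrow> g \<otimes> x = x \<otimes> g"
    using assms inv_solve_right[of x "g \<otimes> x" g] by auto
  finally show ?thesis .
qed

lemma conj_by_eq_conj_by_iff:
  assumes "g \<in> carrier G" "h \<in> carrier G" "x \<in> carrier G"
  shows "conj_by g x = conj_by h x \<longleftrightarrow> (inv h \<otimes> g) \<otimes> x = x \<otimes> (inv h \<otimes> g)"
proof -
  have "conj_by g x = conj_by h x \<longleftrightarrow> conj_by (inv h) (conj_by g x) = x"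
    using assms by (metis conj_by_closed conj_by_eq_iff inv_closed inv_inv)
  also have "\<dots> \<longleftrightarrow> conj_by (inv h \<otimes> g) x = x" using assms by (simp add: conj_by_mult)
  finally show ?thesis using assms by (simp add: conj_by_fix_iff)
qed

lemma commutes_conj_by:
  assumes "g \<in> carrier G" "x \<in> carrier G" "y \<in> carrier G" "x \<otimes> y = y \<otimes> x"
  shows "conj_by g x \<otimes> conj_by g y = conj_by g y \<otimes> conj_by g x"
  using assms by (metis conj_by_mult_right)

lemma commutes_inv:
  assumes "x \<in> carrier G" "y \<in> carrier G" "x \<otimes> y = y \<otimes> x"
  shows "inv x \<otimes> y = y \<otimes> inv x"
  using assms by (metis conj_by_fix_iff conj_by_inv_cancel(1) inv_closed)

lemma commutes_mult:
  assumes "x \<in> carrier G" "y \<in> carrier G" "z \<in> carrier G" "x \<otimes> z = z \<otimes> x" "y \<otimes> z = z \<otimes> y"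
  shows "(x \<otimes> y) \<otimes> z = z \<otimes> (x \<otimes> y)"
  using assms by (metis m_assoc)

end

lemma hom_conj_by:
  assumes "group G" "group H" "h \<in> hom G H" "g \<in> carrier G" "x \<in> carrier G"
  shows "h (group.conj_by G g x) = group.conj_by H (h g) (h x)"
proof -
  interpret group_hom G H h using assms by (simp add: group_hom_def group_hom_axioms_def)
  show ?thesis using assms(4,5) by (simp add: G.conj_by_def H.conj_by_def)
qed

section \<open>The universal property of right-angled Artin groups\<close>

fun letter_val :: "('b, 'c) monoid_scheme \<Rightarrow> ('a \<Rightarrow> 'b) \<Rightarrow> 'a \<times> bool \<Rightarrow> 'b" where
  "letter_val G f (v, b) = (if b then f v else inv\<^bsub>G\<^esub> (f v))"

definition word_val :: "('b, 'c) monoid_scheme \<Rightarrow> ('a \<Rightarrow> 'b) \<Rightarrow> ('a \<times> bool) list \<Rightarrow> 'b" where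
  "word_val G f w = foldr (\<lambda>l x. letter_val G f l \<otimes>\<^bsub>G\<^esub> x) w \<one>\<^bsub>G\<^esub>"

lemma word_val_simps [simp]:
  "word_val G f [] = \<one>\<^bsub>G\<^esub>"
  "word_val G f (l # w) = letter_val G f l \<otimes>\<^bsub>G\<^esub> word_val G f w"
  by (simp_all add: word_val_def)

text \<open>Evaluates an arbitrary representative of the class; \<open>word_val_rel\<close> makes
  the choice harmless once the images of adjacent vertices commute.\<close>

definition raag_lift :: "('b, 'c) monoid_scheme \<Rightarrow> ('a \<Rightarrow> 'b) \<Rightarrow> ('a \<times> bool) list set \<Rightarrow> 'b" where
  "raag_lift G f P = word_val G f (SOME w. w \<in> P)"

context group begin

lemma letter_val_closed: "f \<in> V \<rightarrow> carrier G \<Longrightarrow> l \<in> V \<times> UNIV \<Longrightarrow> letter_val G f l \<in> carrier G"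
  by (auto simp: Pi_iff)

lemma word_val_closed: "f \<in> V \<rightarrow> carrier G \<Longrightarrow> w \<in> lists (V \<times> UNIV) \<Longrightarrow> word_val G f w \<in> carrier G"
proof (induction w)
  case (Cons l w)
  then have "letter_val G f l \<in> carrier G" by (intro letter_val_closed[of f V]) auto
  then show ?case using Cons by simp
qed simp

lemma word_val_append:
  assumes "f \<in> V \<rightarrow> carrier G" "w \<in> lists (V \<times> UNIV)" "w' \<in> lists (V \<times> UNIV)"
  shows "word_val G f (w @ w') = word_val G f w \<otimes> word_val G f w'"
  using assms(2)
proof (induction w)
  case Nil
  then show ?case using word_val_closed[OF assms(1,3)] by simp
next
  case (Cons l w)
  then show ?case
    using word_val_closed[OF assms(1,3)] word_val_closed[OF assms(1), of w]
      letter_val_closed[OF assms(1), of l]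
    by (simp add: m_assoc)
qed

lemma letter_val_commute:
  assumes "f v \<in> carrier G" "f w \<in> carrier G" "f v \<otimes> f w = f w \<otimes> f v"
  shows "letter_val G f (v, b) \<otimes> letter_val G f (w, c) = letter_val G f (w, c) \<otimes> letter_val G f (v, b)"
  using assms commutes_inv[of "f v" "f w"] commutes_inv[of "f w" "f v"]
    commutes_inv[of "f v" "inv (f w)"] by auto

end

locale raag =
  fixes V :: "'a set" and E :: "('a \<times> 'a) set"
  assumes graph: "simple_graph V E"
begin

lemma finite_V: "finite V" and E_subset: "E \<subseteq> V \<times> V"
  and E_sym: "(v, w) \<in> E \<Longrightarrow> (w, v) \<in> E" and E_irrefl: "(v, v) \<notin> E"
  using graph by (auto simp: simple_graph_def sym_def irrefl_def)

abbreviation "A \<equiv> RAAG V E"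
abbreviation "gen \<equiv> raag_gen V E"
abbreviation "words \<equiv> raag_words V"
abbreviation "cls w \<equiv> raag_rel V E `` {w}"

lemma words_simps [simp]:
  "[] \<in> words" "x @ y \<in> words \<longleftrightarrow> x \<in> words \<and> y \<in> words"
  "(v, b) # x \<in> words \<longleftrightarrow> v \<in> V \<and> x \<in> words"
  by (auto simp: raag_words_def)

lemma equiv_rel: "equiv words (raag_rel V E)"
proof (rule equivI)
  let ?s = "raag_step V E \<union> (raag_step V E)\<inverse>"
  show "refl_on words (raag_rel V E)" by (auto simp: refl_on_def raag_rel_def)
  have "sym (?s\<^sup>*)" by (intro sym_rtrancl) (auto simp: sym_def)
  then show "sym (raag_rel V E)" by (auto simp: raag_rel_def sym_def)
  show "trans (raag_rel V E)" by (auto simp: raag_rel_def trans_def intro: rtrancl_trans)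
  show "raag_rel V E \<subseteq> words \<times> words" by (auto simp: raag_rel_def)
qed

text \<open>Reduces every compatibility statement about the congruence to the two elementary moves,
  cancellation and swap.\<close>

lemma rel_induct [consumes 1, case_names refl sym trans cancel swap]:
  assumes "(x, y) \<in> raag_rel V E"
    and refl: "\<And>x. x \<in> words \<Longrightarrow> P x x"
    and sym: "\<And>x y. x \<in> words \<Longrightarrow> y \<in> words \<Longrightarrow> P x y \<Longrightarrow> P y x"
    and trans: "\<And>x y z. x \<in> words \<Longrightarrow> y \<in> words \<Longrightarrow> z \<in> words \<Longrightarrow> P x y \<Longrightarrow> P y z \<Longrightarrow> P x z"
    and cancel: "\<And>xs ys v b. xs \<in> words \<Longrightarrow> ys \<in> words \<Longrightarrow> v \<in> V \<Longrightarrow>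
        P (xs @ [(v, b), (v, \<not> b)] @ ys) (xs @ ys)"
    and swap: "\<And>xs ys v b w c. xs \<in> words \<Longrightarrow> ys \<in> words \<Longrightarrow> v \<in> V \<Longrightarrow> w \<in> V \<Longrightarrow> (v, w) \<in> E \<Longrightarrow>
        P (xs @ [(v, b), (w, c)] @ ys) (xs @ [(w, c), (v, b)] @ ys)"
  shows "P x y"
proof -
  let ?s = "raag_step V E \<union> (raag_step V E)\<inverse>"
  from assms(1) have xw: "x \<in> words" and "(x, y) \<in> ?s\<^sup>*" by (auto simp: raag_rel_def)
  from this(2) have "P x y \<and> y \<in> words"
  proof induction
    case base
    then show ?case using refl xw by blast
  next
    case (step y z)
    have zw: "z \<in> words" using step(2) by (auto simp: raag_step_def)
    have st: "P p q" if "(p, q) \<in> raag_step V E" for p q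
      using that cancel swap by (fastforce simp: raag_step_def)
    have "P y z" using step st sym zw by auto
    then show ?case using step trans xw zw by blast
  qed
  then show ?thesis ..
qed

lemma rel_refl: "x \<in> words \<Longrightarrow> (x, x) \<in> raag_rel V E"
  using equiv_rel by (auto simp: equiv_def refl_on_def)

lemma rel_sym: "(x, y) \<in> raag_rel V E \<Longrightarrow> (y, x) \<in> raag_rel V E"
  using equiv_rel by (auto simp: equiv_def sym_def)

lemma rel_trans: "(x, y) \<in> raag_rel V E \<Longrightarrow> (y, z) \<in> raag_rel V E \<Longrightarrow> (x, z) \<in> raag_rel V E"
  using equiv_rel by (meson equiv_def transD)

lemma rel_words: "(x, y) \<in> raag_rel V E \<Longrightarrow> x \<in> words \<and> y \<in> words"
  by (auto simp: raag_rel_def)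

lemma rel_cancel:
  assumes "xs \<in> words" "ys \<in> words" "v \<in> V"
  shows "(xs @ [(v, b), (v, \<not> b)] @ ys, xs @ ys) \<in> raag_rel V E"
proof -
  have "(xs @ [(v, b), (v, \<not> b)] @ ys, xs @ ys) \<in> raag_step V E"
    using assms unfolding raag_step_def by fastforce
  then show ?thesis using assms by (auto simp: raag_rel_def)
qed

lemma rel_swap:
  assumes "xs \<in> words" "ys \<in> words" "v \<in> V" "w \<in> V" "(v, w) \<in> E"
  shows "(xs @ [(v, b), (w, c)] @ ys, xs @ [(w, c), (v, b)] @ ys) \<in> raag_rel V E"
proof -
  have "(xs @ [(v, b), (w, c)] @ ys, xs @ [(w, c), (v, b)] @ ys) \<in> raag_step V E"
    using assms unfolding raag_step_def by fastforce
  then show ?thesis using assms by (auto simp: raag_rel_def)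
qed

lemma rel_context:
  assumes "(x, y) \<in> raag_rel V E" "z \<in> words" "w \<in> words"
  shows "(z @ x @ w, z @ y @ w) \<in> raag_rel V E"
  using assms(1)
proof (induction rule: rel_induct)
  case (cancel xs ys v b)
  then show ?case using rel_cancel[of "z @ xs" "ys @ w" v b] assms by simp
next
  case (swap xs ys v b u c)
  then show ?case using rel_swap[of "z @ xs" "ys @ w" v u b c] assms by simp
qed (use assms in \<open>auto intro: rel_refl rel_sym rel_trans\<close>)

lemma rel_append:
  assumes "(x, x') \<in> raag_rel V E" "(y, y') \<in> raag_rel V E"
  shows "(x @ y, x' @ y') \<in> raag_rel V E"
  using rel_trans rel_context[OF assms(1), of "[]" y] rel_context[OF assms(2), of x' "[]"]
    rel_words[OF assms(1)] rel_words[OF assms(2)] by auto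

lemma cls_eq_iff: "x \<in> words \<Longrightarrow> y \<in> words \<Longrightarrow> cls x = cls y \<longleftrightarrow> (x, y) \<in> raag_rel V E"
  using eq_equiv_class_iff[OF equiv_rel] by blast

lemma cls_mult:
  assumes "x \<in> words" "y \<in> words"
  shows "cls x \<otimes>\<^bsub>A\<^esub> cls y = cls (x @ y)"
proof -
  have "cls (a @ b) = cls (x @ y)" if "a \<in> cls x" "b \<in> cls y" for a b
  proof -
    have "(x @ y, a @ b) \<in> raag_rel V E" using that by (auto intro: rel_append)
    then show ?thesis using rel_words[of "x @ y" "a @ b"] cls_eq_iff[of "x @ y" "a @ b"] by simp
  qed
  then have "(\<lambda>(a, b). cls (a @ b)) ` (cls x \<times> cls y) = (\<lambda>_. cls (x @ y)) ` (cls x \<times> cls y)"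
    by (intro image_cong) auto
  also have "\<dots> = {cls (x @ y)}" using rel_refl[OF assms(1)] rel_refl[OF assms(2)] by (intro image_constant) auto
  finally show ?thesis unfolding RAAG_def by simp
qed

lemma carrier_A: "carrier A = cls ` words"
  by (auto simp: RAAG_def quotient_def)

lemma one_A: "\<one>\<^bsub>A\<^esub> = cls []" by (simp add: RAAG_def)

definition inverse_word :: "('a \<times> bool) list \<Rightarrow> ('a \<times> bool) list" where
  "inverse_word w = rev (map (\<lambda>(v, b). (v, \<not> b)) w)"

lemma inverse_word_words [simp]: "w \<in> words \<Longrightarrow> inverse_word w \<in> words"
  by (induction w) (auto simp: inverse_word_def)

lemma rel_inverse_word: "w \<in> words \<Longrightarrow> (inverse_word w @ w, []) \<in> raag_rel V E"
proof (induction w)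
  case Nil
  then show ?case by (simp add: inverse_word_def rel_refl)
next
  case (Cons l w)
  obtain v b where l: "l = (v, b)" by force
  have "(inverse_word w @ [(v, \<not> b), (v, \<not> \<not> b)] @ w, inverse_word w @ w) \<in> raag_rel V E"
    using Cons l by (intro rel_cancel) auto
  moreover have "inverse_word (l # w) @ l # w = inverse_word w @ [(v, \<not> b), (v, \<not> \<not> b)] @ w"
    by (simp add: l inverse_word_def)
  ultimately show ?case using Cons l rel_trans by auto
qed

sublocale A: group A
proof (rule groupI)
  show "\<one>\<^bsub>A\<^esub> \<in> carrier A" by (auto simp: carrier_A one_A)
  fix x y z assume "x \<in> carrier A" "y \<in> carrier A" "z \<in> carrier A"
  then obtain a b c where abc: "x = cls a" "y = cls b" "z = cls c" "a \<in> words" "b \<in> words" "c \<in> words"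
    by (auto simp: carrier_A)
  show "x \<otimes>\<^bsub>A\<^esub> y \<in> carrier A" using abc by (auto simp: cls_mult carrier_A)
  show "x \<otimes>\<^bsub>A\<^esub> y \<otimes>\<^bsub>A\<^esub> z = x \<otimes>\<^bsub>A\<^esub> (y \<otimes>\<^bsub>A\<^esub> z)" using abc by (simp add: cls_mult)
  show "\<one>\<^bsub>A\<^esub> \<otimes>\<^bsub>A\<^esub> x = x" using abc by (simp add: cls_mult one_A)
  have "cls (inverse_word a) \<otimes>\<^bsub>A\<^esub> x = \<one>\<^bsub>A\<^esub>"
    using abc rel_inverse_word[of a] by (simp add: cls_mult one_A cls_eq_iff)
  then show "\<exists>y\<in>carrier A. y \<otimes>\<^bsub>A\<^esub> x = \<one>\<^bsub>A\<^esub>" using abc by (auto simp: carrier_A)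
qed

abbreviation mul (infixl "\<bullet>" 70) where "x \<bullet> y \<equiv> x \<otimes>\<^bsub>A\<^esub> y"
abbreviation iv where "iv x \<equiv> inv\<^bsub>A\<^esub> x"
abbreviation "cj \<equiv> A.conj_by"

lemma gen_closed [simp, intro]: "v \<in> V \<Longrightarrow> gen v \<in> carrier A"
  by (auto simp: raag_gen_def carrier_A)

lemma inv_gen: "v \<in> V \<Longrightarrow> iv (gen v) = cls [(v, False)]"
proof (rule A.inv_equality)
  assume v: "v \<in> V"
  then show "cls [(v, False)] \<bullet> gen v = \<one>\<^bsub>A\<^esub>"
    using rel_cancel[of "[]" "[]" v False] by (simp add: raag_gen_def cls_mult one_A cls_eq_iff)
  show "cls [(v, False)] \<in> carrier A" using v by (auto simp: carrier_A)
qed auto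

lemma gen_commute: "(v, w) \<in> E \<Longrightarrow> gen v \<bullet> gen w = gen w \<bullet> gen v"
proof -
  assume vw: "(v, w) \<in> E"
  then have "v \<in> V" "w \<in> V" using E_subset by auto
  then show ?thesis
    using rel_swap[of "[]" "[]" v w True True] vw by (simp add: raag_gen_def cls_mult cls_eq_iff)
qed

lemma A_induct [consumes 1, case_names one gen inv]:
  assumes "x \<in> carrier A" and "P \<one>\<^bsub>A\<^esub>"
    and "\<And>v x. v \<in> V \<Longrightarrow> x \<in> carrier A \<Longrightarrow> P x \<Longrightarrow> P (gen v \<bullet> x)"
    and "\<And>v x. v \<in> V \<Longrightarrow> x \<in> carrier A \<Longrightarrow> P x \<Longrightarrow> P (iv (gen v) \<bullet> x)"
  shows "P x"
proof -
  have "P (cls w)" if "w \<in> words" for w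
    using that
  proof (induction w)
    case Nil
    then show ?case using assms(2) by (simp add: one_A)
  next
    case (Cons l w)
    obtain v b where l: "l = (v, b)" by force
    have v: "v \<in> V" "w \<in> words" using Cons l by auto
    have c: "cls w \<in> carrier A" using v carrier_A by auto
    have "cls (l # w) = cls [(v, b)] \<bullet> cls w" using v l by (simp add: cls_mult)
    then show ?case
      using assms(3)[OF v(1) c] assms(4)[OF v(1) c] Cons v inv_gen[OF v(1)]
      by (cases b) (auto simp: raag_gen_def)
  qed
  then show ?thesis using assms(1) carrier_A by auto
qed

lemma hom_eqI:
  assumes G: "group G" and h: "h \<in> hom A G" and k: "k \<in> hom A G"
    and eq: "\<And>v. v \<in> V \<Longrightarrow> h (gen v) = k (gen v)" and x: "x \<in> carrier A"
  shows "h x = k x"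
proof -
  interpret h: group_hom A G h using G h by (simp add: group_hom_def group_hom_axioms_def A.is_group)
  interpret k: group_hom A G k using G k by (simp add: group_hom_def group_hom_axioms_def A.is_group)
  from x show ?thesis by (induction rule: A_induct) (simp_all add: eq)
qed

lemma word_val_rel:
  assumes G: "group G" and f: "f \<in> V \<rightarrow> carrier G"
    and comm: "\<And>v w. (v, w) \<in> E \<Longrightarrow> f v \<otimes>\<^bsub>G\<^esub> f w = f w \<otimes>\<^bsub>G\<^esub> f v"
    and "(x, y) \<in> raag_rel V E"
  shows "word_val G f x = word_val G f y"
  using assms(4)
proof (induction rule: rel_induct)
  interpret group G by fact
  note app = word_val_append[OF f] and cl = word_val_closed[OF f]
  have fV: "v \<in> V \<Longrightarrow> f v \<in> carrier G" for v using f by auto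
  {
    case (cancel xs ys v b)
    then have "word_val G f ([(v, b), (v, \<not> b)] @ ys) = word_val G f ys"
      using cl[of ys] fV by (cases b) (auto simp: raag_words_def)
    moreover have "[(v, b), (v, \<not> b)] @ ys \<in> lists (V \<times> UNIV)" using cancel by (auto simp: raag_words_def)
    ultimately show ?case using cancel app by (simp add: raag_words_def)
  next
    case (swap xs ys v b w c)
    let ?g = "letter_val G f (v, b)" and ?h = "letter_val G f (w, c)"
    have gh: "?g \<otimes>\<^bsub>G\<^esub> ?h = ?h \<otimes>\<^bsub>G\<^esub> ?g"
      by (rule letter_val_commute) (use swap fV comm in auto)
    have cc: "?g \<in> carrier G" "?h \<in> carrier G" using fV swap by auto
    have yc: "word_val G f ys \<in> carrier G" using cl swap by (simp add: raag_words_def)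
    have "word_val G f ([(v, b), (w, c)] @ ys) = ?g \<otimes>\<^bsub>G\<^esub> ?h \<otimes>\<^bsub>G\<^esub> word_val G f ys"
      using cc yc by (simp add: m_assoc del: letter_val.simps)
    also have "\<dots> = word_val G f ([(w, c), (v, b)] @ ys)"
      using gh cc yc by (simp add: m_assoc del: letter_val.simps)
    finally have "word_val G f ([(v, b), (w, c)] @ ys) = word_val G f ([(w, c), (v, b)] @ ys)" .
    moreover have "[(v, b), (w, c)] @ ys \<in> lists (V \<times> UNIV)" "[(w, c), (v, b)] @ ys \<in> lists (V \<times> UNIV)"
      using swap by (auto simp: raag_words_def)
    ultimately show ?case using swap app by (simp add: raag_words_def)
  }
qed auto

lemma raag_lift:
  assumes G: "group G" and f: "f \<in> V \<rightarrow> carrier G"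
    and comm: "\<And>v w. (v, w) \<in> E \<Longrightarrow> f v \<otimes>\<^bsub>G\<^esub> f w = f w \<otimes>\<^bsub>G\<^esub> f v"
  shows raag_lift_hom: "raag_lift G f \<in> hom A G"
    and raag_lift_gen: "v \<in> V \<Longrightarrow> raag_lift G f (gen v) = f v"
proof -
  interpret group G by fact
  have cls: "raag_lift G f (cls w) = word_val G f w" if "w \<in> words" for w
  proof -
    have "(SOME x. x \<in> cls w) \<in> cls w" by (rule someI_ex) (use that rel_refl in auto)
    then have "(w, SOME x. x \<in> cls w) \<in> raag_rel V E" by blast
    then show ?thesis unfolding raag_lift_def using word_val_rel[OF G f comm] by metis
  qed
  show "raag_lift G f \<in> hom A G"
    unfolding hom_def
    by (auto simp: carrier_A cls cls_mult word_val_append[OF f] word_val_closed[OF f] raag_words_def[symmetric]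
        word_val_append[OF f, folded raag_words_def] word_val_closed[OF f, folded raag_words_def])
  show "raag_lift G f (gen v) = f v" if "v \<in> V"
    using that cls[of "[(v, True)]"] funcset_mem[OF f, of v] by (simp add: raag_gen_def)
qed

end

text \<open>Unitriangular integer matrices of size 3, with \<open>a\<close>, \<open>b\<close> next
  to the diagonal and \<open>c\<close> in the corner. Two elements commute exactly if the minor of
  their \<open>a\<close>, \<open>b\<close> entries vanishes.\<close>

definition heisenberg_group :: "(int \<times> int \<times> int) monoid" where
  "heisenberg_group = \<lparr>carrier = UNIV,
     monoid.mult = (\<lambda>(a, b, c) (a', b', c'). (a + a', b + b', c + c' + a * b')), one = (0, 0, 0)\<rparr>"

lemma group_heisenberg: "group heisenberg_group"
proof (rule groupI)
  fix x assume "x \<in> carrier heisenberg_group"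
  obtain a b c where x: "x = (a, b, c)" by (metis prod.collapse)
  show "\<exists>y\<in>carrier heisenberg_group. y \<otimes>\<^bsub>heisenberg_group\<^esub> x = \<one>\<^bsub>heisenberg_group\<^esub>"
    by (rule bexI[of _ "(- a, - b, - c + a * b)"]) (auto simp: heisenberg_group_def x algebra_simps)
qed (auto simp: heisenberg_group_def algebra_simps split: prod.splits)

context raag begin

section \<open>Retractions and special subgroups\<close>

definition link :: "'a \<Rightarrow> 'a set" where "link u = {w. (u, w) \<in> E}"
definition star :: "'a \<Rightarrow> 'a set" where "star u = insert u (link u)"

lemma link_subset: "link u \<subseteq> V" and star_subset: "u \<in> V \<Longrightarrow> star u \<subseteq> V"
  using E_subset by (auto simp: link_def star_def)

lemma star_sym: "w \<in> star u \<longleftrightarrow> u \<in> star w"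
  using E_sym by (auto simp: link_def star_def)

definition ret :: "'a set \<Rightarrow> ('a \<times> bool) list set \<Rightarrow> ('a \<times> bool) list set" where
  "ret S = raag_lift A (\<lambda>v. if v \<in> S then gen v else \<one>\<^bsub>A\<^esub>)"

lemma ret_hom: "ret S \<in> hom A A"
  and ret_gen: "v \<in> V \<Longrightarrow> ret S (gen v) = (if v \<in> S then gen v else \<one>\<^bsub>A\<^esub>)"
proof -
  have 1: "(\<lambda>v. if v \<in> S then gen v else \<one>\<^bsub>A\<^esub>) \<in> V \<rightarrow> carrier A" by auto
  have 2: "(if v \<in> S then gen v else \<one>\<^bsub>A\<^esub>) \<bullet> (if w \<in> S then gen w else \<one>\<^bsub>A\<^esub>) =
      (if w \<in> S then gen w else \<one>\<^bsub>A\<^esub>) \<bullet> (if v \<in> S then gen v else \<one>\<^bsub>A\<^esub>)" if "(v, w) \<in> E" for v w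
    using that E_subset gen_commute[OF that] by auto
  show "ret S \<in> hom A A" unfolding ret_def by (rule raag_lift_hom[OF A.is_group 1 2])
  show "v \<in> V \<Longrightarrow> ret S (gen v) = (if v \<in> S then gen v else \<one>\<^bsub>A\<^esub>)"
    unfolding ret_def by (rule raag_lift_gen[OF A.is_group 1 2])
qed

lemma group_hom_ret: "group_hom A A (ret S)"
  by (simp add: group_hom_def group_hom_axioms_def A.is_group ret_hom)

lemma ret_closed [simp]: "x \<in> carrier A \<Longrightarrow> ret S x \<in> carrier A"
  using ret_hom by (auto simp: hom_def)

lemma ret_mult [simp]: "x \<in> carrier A \<Longrightarrow> y \<in> carrier A \<Longrightarrow> ret S (x \<bullet> y) = ret S x \<bullet> ret S y"
  using ret_hom by (auto simp: hom_def)

lemma ret_inv [simp]: "x \<in> carrier A \<Longrightarrow> ret S (iv x) = iv (ret S x)"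
  by (rule group_hom.hom_inv[OF group_hom_ret])

lemma ret_one [simp]: "ret S \<one>\<^bsub>A\<^esub> = \<one>\<^bsub>A\<^esub>"
  by (rule group_hom.hom_one[OF group_hom_ret])

lemma ret_conj: "g \<in> carrier A \<Longrightarrow> x \<in> carrier A \<Longrightarrow> ret S (cj g x) = cj (ret S g) (ret S x)"
  by (simp add: A.conj_by_def)

lemma ret_ret: "x \<in> carrier A \<Longrightarrow> ret S (ret T x) = ret (S \<inter> T) x"
proof (induction rule: A_induct)
  case (gen v x) then show ?case by (auto simp: ret_gen)
next
  case (inv v x) then show ?case by (auto simp: ret_gen)
qed simp

text \<open>The subgroup generated by \<open>S\<close>, as the set of fixed points of the retraction onto it.\<close>

definition SP :: "'a set \<Rightarrow> ('a \<times> bool) list set set" where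
  "SP S = {x \<in> carrier A. ret S x = x}"

lemma SP_closed: "x \<in> SP S \<Longrightarrow> x \<in> carrier A" by (simp add: SP_def)

lemma ret_SP: "x \<in> SP S \<Longrightarrow> ret S x = x" by (simp add: SP_def)

lemma ret_in_SP [simp]: "x \<in> carrier A \<Longrightarrow> ret S x \<in> SP S"
  by (simp add: SP_def ret_ret)

lemma SP_mono: "S \<subseteq> T \<Longrightarrow> x \<in> SP S \<Longrightarrow> x \<in> SP T"
  unfolding SP_def by (smt (verit, best) Int_absorb1 mem_Collect_eq ret_ret)

text \<open>Composing the two retractions gives the retraction onto the intersection, so no normal
  form is needed to intersect special subgroups.\<close>

lemma SP_Int: "x \<in> SP S \<Longrightarrow> x \<in> SP T \<Longrightarrow> x \<in> SP (S \<inter> T)"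
  unfolding SP_def by (metis (mono_tags, lifting) mem_Collect_eq ret_ret)

lemma SP_ret: "x \<in> SP T \<Longrightarrow> ret S x \<in> SP (S \<inter> T)"
  by (metis SP_closed ret_SP ret_in_SP ret_ret)

lemma gen_in_SP: "v \<in> V \<Longrightarrow> v \<in> S \<Longrightarrow> gen v \<in> SP S"
  by (simp add: SP_def ret_gen)

lemma SP_one [simp]: "\<one>\<^bsub>A\<^esub> \<in> SP S" by (simp add: SP_def)

lemma SP_mult: "x \<in> SP S \<Longrightarrow> y \<in> SP S \<Longrightarrow> x \<bullet> y \<in> SP S" by (simp add: SP_def)

lemma SP_inv: "x \<in> SP S \<Longrightarrow> iv x \<in> SP S" by (simp add: SP_def)

lemma SP_subgroup: "subgroup (SP S) A"
  by (rule A.subgroupI) (auto simp: SP_closed SP_mult SP_inv intro: SP_one)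

lemma SP_V: "SP V = carrier A"
proof -
  have "ret V x = x" if "x \<in> carrier A" for x
    using that by (induction rule: A_induct) (auto simp: ret_gen)
  then show ?thesis by (auto simp: SP_def)
qed

lemma SP_induct [consumes 1, case_names one gen inv]:
  assumes "x \<in> SP S" and "P \<one>\<^bsub>A\<^esub>"
    and "\<And>v x. v \<in> V \<Longrightarrow> v \<in> S \<Longrightarrow> x \<in> SP S \<Longrightarrow> P x \<Longrightarrow> P (gen v \<bullet> x)"
    and "\<And>v x. v \<in> V \<Longrightarrow> v \<in> S \<Longrightarrow> x \<in> SP S \<Longrightarrow> P x \<Longrightarrow> P (iv (gen v) \<bullet> x)"
  shows "P x"
proof -
  have "P (ret S y)" if "y \<in> carrier A" for y
    using that
  proof (induction rule: A_induct)
    case one then show ?case using assms(2) by simp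
  next
    case (gen v x) then show ?case using assms(3)[of v "ret S x"] by (auto simp: ret_gen)
  next
    case (inv v x) then show ?case using assms(4)[of v "ret S x"] by (auto simp: ret_gen)
  qed
  then show ?thesis using assms(1) by (metis SP_closed ret_SP)
qed

lemma SP_empty: "x \<in> SP {} \<Longrightarrow> x = \<one>\<^bsub>A\<^esub>"
  by (induction rule: SP_induct) auto

lemma SP_commute_elem:
  assumes "x \<in> SP S" "z \<in> carrier A" "\<And>s. s \<in> S \<Longrightarrow> s \<in> V \<Longrightarrow> gen s \<bullet> z = z \<bullet> gen s"
  shows "x \<bullet> z = z \<bullet> x"
  using assms(1)
proof (induction rule: SP_induct)
  case one then show ?case using assms by simp
next
  case (gen v x)
  then show ?case using assms by (intro A.commutes_mult) (auto simp: SP_closed)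
next
  case (inv v x)
  then show ?case using assms by (intro A.commutes_mult A.commutes_inv) (auto simp: SP_closed)
qed

lemma SP_commute_gen:
  assumes "x \<in> SP S" "w \<in> V" "S \<inter> V \<subseteq> star w"
  shows "x \<bullet> gen w = gen w \<bullet> x"
  using assms by (intro SP_commute_elem[OF assms(1)]) (auto simp: star_def link_def dest: gen_commute)

lemma SP_commute_SP:
  assumes "x \<in> SP S" "y \<in> SP T" "\<And>s t. s \<in> S \<Longrightarrow> t \<in> T \<Longrightarrow> (s, t) \<in> E"
  shows "x \<bullet> y = y \<bullet> x"
proof (rule SP_commute_elem[OF assms(1)])
  show "y \<in> carrier A" using assms by (simp add: SP_closed)
  fix s assume s: "s \<in> S" "s \<in> V"
  have "y \<bullet> gen s = gen s \<bullet> y"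
    by (rule SP_commute_gen[OF assms(2) s(2)]) (use assms(3) s in \<open>auto simp: star_def link_def\<close>)
  then show "gen s \<bullet> y = y \<bullet> gen s" by simp
qed

text \<open>All of \<open>S\<close> commutes with \<open>v\<close>, so the powers of
  \<open>v\<close> can be collected in front.\<close>

lemma SP_insert:
  assumes "x \<in> SP (insert v S)" "v \<in> V" "S \<subseteq> link v"
  shows "\<exists>(k::int) y. y \<in> SP S \<and> x = gen v [^]\<^bsub>A\<^esub> k \<bullet> y"
  using assms(1)
proof (induction rule: SP_induct)
  case one
  show ?case by (rule exI[of _ 0], rule exI[of _ "\<one>\<^bsub>A\<^esub>"]) auto
next
  have step: "\<exists>k' y'. y' \<in> SP S \<and> z \<bullet> (gen v [^]\<^bsub>A\<^esub> k \<bullet> y) = gen v [^]\<^bsub>A\<^esub> (k'::int) \<bullet> y'"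
    if "y \<in> SP S" "w \<in> insert v S" "w \<in> V" "z = gen w \<or> z = iv (gen w)" for z w and k :: int and y
  proof (cases "w = v")
    case True
    define e :: int where "e = (if z = gen v then 1 else -1)"
    have z: "z = gen v [^]\<^bsub>A\<^esub> e" using that True assms(2) by (auto simp: e_def A.int_pow_neg A.int_pow_1)
    have "z \<bullet> (gen v [^]\<^bsub>A\<^esub> k \<bullet> y) = gen v [^]\<^bsub>A\<^esub> (e + k) \<bullet> y"
      unfolding z using that assms(2) SP_closed by (simp add: A.int_pow_mult A.m_assoc)
    then show ?thesis using that by blast
  next
    case False
    then have w: "w \<in> S" using that by auto
    have zS: "z \<in> SP S" using that w gen_in_SP SP_inv by auto
    have vk: "gen v [^]\<^bsub>A\<^esub> k \<in> SP {v}"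
      using gen_in_SP[OF assms(2), of "{v}"] subgroup.subgroup_is_group[OF SP_subgroup[of "{v}"] A.is_group]
      by (metis A.subgroup_int_pow_closed SP_subgroup singletonI)
    have "z \<bullet> gen v [^]\<^bsub>A\<^esub> k = gen v [^]\<^bsub>A\<^esub> k \<bullet> z"
      by (rule SP_commute_SP[OF zS vk]) (use assms(3) E_sym in \<open>auto simp: link_def\<close>)
    then have "z \<bullet> (gen v [^]\<^bsub>A\<^esub> k \<bullet> y) = gen v [^]\<^bsub>A\<^esub> k \<bullet> (z \<bullet> y)"
      using SP_closed[OF zS] SP_closed[OF vk] SP_closed[OF that(1)] by (metis A.m_assoc)
    then show ?thesis using SP_mult[OF zS that(1)] by blast
  qed
  {
    case (gen w x) then show ?case using step by metis
  next
    case (inv w x) then show ?case using step by metis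
  }
qed

lemma SP_single: "x \<in> SP {v} \<Longrightarrow> v \<in> V \<Longrightarrow> \<exists>k::int. x = gen v [^]\<^bsub>A\<^esub> k"
  using SP_insert[of x v "{}"] SP_empty by (metis A.int_pow_closed A.r_one empty_subsetI gen_closed)

lemma SP_edge:
  assumes "x \<in> SP {v, w}" "(v, w) \<in> E"
  shows "\<exists>(a::int) (b::int). x = gen v [^]\<^bsub>A\<^esub> a \<bullet> gen w [^]\<^bsub>A\<^esub> b"
proof -
  have "v \<in> V" "w \<in> V" using assms E_subset by auto
  moreover from this obtain a :: int and y where "y \<in> SP {w}" "x = gen v [^]\<^bsub>A\<^esub> a \<bullet> y"
    using SP_insert[OF assms(1)] assms(2) by (auto simp: link_def)
  ultimately show ?thesis using SP_single by blast
qed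

lemma SP_int_pow: "v \<in> V \<Longrightarrow> v \<in> S \<Longrightarrow> gen v [^]\<^bsub>A\<^esub> (k::int) \<in> SP S"
  by (metis A.subgroup_int_pow_closed SP_subgroup gen_in_SP)

section \<open>Exponent sums\<close>

definition ex :: "'a \<Rightarrow> ('a \<times> bool) list set \<Rightarrow> int" where
  "ex v = raag_lift integer_group (\<lambda>w. if w = v then 1 else 0)"

lemma ex_hom: "ex v \<in> hom A integer_group"
  and ex_gen: "w \<in> V \<Longrightarrow> ex v (gen w) = (if w = v then 1 else 0)"
  unfolding ex_def
  by (rule raag_lift_hom raag_lift_gen; simp add: group_integer_group)+

lemma group_hom_ex: "group_hom A integer_group (ex v)"
  by (simp add: group_hom_def group_hom_axioms_def A.is_group ex_hom group_integer_group)

lemma ex_mult [simp]: "x \<in> carrier A \<Longrightarrow> y \<in> carrier A \<Longrightarrow> ex v (x \<bullet> y) = ex v x + ex v y"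
  using ex_hom[of v] by (auto simp: hom_def)

lemma ex_inv [simp]: "x \<in> carrier A \<Longrightarrow> ex v (iv x) = - ex v x"
  using group_hom.hom_inv[OF group_hom_ex] by (simp)

lemma ex_one [simp]: "ex v \<one>\<^bsub>A\<^esub> = 0"
  using group_hom.hom_one[OF group_hom_ex] by simp

lemma ex_conj [simp]: "g \<in> carrier A \<Longrightarrow> x \<in> carrier A \<Longrightarrow> ex v (cj g x) = ex v x"
  by (simp add: A.conj_by_def)

lemma ex_nat_pow: "x \<in> carrier A \<Longrightarrow> ex v (x [^]\<^bsub>A\<^esub> (n::nat)) = int n * ex v x"
  by (induction n) (auto simp: algebra_simps)

lemma ex_int_pow: "x \<in> carrier A \<Longrightarrow> ex v (x [^]\<^bsub>A\<^esub> (k::int)) = k * ex v x"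
  by (cases k rule: int_cases2) (simp_all add: int_pow_int A.int_pow_neg_int ex_nat_pow)

lemma ex_ret: "x \<in> carrier A \<Longrightarrow> ex v (ret S x) = (if v \<in> S then ex v x else 0)"
proof (induction rule: A_induct)
  case (gen w x) then show ?case by (auto simp: ret_gen ex_gen)
next
  case (inv w x) then show ?case by (auto simp: ret_gen ex_gen)
qed simp

text \<open>Sending two non-adjacent generators to the standard generators of the Heisenberg group
  detects whether the exponent vectors of commuting elements are parallel.\<close>

lemma commuting_exponents:
  assumes "x \<in> carrier A" "y \<in> carrier A" "x \<bullet> y = y \<bullet> x" "i \<noteq> j" "(i, j) \<notin> E"
  shows "ex i x * ex j y = ex j x * ex i y"
proof -
  let ?H = heisenberg_group
  let ?f = "\<lambda>v. (if v = i then (1, 0, 0) else if v = j then (0, 1, 0) else (0, 0, 0)) :: int \<times> int \<times> int"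
  let ?h = "raag_lift ?H ?f"
  have ji: "(j, i) \<notin> E" using assms E_sym by blast
  have f: "?f \<in> V \<rightarrow> carrier ?H" by (auto simp: heisenberg_group_def)
  have c: "?f v \<otimes>\<^bsub>?H\<^esub> ?f w = ?f w \<otimes>\<^bsub>?H\<^esub> ?f v" if "(v, w) \<in> E" for v w
    using that assms ji by (auto simp: heisenberg_group_def)
  have h: "?h \<in> hom A ?H" by (rule raag_lift_hom[OF group_heisenberg f c])
  have hg: "v \<in> V \<Longrightarrow> ?h (gen v) = ?f v" for v by (rule raag_lift_gen[OF group_heisenberg f c])
  have 1: "fst \<in> hom ?H integer_group" "(\<lambda>p. fst (snd p)) \<in> hom ?H integer_group"
    by (auto simp: hom_def heisenberg_group_def)
  have e1: "fst (?h z) = ex i z" if "z \<in> carrier A" for z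
    using hom_eqI[OF group_integer_group hom_compose[OF h 1(1)] ex_hom[of i] _ that]
    by (auto simp: hg ex_gen)
  have e2: "fst (snd (?h z)) = ex j z" if "z \<in> carrier A" for z
    using hom_eqI[OF group_integer_group hom_compose[OF h 1(2)] ex_hom[of j] _ that] assms(4)
    by (auto simp: hg ex_gen)
  obtain p q where pq: "?h x = (ex i x, ex j x, p)" "?h y = (ex i y, ex j y, q)"
    using e1[OF assms(1)] e1[OF assms(2)] e2[OF assms(1)] e2[OF assms(2)]
    by (cases "?h x"; cases "?h y") auto
  have "?h x \<otimes>\<^bsub>?H\<^esub> ?h y = ?h y \<otimes>\<^bsub>?H\<^esub> ?h x"
    using hom_mult[OF h assms(1,2)] hom_mult[OF h assms(2,1)] assms(3) by simp
  then have "ex i x * ex j y = ex i y * ex j x" unfolding pq by (simp add: heisenberg_group_def)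
  then show ?thesis by (simp add: mult.commute)
qed

end

section \<open>Reduced words\<close>

fun flip :: "'x \<times> bool \<Rightarrow> 'x \<times> bool" where "flip (x, b) = (x, \<not> b)"

lemma flip_flip [simp]: "flip (flip l) = l" and flip_neq [simp]: "flip l \<noteq> l" "l \<noteq> flip l"
  by (cases l; simp)+

lemma flip_eq_iff: "flip l = m \<longleftrightarrow> l = flip m" by auto

lemma snd_flip [simp]: "snd (flip l) = (\<not> snd l)" and fst_flip [simp]: "fst (flip l) = fst l"
  by (cases l; simp)+

abbreviation reduced :: "('x \<times> bool) list \<Rightarrow> bool" where
  "reduced \<equiv> successively (\<lambda>l m. m \<noteq> flip l)"

text \<open>Left multiplication by a letter in the free group, on reduced words. Accordingly
  \<open>foldr push f q\<close> is the product of the words \<open>f\<close> and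
  \<open>q\<close>.\<close>

definition push :: "'x \<times> bool \<Rightarrow> ('x \<times> bool) list \<Rightarrow> ('x \<times> bool) list" where
  "push l w = (if w \<noteq> [] \<and> hd w = flip l then tl w else l # w)"

definition sgn_sum :: "('x \<times> bool) list \<Rightarrow> int" where
  "sgn_sum w = (\<Sum>l\<leftarrow>w. if snd l then 1 else -1)"

lemma sgn_sum_simps [simp]:
  "sgn_sum [] = 0" "sgn_sum (l # w) = (if snd l then 1 else -1) + sgn_sum w"
  "sgn_sum (v @ w) = sgn_sum v + sgn_sum w"
  by (auto simp: sgn_sum_def)

lemma reduced_push: "reduced w \<Longrightarrow> reduced (push l w)"
  by (cases w) (auto simp: push_def successively_Cons)

lemma push_push: "reduced w \<Longrightarrow> push (flip l) (push l w) = w"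
  by (cases w) (auto simp: push_def successively_Cons)

lemma push_push': "reduced w \<Longrightarrow> push l (push (flip l) w) = w"
  using push_push[of w "flip l"] by simp

lemma set_push: "set (push l w) \<subseteq> insert l (set w)"
  by (cases w) (auto simp: push_def)

lemma foldr_push_append: "reduced (f @ q) \<Longrightarrow> foldr push f q = f @ q"
proof (induction f)
  case (Cons l f)
  then have "reduced (f @ q)" by (auto simp: successively_Cons)
  then show ?case using Cons by (auto simp: push_def successively_Cons)
qed simp

lemma foldr_push_cancel: "reduced f \<Longrightarrow> foldr push (f @ [flip l]) [l] = f"
  using foldr_push_append[of f "[]"] by (simp add: push_def)

text \<open>Right multiplication by one letter: only the last letter of the reduced word can
  cancel.\<close>

lemma foldr_push_single:
  assumes "reduced f"
  shows "foldr push f [z] = (if f \<noteq> [] \<and> last f = flip z then butlast f else f @ [z])"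
proof (cases "f \<noteq> [] \<and> last f = flip z")
  case True
  then have f: "f = butlast f @ [flip z]" by (metis append_butlast_last_id)
  have "reduced (butlast f)" using assms f by (metis successively_append_iff)
  then show ?thesis using foldr_push_cancel[of "butlast f" z] f True by simp
next
  case False
  then have "reduced (f @ [z])"
    using assms by (auto simp: successively_append_iff)
  then show ?thesis using False foldr_push_append[of f "[z]"] by auto
qed

text \<open>Turns commutation with a letter into being a power of that letter.\<close>

lemma Cons_eq_snoc: "y # f = f @ [z] \<Longrightarrow> y = z \<and> set f \<subseteq> {y}"
  by (induction f) auto

lemma reduced_rev_flip: "reduced (rev (map flip q)) \<longleftrightarrow> reduced q"
  by (auto simp: successively_map flip_eq_iff intro!: successively_cong)

section \<open>The action on the tree of reduced words over cosets\<close>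

text \<open>The group is an HNN extension of \<open>H\<close> with stable letter \<open>u\<close>,
  which centralises \<open>B\<close>. Equivalently it is the semidirect product of \<open>H\<close>
  with the kernel of \<open>\<rho>\<close>, a free group on the conjugates of \<open>u\<close>
  indexed by the cosets of \<open>B\<close> in \<open>H\<close>.\<close>

locale raag_vertex = raag +
  fixes u assumes uV: "u \<in> V"
begin

abbreviation "H \<equiv> SP (V - {u})"
abbreviation "B \<equiv> SP (link u)"
abbreviation "\<rho> \<equiv> ret (V - {u})"

lemma u_link: "u \<notin> link u" using E_irrefl by (auto simp: link_def)

lemma H_closed: "h \<in> H \<Longrightarrow> h \<in> carrier A" and B_closed: "h \<in> B \<Longrightarrow> h \<in> carrier A"
  by (auto simp: SP_closed)

lemma B_carrier: "B \<subseteq> carrier A" using B_closed by auto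

definition cosets where "cosets = (\<lambda>h. h <#\<^bsub>A\<^esub> B) ` H"

definition letters where "letters = cosets \<times> (UNIV :: bool set)"

text \<open>The free kernel of \<open>\<rho>\<close> as a set. It is in bijection with the cosets of
  \<open>H\<close> in the whole group, which are the vertices of the Bass-Serre tree.\<close>

definition tree where "tree = {p. set p \<subseteq> letters \<and> reduced p}"

text \<open>Conjugation by \<open>\<rho> a\<close> permutes the free basis; on the indexing cosets
  it is left translation. The generator \<open>u\<close> moves no letter, because
  \<open>\<rho>\<close> kills it.\<close>

definition am where "am a l = (\<rho> a <#\<^bsub>A\<^esub> fst l, snd l)"

lemma snd_am [simp]: "snd (am a l) = snd l" by (simp add: am_def)

lemma coset_in: "h \<in> H \<Longrightarrow> h <#\<^bsub>A\<^esub> B \<in> cosets" by (auto simp: cosets_def)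

lemma B_in: "B \<in> cosets"
proof -
  have "\<one>\<^bsub>A\<^esub> <#\<^bsub>A\<^esub> B = B" using A.lcos_mult_one[OF B_carrier] .
  then show ?thesis using coset_in[of "\<one>\<^bsub>A\<^esub>"] by simp
qed

lemma B_letter [simp]: "(B, b) \<in> letters" using B_in by (simp add: letters_def)

lemma flip_letter [simp]: "flip l \<in> letters \<longleftrightarrow> l \<in> letters"
  by (cases l) (simp add: letters_def)

lemma am_coset:
  "a \<in> carrier A \<Longrightarrow> h \<in> H \<Longrightarrow> am a (h <#\<^bsub>A\<^esub> B, b) = ((\<rho> a \<bullet> h) <#\<^bsub>A\<^esub> B, b)"
  using A.lcos_m_assoc[OF B_carrier, of "\<rho> a" h] by (simp add: am_def H_closed)

lemma letterE:
  assumes "l \<in> letters"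
  obtains h b where "h \<in> H" "l = (h <#\<^bsub>A\<^esub> B, b)"
  using assms by (auto simp: cosets_def letters_def)

lemma am_in: "a \<in> carrier A \<Longrightarrow> l \<in> letters \<Longrightarrow> am a l \<in> letters"
  by (elim letterE) (auto simp: am_coset letters_def intro!: coset_in SP_mult)

lemma am_mult: "a \<in> carrier A \<Longrightarrow> c \<in> carrier A \<Longrightarrow> l \<in> letters \<Longrightarrow> am (a \<bullet> c) l = am a (am c l)"
  by (elim letterE) (simp add: am_coset SP_mult H_closed A.m_assoc)

lemma am_one: "l \<in> letters \<Longrightarrow> am \<one>\<^bsub>A\<^esub> l = l"
  by (elim letterE) (simp add: am_coset H_closed)

lemma am_inv:
  assumes "a \<in> carrier A" "l \<in> letters"
  shows "am (iv a) (am a l) = l" "am a (am (iv a) l) = l"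
  using assms am_mult[of "iv a" a l] am_mult[of a "iv a" l] am_one[of l] by simp_all

lemma am_ret: "a \<in> carrier A \<Longrightarrow> am (\<rho> a) l = am a l"
  by (simp add: am_def ret_ret)

lemma am_flip: "am a (flip l) = flip (am a l)" by (cases l) (simp add: am_def)

lemma am_eq_iff:
  "a \<in> carrier A \<Longrightarrow> l \<in> letters \<Longrightarrow> m \<in> letters \<Longrightarrow> am a l = am a m \<longleftrightarrow> l = m"
  using am_inv(1)[of a l] am_inv(1)[of a m] by metis

lemma reduced_map_am:
  assumes "a \<in> carrier A" "set p \<subseteq> letters"
  shows "reduced (map (am a) p) \<longleftrightarrow> reduced p"
proof -
  have "am a m \<noteq> flip (am a l) \<longleftrightarrow> m \<noteq> flip l" if "l \<in> set p" "m \<in> set p" for l m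
  proof -
    have "flip l \<in> letters" using that assms by auto
    then show ?thesis using am_eq_iff[of a m "flip l"] that assms by (auto simp: am_flip)
  qed
  then show ?thesis by (auto simp: successively_map intro!: successively_cong)
qed

lemma map_am_tree: "a \<in> carrier A \<Longrightarrow> p \<in> tree \<Longrightarrow> map (am a) p \<in> tree"
  using reduced_map_am[of a p] am_in[of a] by (auto simp: tree_def)

lemma map_am_inv:
  assumes "a \<in> carrier A" "p \<in> tree"
  shows "map (am (iv a)) (map (am a) p) = p" "map (am a) (map (am (iv a)) p) = p"
proof -
  have "l \<in> letters" if "l \<in> set p" for l using that assms by (auto simp: tree_def)
  then show "map (am (iv a)) (map (am a) p) = p" "map (am a) (map (am (iv a)) p) = p"
    using am_inv[OF assms(1)] by (auto intro!: map_idI)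
qed

lemma map_am_mult:
  "a \<in> carrier A \<Longrightarrow> c \<in> carrier A \<Longrightarrow> p \<in> tree \<Longrightarrow> map (am (a \<bullet> c)) p = map (am a) (map (am c) p)"
  using am_mult[of a c] by (auto simp: tree_def subset_iff)

lemma push_tree: "l \<in> letters \<Longrightarrow> p \<in> tree \<Longrightarrow> push l p \<in> tree"
  using reduced_push[of p l] set_push[of l p] by (auto simp: tree_def)

lemma push_map_am:
  assumes "a \<in> carrier A" "l \<in> letters" "p \<in> tree"
  shows "map (am a) (push l p) = push (am a l) (map (am a) p)"
proof (cases p)
  case (Cons m p')
  have "flip l \<in> letters" using assms by simp
  then have "am a m = flip (am a l) \<longleftrightarrow> m = flip l"
    using am_eq_iff[of a m "flip l"] assms Cons by (auto simp: tree_def am_flip)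
  then show ?thesis by (auto simp: push_def Cons)
qed (auto simp: push_def)

text \<open>This makes the action respect the commutation of \<open>u\<close> with its neighbours:
  they fix the letter that \<open>u\<close> pushes.\<close>

lemma am_link_fixes_B: "w \<in> link u \<Longrightarrow> am (gen w) (B, b) = (B, b)"
proof -
  assume w: "w \<in> link u"
  then have wV: "w \<in> V" "w \<noteq> u" using link_subset u_link by auto
  then have "gen w \<in> B" using gen_in_SP w by simp
  then have "gen w <#\<^bsub>A\<^esub> B = B" using A.coset_join3[OF _ SP_subgroup] wV by simp
  then show ?thesis using wV by (simp add: am_def ret_gen)
qed

text \<open>Restricted to \<open>tree\<close> because the members of \<open>Bij\<close> must be
  undefined outside their domain.\<close>

definition gen_act where
  "gen_act v = (\<lambda>p\<in>tree. if v = u then push (B, True) p else map (am (gen v)) p)"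

lemma gen_act_Bij: "v \<in> V \<Longrightarrow> gen_act v \<in> Bij tree"
proof (cases "v = u")
  case True
  have r: "p \<in> tree \<Longrightarrow> reduced p" for p by (simp add: tree_def)
  have "bij_betw (push (B, True)) tree tree"
    by (rule bij_betw_byWitness[where f' = "push (B, False)"])
      (use push_push[of _ "(B, True)"] push_push'[of _ "(B, True)"] r push_tree B_in in auto)
  then have "bij_betw (gen_act v) tree tree" by (rule bij_betw_cong[THEN iffD1, rotated]) (auto simp: gen_act_def True)
  then show ?thesis by (auto simp: Bij_def gen_act_def)
next
  case False
  assume v: "v \<in> V"
  have "bij_betw (map (am (gen v))) tree tree"
    by (rule bij_betw_byWitness[where f' = "map (am (iv (gen v)))"])
      (use map_am_inv v map_am_tree in auto)
  then have "bij_betw (gen_act v) tree tree" by (rule bij_betw_cong[THEN iffD1, rotated]) (auto simp: gen_act_def False)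
  then show ?thesis by (auto simp: Bij_def gen_act_def)
qed

lemma gen_act_commute:
  assumes "(v, w) \<in> E" "p \<in> tree"
  shows "gen_act v (gen_act w p) = gen_act w (gen_act v p)"
proof -
  have vw: "v \<in> V" "w \<in> V" "v \<noteq> w" using assms E_subset E_irrefl by auto
  have uw: "push (B, True) (map (am (gen w)) q) = map (am (gen w)) (push (B, True) q)"
    if "w \<in> link u" "q \<in> tree" for q w
    using that push_map_am[of "gen w" "(B, True)" q] am_link_fixes_B[of w True] link_subset[of u] by auto
  consider "v = u" | "w = u" | "v \<noteq> u" "w \<noteq> u" by auto
  then show ?thesis
  proof cases
    case 1
    then have "w \<in> link u" "w \<noteq> u" using assms vw by (auto simp: link_def)
    then show ?thesis using 1 uw assms vw B_in by (simp add: gen_act_def map_am_tree push_tree)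
  next
    case 2
    then have "v \<in> link u" "v \<noteq> u" using assms vw E_sym by (auto simp: link_def)
    then show ?thesis using 2 uw assms vw B_in by (simp add: gen_act_def map_am_tree push_tree)
  next
    case 3
    then show ?thesis using assms vw map_am_mult[of "gen v" "gen w" p] map_am_mult[of "gen w" "gen v" p]
      gen_commute[of v w] by (simp add: gen_act_def map_am_tree)
  qed
qed

definition act where "act = raag_lift (BijGroup tree) gen_act"

lemma act_hom: "act \<in> hom A (BijGroup tree)" and act_gen: "v \<in> V \<Longrightarrow> act (gen v) = gen_act v"
proof -
  have 1: "gen_act \<in> V \<rightarrow> carrier (BijGroup tree)" using gen_act_Bij by (auto simp: BijGroup_def)
  have 2: "gen_act v \<otimes>\<^bsub>BijGroup tree\<^esub> gen_act w = gen_act w \<otimes>\<^bsub>BijGroup tree\<^esub> gen_act v" if "(v, w) \<in> E" for v w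
  proof -
    have "v \<in> V" "w \<in> V" using that E_subset by auto
    then show ?thesis using gen_act_commute[OF that] gen_act_Bij
      by (auto simp: BijGroup_def compose_def fun_eq_iff)
  qed
  show "act \<in> hom A (BijGroup tree)" unfolding act_def by (rule raag_lift_hom[OF group_BijGroup 1 2])
  show "v \<in> V \<Longrightarrow> act (gen v) = gen_act v"
    unfolding act_def by (rule raag_lift_gen[OF group_BijGroup 1 2])
qed

lemma act_Bij: "a \<in> carrier A \<Longrightarrow> act a \<in> Bij tree"
  using act_hom by (auto simp: hom_def BijGroup_def)

lemma act_tree [simp]: "a \<in> carrier A \<Longrightarrow> p \<in> tree \<Longrightarrow> act a p \<in> tree"
  using act_Bij[of a] Bij_imp_funcset by fastforce

lemma act_mult: "a \<in> carrier A \<Longrightarrow> c \<in> carrier A \<Longrightarrow> p \<in> tree \<Longrightarrow> act (a \<bullet> c) p = act a (act c p)"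
  using hom_mult[OF act_hom, of a c] act_Bij[of a] act_Bij[of c] by (simp add: BijGroup_def compose_def)

lemma act_one: "p \<in> tree \<Longrightarrow> act \<one>\<^bsub>A\<^esub> p = p"
  using hom_one[OF act_hom A.is_group group_BijGroup] by (simp add: BijGroup_def)

lemma act_inv:
  assumes "a \<in> carrier A" "p \<in> tree"
  shows "act (iv a) (act a p) = p" "act a (act (iv a) p) = p"
  using assms act_mult[of "iv a" a p] act_mult[of a "iv a" p] by (simp_all add: act_one)

lemma act_u: "p \<in> tree \<Longrightarrow> act (gen u) p = push (B, True) p"
  by (simp add: act_gen uV gen_act_def)

lemma act_eqI_inv:
  assumes "a \<in> carrier A" "p \<in> tree" "q \<in> tree" "act a q = p"
  shows "act (iv a) p = q"
  using act_inv(1)[of a q] assms by auto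

lemma act_u_inv: "p \<in> tree \<Longrightarrow> act (iv (gen u)) p = push (B, False) p"
  using push_push'[of p "(B, True)"] push_tree[of "(B, False)" p] B_in uV
  by (intro act_eqI_inv) (auto simp: act_u tree_def)

lemma act_H: "h \<in> H \<Longrightarrow> p \<in> tree \<Longrightarrow> act h p = map (am h) p"
proof (induction arbitrary: p rule: SP_induct)
  case one
  then show ?case using am_one by (auto simp: act_one tree_def subset_iff intro!: map_idI[symmetric])
next
  case (gen v x)
  then have "act (gen v) q = map (am (gen v)) q" if "q \<in> tree" for q
    using that by (simp add: act_gen gen_act_def)
  then show ?case using gen by (simp add: act_mult H_closed map_am_mult[of "gen v" x] map_am_tree)
next
  case (inv v x)
  then have g: "act (gen v) q = map (am (gen v)) q" if "q \<in> tree" for q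
    using that by (simp add: act_gen gen_act_def)
  have "act (iv (gen v)) q = map (am (iv (gen v))) q" if "q \<in> tree" for q
    by (rule act_eqI_inv) (use inv that g map_am_tree map_am_inv in auto)
  then show ?case using inv by (simp add: act_mult H_closed map_am_mult[of "iv (gen v)" x] map_am_tree)
qed

text \<open>The generator \<open>u\<close> is centralised by \<open>B\<close>, so a coset of \<open>B\<close> determines a conjugate of \<open>u\<close>.\<close>

definition \<kappa> where "\<kappa> Y = cj (SOME h. h \<in> Y) (gen u)"

abbreviation "\<tau> \<equiv> word_val A \<kappa>"

lemma \<kappa>_coset:
  assumes "h \<in> H"
  shows "\<kappa> (h <#\<^bsub>A\<^esub> B) = cj h (gen u)"
proof -
  have "h \<bullet> \<one>\<^bsub>A\<^esub> \<in> h <#\<^bsub>A\<^esub> B" unfolding l_coset_def using SP_one[of "link u"] by blast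
  then have "(SOME h'. h' \<in> h <#\<^bsub>A\<^esub> B) \<in> h <#\<^bsub>A\<^esub> B" by (rule someI)
  then obtain b where b: "b \<in> B" "(SOME h'. h' \<in> h <#\<^bsub>A\<^esub> B) = h \<bullet> b" by (auto simp: l_coset_def)
  have "b \<bullet> gen u = gen u \<bullet> b"
    by (rule SP_commute_gen[OF b(1) uV]) (auto simp: star_def)
  then have "cj b (gen u) = gen u" using b B_closed uV by (simp add: A.conj_by_fix_iff)
  then show ?thesis unfolding \<kappa>_def b(2) using assms b uV by (simp add: A.conj_by_mult H_closed B_closed)
qed

lemma \<kappa>_closed: "\<kappa> \<in> cosets \<rightarrow> carrier A"
  by (auto simp: cosets_def \<kappa>_coset H_closed uV)

lemma \<kappa>_B: "\<kappa> B = gen u"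
  using \<kappa>_coset[of "\<one>\<^bsub>A\<^esub>"] A.lcos_mult_one[OF B_carrier] uV by simp

lemma tree_lists: "p \<in> tree \<Longrightarrow> p \<in> lists (letters)"
  by (auto simp: tree_def)

lemma \<tau>_closed: "p \<in> lists (letters) \<Longrightarrow> \<tau> p \<in> carrier A"
  using A.word_val_closed[OF \<kappa>_closed] by (simp add: letters_def)

lemma lv_closed: "l \<in> letters \<Longrightarrow> letter_val A \<kappa> l \<in> carrier A"
  using A.letter_val_closed[OF \<kappa>_closed] by (simp add: letters_def)

lemma lv_flip: "l \<in> letters \<Longrightarrow> letter_val A \<kappa> (flip l) = iv (letter_val A \<kappa> l)"
  using funcset_mem[OF \<kappa>_closed, of "fst l"] by (cases l) (simp add: letters_def)

lemma \<tau>_push: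
  assumes "l \<in> letters" "p \<in> tree"
  shows "\<tau> (push l p) = letter_val A \<kappa> l \<bullet> \<tau> p"
proof (cases "p \<noteq> [] \<and> hd p = flip l")
  case True
  then obtain q where q: "p = flip l # q" by (cases p) auto
  then have "q \<in> lists (letters)" using assms tree_lists by fastforce
  then show ?thesis using assms by (simp add: q push_def lv_flip \<tau>_closed lv_closed)
next
  case False
  then show ?thesis by (auto simp: push_def)
qed

lemma lv_am:
  assumes "a \<in> carrier A" "l \<in> letters"
  shows "letter_val A \<kappa> (am a l) = cj (\<rho> a) (letter_val A \<kappa> l)"
proof -
  obtain h b where l: "h \<in> H" "l = (h <#\<^bsub>A\<^esub> B, b)" using assms letterE by metis
  have "\<rho> a \<bullet> h \<in> H" using l assms by (simp add: SP_mult)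
  then have "\<kappa> ((\<rho> a \<bullet> h) <#\<^bsub>A\<^esub> B) = cj (\<rho> a) (\<kappa> (h <#\<^bsub>A\<^esub> B))"
    using l assms uV by (simp add: \<kappa>_coset A.conj_by_mult H_closed)
  then show ?thesis using l assms uV
    by (simp add: am_coset A.conj_by_inv \<kappa>_coset H_closed)
qed

lemma \<tau>_map_am:
  assumes "a \<in> carrier A" "p \<in> lists (letters)"
  shows "\<tau> (map (am a) p) = cj (\<rho> a) (\<tau> p)"
  using assms(2)
proof (induction p)
  case Nil then show ?case using assms by simp
next
  case (Cons l p)
  have "l \<in> letters" using Cons by auto
  then show ?case using Cons assms by (simp add: lv_am A.conj_by_mult_right lv_closed \<tau>_closed)
qed

lemma \<tau>_gen_act:
  assumes "v \<in> V" "p \<in> tree"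
  shows "gen v \<bullet> \<tau> p = \<tau> (act (gen v) p) \<bullet> \<rho> (gen v)"
proof (cases "v = u")
  case True
  then show ?thesis using assms B_in \<tau>_closed[OF tree_lists[OF assms(2)]]
    by (simp add: act_u \<tau>_push \<kappa>_B ret_gen)
next
  case False
  then have "\<rho> (gen v) = gen v" "act (gen v) p = map (am (gen v)) p"
    using assms by (auto simp: ret_gen act_gen gen_act_def)
  then show ?thesis using assms \<tau>_closed[OF tree_lists[OF assms(2)]]
    by (simp add: \<tau>_map_am tree_lists A.conj_by_def A.m_assoc)
qed

text \<open>Evaluation of words is equivariant if \<open>a\<close> acts on the kernel of
  \<open>\<rho>\<close> by sending x to a x \<rho>(a)^-1. Applied to the empty word this splits
  \<open>a\<close> into a kernel part and a part in \<open>H\<close>.\<close>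

lemma \<tau>_act:
  assumes "a \<in> carrier A" "p \<in> tree"
  shows "a \<bullet> \<tau> p = \<tau> (act a p) \<bullet> \<rho> a"
  using assms(1)
proof (induction rule: A_induct)
  case one
  then show ?case using assms \<tau>_closed[OF tree_lists[OF assms(2)]] by (simp add: act_one)
next
  note tc = \<tau>_closed[OF tree_lists]
  case (gen v x)
  have "gen v \<bullet> x \<bullet> \<tau> p = gen v \<bullet> (\<tau> (act x p) \<bullet> \<rho> x)"
    using gen assms tc by (simp add: A.m_assoc)
  also have "\<dots> = \<tau> (act (gen v) (act x p)) \<bullet> \<rho> (gen v) \<bullet> \<rho> x"
    using gen assms tc \<tau>_gen_act[of v "act x p"] by (simp flip: A.m_assoc)
  finally show ?case using gen assms tc by (simp add: A.m_assoc act_mult)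
next
  note tc = \<tau>_closed[OF tree_lists]
  case (inv v x)
  let ?q = "act (iv (gen v)) (act x p)"
  have q: "?q \<in> tree" "act (gen v) ?q = act x p" using inv assms act_inv by auto
  have "gen v \<bullet> \<tau> ?q = \<tau> (act x p) \<bullet> \<rho> (gen v)" using \<tau>_gen_act[OF inv(1) q(1)] q by simp
  then have "iv (gen v) \<bullet> (gen v \<bullet> \<tau> ?q) \<bullet> iv (\<rho> (gen v)) =
      iv (gen v) \<bullet> (\<tau> (act x p) \<bullet> \<rho> (gen v)) \<bullet> iv (\<rho> (gen v))" by simp
  then have e: "\<tau> ?q \<bullet> iv (\<rho> (gen v)) = iv (gen v) \<bullet> \<tau> (act x p)"
    using inv assms q tc by (simp add: A.m_assoc)
  have "iv (gen v) \<bullet> x \<bullet> \<tau> p = iv (gen v) \<bullet> (\<tau> (act x p) \<bullet> \<rho> x)"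
    using inv assms tc by (simp add: A.m_assoc)
  also have "\<dots> = \<tau> ?q \<bullet> iv (\<rho> (gen v)) \<bullet> \<rho> x"
    unfolding e using inv assms tc by (simp add: A.m_assoc)
  finally show ?case using inv assms tc q by (simp add: A.m_assoc act_mult)
qed

lemma Nil_tree [simp]: "[] \<in> tree" by (simp add: tree_def)

text \<open>The image of the base vertex, that is, the coset of \<open>H\<close> containing
  \<open>a\<close>; as a word it is the component of \<open>a\<close> in the free kernel.\<close>

definition nf where "nf a = act a []"

lemma nf_tree [simp]: "a \<in> carrier A \<Longrightarrow> nf a \<in> tree" by (simp add: nf_def)

lemma nf_decomp: "a \<in> carrier A \<Longrightarrow> a = \<tau> (nf a) \<bullet> \<rho> a"
  using \<tau>_act[of a "[]"] by (simp add: nf_def)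

lemma nf_mult: "a \<in> carrier A \<Longrightarrow> c \<in> carrier A \<Longrightarrow> nf (a \<bullet> c) = act a (nf c)"
  by (simp add: nf_def act_mult)

text \<open>The value of a letter is a conjugate h u h^-1 or its inverse: translating back by h,
  pushing the letter of the trivial coset and translating forward pushes the letter itself.\<close>

lemma act_letter:
  assumes "l \<in> letters" "p \<in> tree"
  shows "act (letter_val A \<kappa> l) p = push l p"
proof -
  obtain h b where l: "h \<in> H" "l = (h <#\<^bsub>A\<^esub> B, b)" using assms letterE by metis
  let ?x = "if b then gen u else iv (gen u)"
  have ih: "iv h \<in> H" and hc: "h \<in> carrier A" and xc: "?x \<in> carrier A" using l SP_inv H_closed uV by auto
  have v: "letter_val A \<kappa> l = h \<bullet> ?x \<bullet> iv h"
    using l hc uV by (auto simp: \<kappa>_coset A.conj_by_def A.inv_mult_group A.m_assoc)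
  have "act (letter_val A \<kappa> l) p = act h (act ?x (act (iv h) p))"
    unfolding v using hc xc assms by (simp add: act_mult)
  also have "\<dots> = map (am h) (push (B, b) (map (am (iv h)) p))"
    using hc xc assms l ih B_in by (auto simp: act_H act_u act_u_inv map_am_tree push_tree)
  also have "\<dots> = push (am h (B, b)) (map (am h) (map (am (iv h)) p))"
    using hc assms B_in map_am_tree[of "iv h" p] by (intro push_map_am) auto
  also have "\<dots> = push (am h (B, b)) p" by (simp only: map_am_inv(2)[OF hc assms(2)])
  also have "am h (B, b) = l"
    using am_coset[OF hc SP_one, of b] A.lcos_mult_one[OF B_carrier] l hc by (simp add: ret_SP)
  finally show ?thesis .
qed

lemma act_\<tau>:
  assumes "f \<in> lists (letters)" "p \<in> tree"
  shows "act (\<tau> f) p = foldr push f p \<and> foldr push f p \<in> tree"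
  using assms(1)
proof (induction f)
  case Nil then show ?case using assms by (simp add: act_one)
next
  case (Cons l f)
  have "l \<in> letters" using Cons by auto
  then show ?case using Cons assms by (simp add: act_mult lv_closed \<tau>_closed act_letter push_tree)
qed

text \<open>Freeness of the kernel: a reduced word over the conjugates of \<open>u\<close> can be
  recovered from its value.\<close>

lemma nf_\<tau>: "q \<in> tree \<Longrightarrow> nf (\<tau> q) = q"
  using act_\<tau>[of q "[]"] foldr_push_append[of q "[]"] by (simp add: nf_def tree_lists) (simp add: tree_def)

text \<open>The action in semidirect form: the \<open>H\<close>-part of \<open>a\<close> relabels
  the letters, then its kernel part multiplies from the left.\<close>

lemma act_eq:
  assumes "a \<in> carrier A" "p \<in> tree"
  shows "act a p = foldr push (nf a) (map (am a) p)"
proof -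
  have t: "\<tau> (nf a) \<in> carrier A" using assms by (simp add: \<tau>_closed tree_lists)
  have "act a p = act (\<tau> (nf a) \<bullet> \<rho> a) p" using nf_decomp[OF assms(1)] by simp
  also have "\<dots> = act (\<tau> (nf a)) (map (am (\<rho> a)) p)" using assms t by (simp add: act_mult act_H)
  also have "map (am (\<rho> a)) p = map (am a) p" using assms by (simp add: am_ret)
  finally show ?thesis using assms act_\<tau>[of "nf a" "map (am a) p"] by (simp add: tree_lists map_am_tree)
qed

lemma ex_\<tau>: "p \<in> lists (letters) \<Longrightarrow> ex u (\<tau> p) = sgn_sum p"
proof (induction p)
  case (Cons l p)
  obtain h b where l: "h \<in> H" "l = (h <#\<^bsub>A\<^esub> B, b)" using Cons letterE by (metis Cons_in_lists_iff)
  then show ?case using Cons uV H_closed \<tau>_closed[of p] lv_closed[of l]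
    by (auto simp: \<kappa>_coset ex_gen)
qed simp

lemma ex_nf: "a \<in> carrier A \<Longrightarrow> ex u a = sgn_sum (nf a)"
proof -
  assume a: "a \<in> carrier A"
  have "ex u a = ex u (\<tau> (nf a) \<bullet> \<rho> a)" using nf_decomp[OF a] by simp
  also have "\<dots> = sgn_sum (nf a)" using a by (simp add: ex_ret ex_\<tau> tree_lists \<tau>_closed)
  finally show ?thesis .
qed

end

section \<open>Centralisers of generators and conjugation into links\<close>

context raag_vertex begin

lemma tree_reduced: "p \<in> tree \<Longrightarrow> reduced p" by (simp add: tree_def)

lemma stabilizer_B: "h \<in> carrier A \<Longrightarrow> h <#\<^bsub>A\<^esub> B = B \<Longrightarrow> h \<in> B"
proof -
  assume h: "h \<in> carrier A" "h <#\<^bsub>A\<^esub> B = B"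
  have "h \<bullet> \<one>\<^bsub>A\<^esub> \<in> h <#\<^bsub>A\<^esub> B" unfolding l_coset_def using SP_one[of "link u"] by blast
  then show "h \<in> B" using h by simp
qed

text \<open>Reading a u = u a in the free kernel gives f z = y f, where f is \<open>nf a\<close>, y
  is the letter of \<open>u\<close> and z its translate under \<open>a\<close>. By length,
  cancellation occurs on both sides or on neither. In both cases y = z and f is a power of y;
  equality of the letters says that \<open>\<rho> a\<close> stabilises the coset
  \<open>B\<close>.\<close>

lemma centralizer_u:
  assumes "a \<in> carrier A" "a \<bullet> gen u = gen u \<bullet> a"
  shows "a \<in> SP (star u)"
proof -
  let ?y = "(B, True)" and ?f = "nf a"
  let ?z = "am a ?y"
  have f: "?f \<in> tree" "reduced ?f" using assms tree_reduced by auto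
  have u1: "nf (gen u) = [?y]" by (simp add: nf_def act_u push_def)
  have "push ?y ?f = act a [?y]"
    using nf_mult[of a "gen u"] nf_mult[of "gen u" a] assms uV f by (simp add: u1 act_u)
  also have "\<dots> = foldr push ?f [?z]" using assms by (subst act_eq) (auto simp: tree_def)
  finally have eq: "push ?y ?f = (if ?f \<noteq> [] \<and> last ?f = flip ?z then butlast ?f else ?f @ [?z])"
    using foldr_push_single[OF f(2), of ?z] by simp
  have key: "?y = ?z \<and> set ?f \<subseteq> {?y, flip ?y}"
  proof (cases "?f \<noteq> [] \<and> hd ?f = flip ?y")
    case True
    have len: "length (push ?y ?f) = length ?f - 1" using True by (simp add: push_def)
    have last: "last ?f = flip ?z"
    proof (rule ccontr)
      assume "last ?f \<noteq> flip ?z"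
      then have "length (push ?y ?f) = length ?f + 1" by (simp add: eq)
      then show False using len by simp
    qed
    have "tl ?f = butlast ?f" using eq True last by (simp add: push_def)
    then have "flip ?y # tl ?f = tl ?f @ [flip ?z]"
      using True last by (metis append_butlast_last_id list.collapse)
    from Cons_eq_snoc[OF this] have *: "flip ?y = flip ?z" "set (tl ?f) \<subseteq> {flip ?y}" by auto
    have "?y = ?z" using arg_cong[OF *(1), of flip] by (simp only: flip_flip)
    moreover have "set ?f \<subseteq> {?y, flip ?y}" using *(2) True by (cases ?f) auto
    ultimately show ?thesis by blast
  next
    case False
    then have p: "push ?y ?f = ?y # ?f" by (auto simp: push_def)
    have "\<not> (?f \<noteq> [] \<and> last ?f = flip ?z)"
    proof
      assume "?f \<noteq> [] \<and> last ?f = flip ?z"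
      then have "length (push ?y ?f) = length ?f - 1" by (simp add: eq)
      then show False using p by simp
    qed
    then have "?y # ?f = ?f @ [?z]" using eq p by argo
    from Cons_eq_snoc[OF this] show ?thesis by auto
  qed
  have "\<rho> a <#\<^bsub>A\<^esub> B = B" using key by (auto simp: am_def)
  then have r: "\<rho> a \<in> SP (star u)"
    using stabilizer_B[of "\<rho> a"] assms SP_mono[of "link u" "star u"] by (auto simp: star_def)
  have gu: "gen u \<in> SP (star u)" using gen_in_SP[OF uV] by (simp add: star_def)
  have "\<tau> w \<in> SP (star u)" if "set w \<subseteq> {?y, flip ?y}" for w
    using that by (induction w) (auto simp: \<kappa>_B gu SP_inv intro!: SP_mult)
  then have "\<tau> ?f \<bullet> \<rho> a \<in> SP (star u)" using key r by (intro SP_mult) auto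
  then show ?thesis using nf_decomp[OF assms(1)] by simp
qed

text \<open>Conjugation is twisted in the free kernel: the letter that arrives on the right has been
  translated by \<open>g\<close>.\<close>

lemma nf_conj_letter:
  assumes "g \<in> carrier A" "y \<in> letters"
  shows "nf (cj (iv (letter_val A \<kappa> y)) g) = push (flip y) (foldr push (nf g) [am g y])"
proof -
  let ?t = "letter_val A \<kappa> y"
  have t: "?t \<in> carrier A" using assms lv_closed by simp
  have y: "[y] \<in> tree" "nf ?t = [y]"
    using assms act_letter[of y "[]"] by (auto simp: tree_def nf_def push_def)
  have "nf (cj (iv ?t) g) = nf (iv ?t \<bullet> (g \<bullet> ?t))" using assms t by (simp add: A.conj_by_def A.m_assoc)
  also have "\<dots> = act (iv ?t) (act g [y])" using assms t y by (simp add: nf_mult)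
  also have "\<dots> = push (flip y) (act g [y])"
    using act_letter[of "flip y" "act g [y]"] assms y lv_flip[of y] by simp
  also have "act g [y] = foldr push (nf g) [am g y]" using act_eq[OF assms(1) y(1)] by simp
  finally show ?thesis .
qed

text \<open>Conjugating by an element of \<open>H\<close> only relabels the letters.\<close>

lemma nf_conj_H:
  assumes "x \<in> carrier A" "h \<in> H"
  shows "length (nf (cj (iv h) x)) = length (nf x)"
proof -
  have h: "h \<in> carrier A" "iv h \<in> H" using assms H_closed SP_inv by auto
  have "nf h = []" using assms by (simp add: nf_def act_H)
  then have "nf (cj (iv h) x) = map (am (iv h)) (act x [])"
    using assms h by (simp add: A.conj_by_def A.m_assoc nf_mult act_H)
  then show ?thesis by (simp add: nf_def)
qed

lemma \<tau>_inv:
  "q \<in> lists letters \<Longrightarrow> iv (\<tau> q) = \<tau> (rev (map flip q))"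
proof (induction q)
  case (Cons l q)
  have l: "l \<in> letters" "q \<in> lists letters" using Cons by auto
  have q': "rev (map flip q) \<in> lists letters" using l by (auto simp: in_lists_conv_set)
  have "\<tau> (rev (map flip q) @ [flip l]) = \<tau> (rev (map flip q)) \<bullet> \<tau> [flip l]"
    by (rule A.word_val_append[OF \<kappa>_closed]) (use l q' in \<open>simp_all add: letters_def[symmetric] del: flip.simps\<close>)
  then show ?case using Cons l by (simp add: A.inv_mult_group lv_closed \<tau>_closed lv_flip)
qed simp

text \<open>If the cyclic word of \<open>g\<close> has minimal length and total exponent zero, then every conjugator that
  keeps the length moves along the axis of \<open>g\<close>, where the exponent sum is periodic.\<close>

lemma conj_min_exponent:
  assumes "g \<in> carrier A" "nf g \<noteq> []" "ex u g = 0"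
    and "\<And>c. c \<in> carrier A \<Longrightarrow> length (nf g) \<le> length (nf (cj (iv c) g))"
    and "q \<in> tree" "length (nf (cj (iv (\<tau> q)) g)) \<le> length (nf g)"
  shows "\<exists>i \<le> length (nf g). sgn_sum q = sgn_sum (take i (nf g))"
  using assms
proof (induction q arbitrary: g)
  case Nil
  show ?case by (rule exI[of _ 0]) simp
next
  case (Cons y q)
  let ?f = "nf g" and ?z = "am g y" and ?t = "letter_val A \<kappa> y"
  \<comment> \<open>The first letter of the conjugator is absorbed into \<open>g\<close>, so that
    the induction hypothesis applies to the remaining letters.\<close>
  define g' where "g' = cj (iv ?t) g"
  have y: "y \<in> letters" and qt: "q \<in> tree" and q: "\<tau> q \<in> carrier A"
    using Cons.prems(5) \<tau>_closed[of q] by (auto simp: tree_def successively_Cons)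
  have t: "?t \<in> carrier A" using y lv_closed by simp
  have g': "g' \<in> carrier A" "ex u g' = 0" using Cons.prems t by (auto simp: g'_def)
  have f: "?f \<in> tree" "reduced ?f" using Cons.prems tree_reduced by auto
  have z: "?z \<in> letters" "snd ?z = snd y" using y Cons.prems am_in by auto
  have sum0: "sgn_sum ?f = 0" using Cons.prems ex_nf by simp
  have fg': "nf g' = push (flip y) (if last ?f = flip ?z then butlast ?f else ?f @ [?z])"
    unfolding g'_def nf_conj_letter[OF Cons.prems(1) y] foldr_push_single[OF f(2)]
    using Cons.prems(2) by simp
  have conj': "cj (iv c) g' = cj (iv (?t \<bullet> c)) g" if "c \<in> carrier A" for c
    using that t Cons.prems(1) by (simp add: g'_def A.inv_mult_group A.conj_by_mult)
  have min: "length ?f \<le> length (nf (cj (iv c) g'))" if "c \<in> carrier A" for c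
    using that t Cons.prems(4)[of "?t \<bullet> c"] conj'[OF that] by simp
  have min': "length ?f \<le> length (nf g')" using min[of "\<one>\<^bsub>A\<^esub>"] g' by simp
  have IH: "\<exists>i \<le> length (nf g'). sgn_sum q = sgn_sum (take i (nf g'))"
    if "length (nf g') = length ?f"
  proof (rule Cons.IH[OF g'(1) _ g'(2) _ qt])
    show "nf g' \<noteq> []" using that Cons.prems(2) by auto
    show "length (nf g') \<le> length (nf (cj (iv c) g'))" if "c \<in> carrier A" for c
      using min[OF that] \<open>length (nf g') = length ?f\<close> by simp
    show "length (nf (cj (iv (\<tau> q)) g')) \<le> length (nf g')"
      using Cons.prems(6) that conj'[OF q] by simp
  qed
  \<comment> \<open>Conjugation by \<open>y\<close> rotates the cyclic word by one letter, forwards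
    in case \<open>left\<close> and backwards in case \<open>right\<close>. In case
    \<open>none\<close> nothing cancels, and the whole conjugator survives at both ends.\<close>
  consider (left) "hd ?f = y" | (right) "hd ?f \<noteq> y" "last ?f = flip ?z"
    | (none) "hd ?f \<noteq> y" "last ?f \<noteq> flip ?z" by blast
  then show ?case
  proof cases
    case left
    then obtain f' where f': "?f = y # f'" using Cons.prems(2) by (cases ?f) auto
    \<comment> \<open>Cancellation at both ends would shorten the word, against minimality.\<close>
    have "last ?f \<noteq> flip ?z"
    proof
      assume l: "last ?f = flip ?z"
      have "f' \<noteq> []"
      proof
        assume "f' = []"
        then have "snd y = snd (flip ?z)" using l f' by (metis last.simps)
        then show False using z(2) unfolding snd_flip by blast
      qed
      then have "nf g' = butlast f'" using fg' l f' by (simp add: push_def)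
      then show False using min' f' by simp
    qed
    then have fr: "nf g' = f' @ [?z]" using fg' f' by (simp add: push_def)
    then obtain i where i: "i \<le> length ?f" "sgn_sum q = sgn_sum (take i (f' @ [?z]))"
      using IH f' by auto
    show ?thesis
    proof (cases "i = length ?f")
      case True
      \<comment> \<open>A full turn contributes 0, since the translate \<open>?z\<close> keeps the
        sign of \<open>y\<close>; only the letter \<open>y\<close> itself is left.\<close>
      then have "sgn_sum q = sgn_sum ?f" using i f' z by simp
      then have "sgn_sum (y # q) = sgn_sum (take 1 ?f)" using sum0 f' by simp
      then show ?thesis using f' by (intro exI[of _ 1]) simp
    next
      case False
      then have "sgn_sum (y # q) = sgn_sum (take (Suc i) ?f)" using i f' by simp
      then show ?thesis using i False by (intro exI[of _ "Suc i"]) simp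
    qed
  next
    case right
    obtain b where fb: "?f = b @ [flip ?z]" using right Cons.prems(2) by (metis append_butlast_last_id)
    have "\<not> (b \<noteq> [] \<and> hd b = y)" using right(1) fb by (metis hd_append2)
    then have fr: "nf g' = flip y # b" using fg' right fb by (auto simp: push_def)
    have len: "length ?f = Suc (length b)" by (simp add: fb)
    have "length (nf g') = length ?f" by (simp add: fr len)
    from IH[OF this] obtain i where i: "i \<le> length ?f" "sgn_sum q = sgn_sum (take i (flip y # b))"
      unfolding fr len by auto
    \<comment> \<open>The total is 0 and the removed letter has the sign opposite to
      \<open>y\<close>, so the rest of the word carries the sign of \<open>y\<close>.\<close>
    have sb: "sgn_sum b = (if snd y then 1 else -1)"
      using sum0 z(2) by (simp add: fb split: if_splits)
    have tk: "take j ?f = take j b" if "j \<le> length b" for j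
      using that by (simp add: fb)
    show ?thesis
    proof (cases i)
      case 0
      then have "sgn_sum (y # q) = sgn_sum (take (length b) ?f)" using i sb tk[of "length b"] by simp
      then show ?thesis using len by (intro exI[of _ "length b"]) simp
    next
      case (Suc j)
      then have "sgn_sum (y # q) = sgn_sum (take j ?f)" using i len tk[of j] by simp
      then show ?thesis using i Suc by (intro exI[of _ j]) simp
    qed
  next
    case none
    let ?q = "y # q"
    let ?r = "rev (map flip ?q)"
    have qc: "\<tau> ?q \<in> carrier A" and ql: "?q \<in> lists letters"
      using \<tau>_closed[OF tree_lists[OF Cons.prems(5)]] tree_lists[OF Cons.prems(5)] by auto
    have r1: "reduced (?f @ map (am g) ?q)"
      using f none Cons.prems(1,2,5) reduced_map_am[of g ?q]
      by (auto simp: successively_append_iff tree_def flip_eq_iff)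
    have hd: "hd (?f @ map (am g) ?q) \<noteq> flip (last ?r)"
      using none Cons.prems(2) by (cases ?f) auto
    \<comment> \<open>Neither junction cancels, so the conjugated word is longer than the word of
      \<open>g\<close> by twice the length of the conjugator.\<close>
    have r2: "reduced (?r @ ?f @ map (am g) ?q)"
      using r1 hd Cons.prems(2,5) reduced_rev_flip[of ?q]
      by (subst successively_append_iff) (auto simp: tree_def)
    have rl: "?r \<in> lists letters" using ql by (auto simp: in_lists_conv_set)
    have "nf (cj (iv (\<tau> ?q)) g) = act (iv (\<tau> ?q)) (act g (nf (\<tau> ?q)))"
      using Cons.prems(1) qc by (simp add: A.conj_by_def A.m_assoc nf_mult del: word_val_simps)
    also have "act g (nf (\<tau> ?q)) = ?f @ map (am g) ?q"
      using Cons.prems(1,5) foldr_push_append[OF r1] by (simp only: nf_\<tau> act_eq)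
    also have "act (iv (\<tau> ?q)) \<dots> = ?r @ ?f @ map (am g) ?q"
    proof -
      have m: "?f @ map (am g) ?q \<in> tree"
        using \<open>act g (nf (\<tau> ?q)) = ?f @ map (am g) ?q\<close> qc Cons.prems(1) by (metis act_tree nf_tree)
      show ?thesis using act_\<tau>[OF rl m] foldr_push_append[OF r2] \<tau>_inv[OF ql] by simp
    qed
    finally have "length (nf (cj (iv (\<tau> ?q)) g)) > length ?f" by simp
    then show ?thesis using Cons.prems(6) by simp
  qed
qed

text \<open>Conjugate so that the word of \<open>g\<close> is shortest. If it is empty,
  \<open>g\<close> lies in \<open>H\<close> and fixes the word of \<open>h\<close>, which is
  non-empty; hence \<open>g\<close> stabilises a coset of \<open>B\<close>. Otherwise all powers of
  \<open>h\<close> fix \<open>g\<close> under conjugation, and \<open>conj_min_exponent\<close>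
  bounds their exponent sums, although these grow linearly.\<close>

lemma commuting_conj_into_link:
  assumes g: "g \<in> carrier A" and h: "h \<in> carrier A" and gh: "g \<bullet> h = h \<bullet> g"
    and exg: "ex u g = 0" and exh: "ex u h \<noteq> 0"
  shows "\<exists>c\<in>carrier A. cj c g \<in> SP (link u)"
proof -
  define m where "m c = length (nf (cj (iv c) g))" for c
  obtain c where c: "c \<in> carrier A" "\<And>d. d \<in> carrier A \<Longrightarrow> m c \<le> m d"
    using ex_has_least_nat[of "\<lambda>c. c \<in> carrier A" "\<one>\<^bsub>A\<^esub>" m] by auto
  define g' where "g' = cj (iv c) g"
  define h' where "h' = cj (iv c) h"
  have g': "g' \<in> carrier A" "ex u g' = 0" and h': "h' \<in> carrier A" "ex u h' \<noteq> 0"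
    using g h c exg exh by (auto simp: g'_def h'_def)
  have gh': "g' \<bullet> h' = h' \<bullet> g'"
    unfolding g'_def h'_def using A.commutes_conj_by[OF _ g h gh] c by simp
  have min: "length (nf g') \<le> length (nf (cj (iv d) g'))" if "d \<in> carrier A" for d
    using c(2)[of "c \<bullet> d"] c(1) that g by (simp add: m_def g'_def A.inv_mult_group A.conj_by_mult)
  show ?thesis
  proof (cases "nf g' = []")
    case True
    then have gH: "g' = \<rho> g'" using nf_decomp[OF g'(1)] g' by simp
    have ft: "nf h' \<in> tree" using h' by simp
    have "nf h' = act h' (nf g')" using True by (simp add: nf_def)
    also have "\<dots> = act g' (nf h')" using g' h' gh' by (metis nf_mult)
    also have "\<dots> = map (am g') (nf h')" using True g' ft by (simp add: act_eq)
    finally have fxd: "map (am g') (nf h') = nf h'" by simp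
    \<comment> \<open>The non-zero exponent sum supplies a letter; its coset is fixed by
      \<open>g'\<close>, and a representative \<open>k\<close> of that coset conjugates
      \<open>g'\<close> into \<open>B\<close>.\<close>
    have "nf h' \<noteq> []" using h' ex_nf by auto
    then obtain l p where lp: "nf h' = l # p" by (cases "nf h'") auto
    then have l: "am g' l = l" "l \<in> letters" using fxd ft by (auto simp: tree_def)
    then obtain k b where k: "k \<in> H" "l = (k <#\<^bsub>A\<^esub> B, b)" using letterE by metis
    have kc: "k \<in> carrier A" using k H_closed by simp
    have "(g' \<bullet> k) <#\<^bsub>A\<^esub> B = k <#\<^bsub>A\<^esub> B" using am_coset[OF g'(1) k(1), of b] l k gH by simp
    then have "iv k <#\<^bsub>A\<^esub> ((g' \<bullet> k) <#\<^bsub>A\<^esub> B) = iv k <#\<^bsub>A\<^esub> (k <#\<^bsub>A\<^esub> B)" by simp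
    then have "(iv k \<bullet> (g' \<bullet> k)) <#\<^bsub>A\<^esub> B = B"
      using A.lcos_m_assoc[OF B_carrier] A.lcos_mult_one[OF B_carrier] kc g' by simp
    then have "iv k \<bullet> (g' \<bullet> k) \<in> B" using kc g' by (intro stabilizer_B) auto
    moreover have "iv k \<bullet> (g' \<bullet> k) = cj (iv k \<bullet> iv c) g"
      using kc g' c g by (simp add: A.conj_by_mult g'_def[symmetric]) (simp add: A.conj_by_def A.m_assoc)
    ultimately show ?thesis using kc c by (intro bexI[of _ "iv k \<bullet> iv c"]) auto
  next
    case False
    have bound: "\<bar>sgn_sum (take i w)\<bar> \<le> int (length w)" for i and w :: "('b \<times> bool) list"
    proof -
      have "\<bar>sgn_sum v\<bar> \<le> int (length v)" for v :: "('b \<times> bool) list"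
        by (induction v) auto
      from this[of "take i w"] show ?thesis by simp
    qed
    \<comment> \<open>Each power of \<open>h'\<close> factors into a kernel part and an element of
      \<open>H\<close>. The latter does not affect word length under conjugation, so the kernel part
      preserves the minimal length.\<close>
    have "\<bar>int n * ex u h'\<bar> \<le> int (length (nf g'))" for n :: nat
    proof -
      let ?d = "h' [^]\<^bsub>A\<^esub> n"
      have d: "?d \<in> carrier A" using h' by simp
      have td: "\<tau> (nf ?d) \<in> carrier A" using d by (simp add: \<tau>_closed tree_lists)
      have "g' \<bullet> ?d = ?d \<bullet> g'" using gh' g' h' by (metis A.group_commutes_pow)
      then have "iv ?d \<bullet> g' = g' \<bullet> iv ?d" using A.commutes_inv[of ?d g'] d g' by simp
      then have "cj (iv ?d) g' = g'" using d g' by (simp add: A.conj_by_fix_iff)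
      moreover have "cj (iv ?d) g' = cj (iv (\<rho> ?d)) (cj (iv (\<tau> (nf ?d))) g')"
      proof -
        have "cj (iv ?d) g' = cj (iv (\<tau> (nf ?d) \<bullet> \<rho> ?d)) g'" using nf_decomp[OF d] by simp
        then show ?thesis using d td g' by (simp add: A.inv_mult_group A.conj_by_mult)
      qed
      ultimately have "length (nf (cj (iv (\<tau> (nf ?d))) g')) = length (nf g')"
        using nf_conj_H[of "cj (iv (\<tau> (nf ?d))) g'" "\<rho> ?d"] td d g' by simp
      then obtain i where "sgn_sum (nf ?d) = sgn_sum (take i (nf g'))"
        using conj_min_exponent[OF g'(1) False g'(2) min, of "nf ?d"] d by auto
      then have "ex u ?d = sgn_sum (take i (nf g'))" using d ex_nf by simp
      then show ?thesis using bound[of i "nf g'"] h' ex_nat_pow by simp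
    qed
    from this[of "Suc (length (nf g'))"] have "int (Suc (length (nf g'))) * \<bar>ex u h'\<bar> \<le> int (length (nf g'))"
      by (simp add: abs_mult)
    moreover have "1 \<le> \<bar>ex u h'\<bar>" using h' by simp
    then have "int (Suc (length (nf g'))) * 1 \<le> int (Suc (length (nf g'))) * \<bar>ex u h'\<bar>"
      by (intro mult_left_mono) auto
    ultimately have "int (Suc (length (nf g'))) * 1 \<le> int (length (nf g'))" by linarith
    then show ?thesis by simp
  qed
qed

end

context raag begin

lemma centralizer_gen:
  assumes "u \<in> V" "a \<in> carrier A" "a \<bullet> gen u = gen u \<bullet> a"
  shows "a \<in> SP (star u)"
proof -
  interpret raag_vertex V E u by unfold_locales fact
  show ?thesis using centralizer_u assms by simp
qed

lemma centralizer_gen_iff: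
  assumes "u \<in> V" "a \<in> carrier A"
  shows "a \<bullet> gen u = gen u \<bullet> a \<longleftrightarrow> a \<in> SP (star u)"
  using centralizer_gen[OF assms] SP_commute_gen[of a "star u" u] assms by auto

lemma conj_into_link:
  assumes "u \<in> V" "g \<in> carrier A" "h \<in> carrier A" "g \<bullet> h = h \<bullet> g" "ex u g = 0" "ex u h \<noteq> 0"
  shows "\<exists>c\<in>carrier A. cj c g \<in> SP (link u)"
proof -
  interpret raag_vertex V E u by unfold_locales fact
  show ?thesis using commuting_conj_into_link assms by simp
qed

end

section \<open>Automorphisms act on the abelianisation by signs\<close>

text \<open>Gaussian elimination: an equation with a non-zero coefficient is solved for one unknown,
  which removes one equation and one unknown.\<close>

lemma homogeneous_system_nontrivial_solution:
  fixes a :: "'t \<Rightarrow> 'u \<Rightarrow> 'k::field"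
  assumes "finite T" "finite U" "card T < card U"
  shows "\<exists>x. (\<exists>u\<in>U. x u \<noteq> 0) \<and> (\<forall>t\<in>T. (\<Sum>u\<in>U. a t u * x u) = 0)"
  using assms
proof (induction T arbitrary: U a rule: finite_induct)
  case empty
  then show ?case by (intro exI[of _ "\<lambda>_. 1"]) (auto simp: card_gt_0_iff)
next
  case (insert t T)
  show ?case
  proof (cases "\<forall>u\<in>U. a t u = 0")
    case True
    have "card T < card U" using insert by simp
    then obtain x where "\<exists>u\<in>U. x u \<noteq> 0" "\<forall>s\<in>T. (\<Sum>u\<in>U. a s u * x u) = 0"
      using insert.IH[of U a] insert.prems by blast
    then show ?thesis using True by (intro exI[of _ x]) auto
  next
    case False
    then obtain w where w: "w \<in> U" "a t w \<noteq> 0" by blast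
    \<comment> \<open>Coefficients after equation \<open>t\<close> has been used to eliminate the
      unknown \<open>w\<close>.\<close>
    define b where "b s u = a s u - a s w * a t u / a t w" for s u
    have "card T < card (U - {w})" using insert w by (simp add: card_Diff_singleton)
    then obtain x where x: "\<exists>u\<in>U - {w}. x u \<noteq> 0" "\<forall>s\<in>T. (\<Sum>u\<in>U - {w}. b s u * x u) = 0"
      using insert.IH[of "U - {w}" b] insert.prems by blast
    define y where "y = x (w := - (\<Sum>u\<in>U - {w}. a t u * x u) / a t w)"
    have split: "(\<Sum>u\<in>U. a s u * y u) = a s w * y w + (\<Sum>u\<in>U - {w}. a s u * x u)" for s
      using insert.prems w by (subst sum.remove[of _ w]) (auto simp: y_def intro!: sum.cong)
    have "(\<Sum>u\<in>U. a t u * y u) = 0" unfolding split using w by (simp add: y_def)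
    moreover have "(\<Sum>u\<in>U. a s u * y u) = 0" if "s \<in> T" for s
    proof -
      have "(\<Sum>u\<in>U - {w}. b s u * x u) = (\<Sum>u\<in>U - {w}. a s u * x u) - a s w / a t w * (\<Sum>u\<in>U - {w}. a t u * x u)"
        by (simp add: b_def left_diff_distrib sum_subtractf sum_distrib_left mult.assoc)
      then show ?thesis using x(2) that unfolding split by (simp add: y_def)
    qed
    moreover have "\<exists>u\<in>U. y u \<noteq> 0" using x(1) by (auto simp: y_def)
    ultimately show ?thesis by blast
  qed
qed

section \<open>Exponent matrices of endomorphisms\<close>

context raag begin

text \<open>The property of exponent matrices provided by \<open>commuting_exponents\<close>: minors
  of adjacent columns on non-adjacent rows vanish. A field is used so that columns can be cleared by
  division.\<close>

definition commuting_columns :: "('a \<Rightarrow> 'a \<Rightarrow> 'k::field) \<Rightarrow> bool" where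
  "commuting_columns M \<longleftrightarrow> (\<forall>u v i j. (u, v) \<in> E \<longrightarrow> i \<in> V \<longrightarrow> j \<in> V \<longrightarrow> i \<noteq> j \<longrightarrow> (i, j) \<notin> E \<longrightarrow>
     M i u * M j v = M j u * M i v)"

definition left_inverse :: "('a \<Rightarrow> 'a \<Rightarrow> 'k::field) \<Rightarrow> ('a \<Rightarrow> 'a \<Rightarrow> 'k) \<Rightarrow> bool" where
  "left_inverse N M \<longleftrightarrow> (\<forall>s\<in>V. \<forall>v\<in>V. (\<Sum>t\<in>V. N s t * M t v) = (if s = v then 1 else 0))"

lemma left_inverse_kernel:
  assumes "left_inverse N M" "\<And>t. t \<in> V \<Longrightarrow> (\<Sum>u\<in>V. M t u * y u) = 0" "v \<in> V"
  shows "y v = 0"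
proof -
  have "0 = (\<Sum>t\<in>V. N v t * (\<Sum>u\<in>V. M t u * y u))" using assms(2) by simp
  also have "\<dots> = (\<Sum>t\<in>V. \<Sum>u\<in>V. N v t * M t u * y u)" by (simp add: sum_distrib_left mult.assoc)
  also have "\<dots> = (\<Sum>u\<in>V. \<Sum>t\<in>V. N v t * M t u * y u)" by (rule sum.swap)
  also have "\<dots> = (\<Sum>u\<in>V. (\<Sum>t\<in>V. N v t * M t u) * y u)" by (simp add: sum_distrib_right)
  also have "\<dots> = (\<Sum>u\<in>V. if v = u then y u else 0)"
    using assms(1,3) by (intro sum.cong) (auto simp: left_inverse_def)
  also have "\<dots> = y v" using assms(3) finite_V by simp
  finally show ?thesis by simp
qed

lemma finite_link: "finite (link v)"
  using finite_subset[OF link_subset finite_V] .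

text \<open>Subtracting multiples of column \<open>v\<close> from its neighbouring columns so that row \<open>s\<close> vanishes
  moves all of them into the coordinates \<open>link s\<close>.\<close>

lemma nonzero_entry_degree:
  fixes M :: "'a \<Rightarrow> 'a \<Rightarrow> 'k::field"
  assumes inv: "left_inverse N M" and comm: "commuting_columns M"
    and sv: "s \<in> V" "v \<in> V" "M s v \<noteq> 0"
    and dom: "\<And>i. i \<in> V \<Longrightarrow> (\<And>w. w \<in> link s \<Longrightarrow> i \<in> star w) \<Longrightarrow> i = s"
  shows "card (link v) \<le> card (link s)"
    and "card (link v) = card (link s) \<Longrightarrow> i \<in> V \<Longrightarrow> i \<noteq> s \<Longrightarrow> M i v = 0"
proof -
  \<comment> \<open>Column \<open>u\<close> after subtracting the multiple of column
    \<open>v\<close> that clears row \<open>s\<close>.\<close>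
  define f where "f t u = M t u - M s u / M s v * M t v" for t u
  have f0: "f t u = 0" if "t \<in> V" "t \<notin> link s" "u \<in> link v" for t u
  proof (cases "t = s")
    case True then show ?thesis using sv by (simp add: f_def)
  next
    case False
    have "M s v * M t u = M t v * M s u"
      using comm that sv False unfolding commuting_columns_def link_def by blast
    then show ?thesis using sv by (simp add: f_def field_simps)
  qed
  have indep: "x u = 0" if x: "\<And>t. t \<in> V \<Longrightarrow> (\<Sum>u\<in>link v. f t u * x u) = 0" and u: "u \<in> link v" for x u
  proof -
    \<comment> \<open>Undoes the column operation: the entry at \<open>v\<close> is chosen so that
      the matrix applied to \<open>y\<close> equals the combination of the cleared columns.\<close>
    define y where "y w = (if w \<in> link v then x w else if w = v then - (\<Sum>u\<in>link v. M s u / M s v * x u) else 0)" for w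
    have vl: "v \<notin> link v" using E_irrefl by (simp add: link_def)
    have "(\<Sum>w\<in>V. M t w * y w) = 0" if "t \<in> V" for t
    proof -
      have "(\<Sum>w\<in>V. M t w * y w) = (\<Sum>w\<in>insert v (link v). M t w * y w)"
        using sv link_subset finite_V by (intro sum.mono_neutral_right) (auto simp: y_def)
      also have "\<dots> = M t v * y v + (\<Sum>w\<in>link v. M t w * x w)"
        using vl finite_link by (simp add: y_def)
      also have "\<dots> = (\<Sum>u\<in>link v. f t u * x u)"
        using vl by (simp add: y_def f_def left_diff_distrib sum_subtractf sum_distrib_left mult.assoc mult.left_commute)
      finally show ?thesis using x[OF that] by simp
    qed
    then have "y u = 0" using left_inverse_kernel[OF inv] u link_subset by blast
    then show ?thesis using u by (simp add: y_def)
  qed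
  show "card (link v) \<le> card (link s)"
  proof (rule ccontr)
    assume "\<not> ?thesis"
    then obtain x where x: "\<exists>u\<in>link v. x u \<noteq> 0" "\<forall>t\<in>link s. (\<Sum>u\<in>link v. f t u * x u) = 0"
      using homogeneous_system_nontrivial_solution[of "link s" "link v" f] finite_link by auto
    have "(\<Sum>u\<in>link v. f t u * x u) = 0" if "t \<in> V" for t
      using x(2) f0[OF that] by (cases "t \<in> link s") auto
    then show False using indep x(1) by blast
  qed
  assume eq: "card (link v) = card (link s)" and i: "i \<in> V" "i \<noteq> s"
  show "M i v = 0"
  proof (rule ccontr)
    assume Mi: "M i v \<noteq> 0"
    have "i \<in> star w" if w: "w \<in> link s" for w
    proof (rule ccontr)
      assume iw: "i \<notin> star w"
      have wV: "w \<in> V" using w link_subset by blast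
      \<comment> \<open>With equal degrees, the cleared columns together with the unit vector at
        \<open>w\<close> are one too many for the coordinates \<open>link s\<close>. The unknown
        \<open>None\<close> carries that unit vector.\<close>
      define a where "a t z = (case z of None \<Rightarrow> if t = w then 1 else 0 | Some u \<Rightarrow> f t u)" for t z
      let ?U = "insert None (Some ` link v)"
      have "card (link s) < card ?U" using finite_link eq by (simp add: card_image)
      then obtain x where x: "\<exists>z\<in>?U. x z \<noteq> 0" "\<forall>t\<in>link s. (\<Sum>z\<in>?U. a t z * x z) = 0"
        using homogeneous_system_nontrivial_solution[of "link s" ?U a] finite_link by auto
      have sum: "(\<Sum>z\<in>?U. a t z * x z) = (if t = w then x None else 0) + (\<Sum>u\<in>link v. f t u * x (Some u))" for t
        using finite_link by (simp add: a_def sum.reindex)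
      have all: "(if t = w then x None else 0) + (\<Sum>u\<in>link v. f t u * x (Some u)) = 0" if "t \<in> V" for t
      proof (cases "t \<in> link s")
        case True then show ?thesis using x(2) sum by metis
      next
        case False then show ?thesis using f0[OF that] w by auto
      qed
      have xN: "x None \<noteq> 0"
      proof
        assume 0: "x None = 0"
        have "(\<Sum>u\<in>link v. f t u * x (Some u)) = 0" if "t \<in> V" for t
          using all[OF that] 0 by (simp split: if_splits)
        then have "x (Some u) = 0" if "u \<in> link v" for u using indep[of "\<lambda>u. x (Some u)"] that by blast
        then show False using x(1) 0 by auto
      qed
      have niw: "i \<noteq> w" "(i, w) \<notin> E" using iw E_sym by (auto simp: star_def link_def)
      \<comment> \<open>Subtracting a multiple of column \<open>v\<close> from column
        \<open>u\<close> does not change a minor of these two columns. Summed against the relation,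
        this forces \<open>M i v\<close> times \<open>x None\<close> to be 0.\<close>
      have minor: "f i u * M w v = f w u * M i v" if u: "u \<in> link v" for u
      proof -
        have "M i u * M w v = M w u * M i v"
          using comm niw i wV u E_sym unfolding commuting_columns_def link_def by blast
        then show ?thesis by (simp add: f_def algebra_simps)
      qed
      have "0 = M w v * (\<Sum>u\<in>link v. f i u * x (Some u))" using all[OF i(1)] niw by simp
      also have "\<dots> = (\<Sum>u\<in>link v. (f i u * M w v) * x (Some u))" by (simp add: sum_distrib_left mult_ac)
      also have "\<dots> = (\<Sum>u\<in>link v. (f w u * M i v) * x (Some u))" using minor by simp
      also have "\<dots> = M i v * (\<Sum>u\<in>link v. f w u * x (Some u))" by (simp add: sum_distrib_left mult_ac)
      also have "(\<Sum>u\<in>link v. f w u * x (Some u)) = - x None" using all[OF wV] by (simp add: eq_neg_iff_add_eq_0 add.commute)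
      finally show False using Mi xN by simp
    qed
    then show False using dom[of i] i by blast
  qed
qed

lemma ex_hom_image:
  assumes "\<phi> \<in> hom A A" "x \<in> carrier A"
  shows "ex s (\<phi> x) = (\<Sum>v\<in>V. ex s (\<phi> (gen v)) * ex v x)"
proof -
  interpret \<phi>: group_hom A A \<phi> using assms by (simp add: group_hom_def group_hom_axioms_def A.is_group)
  have s: "(\<Sum>v\<in>V. ex s (\<phi> (gen v)) * (if w = v then c else 0)) = c * ex s (\<phi> (gen w))" if "w \<in> V" for w and c :: int
  proof -
    have "(\<Sum>v\<in>V. ex s (\<phi> (gen v)) * (if w = v then c else 0)) = (\<Sum>v\<in>V. if w = v then ex s (\<phi> (gen v)) * c else 0)"
      by (intro sum.cong) auto
    also have "\<dots> = c * ex s (\<phi> (gen w))" using that finite_V by simp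
    finally show ?thesis .
  qed
  from assms(2) show ?thesis
  proof (induction rule: A_induct)
    case one then show ?case by simp
  next
    case (gen w x)
    have "(\<Sum>v\<in>V. ex s (\<phi> (gen v)) * ex v (gen w \<bullet> x)) =
      (\<Sum>v\<in>V. ex s (\<phi> (gen v)) * (if w = v then 1 else 0)) + (\<Sum>v\<in>V. ex s (\<phi> (gen v)) * ex v x)"
      unfolding sum.distrib[symmetric] using gen by (intro sum.cong refl) (simp add: ex_gen distrib_left)
    then show ?case using s[of w 1] gen by simp
  next
    case (inv w x)
    have "(\<Sum>v\<in>V. ex s (\<phi> (gen v)) * ex v (iv (gen w) \<bullet> x)) =
      (\<Sum>v\<in>V. ex s (\<phi> (gen v)) * (if w = v then -1 else 0)) + (\<Sum>v\<in>V. ex s (\<phi> (gen v)) * ex v x)"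
      unfolding sum.distrib[symmetric] using inv by (intro sum.cong refl) (simp add: ex_gen algebra_simps)
    then show ?case using s[of w "-1"] inv by simp
  qed
qed

lemma commuting_columns_hom:
  assumes "\<phi> \<in> hom A A"
  shows "commuting_columns (\<lambda>s v. of_int (ex s (\<phi> (gen v))) :: 'k::field)"
  unfolding commuting_columns_def
proof (intro allI impI)
  fix u v i j assume uv: "(u, v) \<in> E" and ij: "i \<in> V" "j \<in> V" "i \<noteq> j" "(i, j) \<notin> E"
  have V: "u \<in> V" "v \<in> V" using uv E_subset by auto
  have "\<phi> (gen u) \<bullet> \<phi> (gen v) = \<phi> (gen v) \<bullet> \<phi> (gen u)"
    using hom_mult[OF assms, of "gen u" "gen v"] hom_mult[OF assms, of "gen v" "gen u"] V gen_commute[OF uv] by simp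
  then have "ex i (\<phi> (gen u)) * ex j (\<phi> (gen v)) = ex j (\<phi> (gen u)) * ex i (\<phi> (gen v))"
    using V ij hom_in_carrier[OF assms] by (intro commuting_exponents) auto
  then show "(of_int (ex i (\<phi> (gen u))) :: 'k) * of_int (ex j (\<phi> (gen v))) =
      of_int (ex j (\<phi> (gen u))) * of_int (ex i (\<phi> (gen v)))" by (metis of_int_mult)
qed

lemma left_inverse_hom:
  assumes "\<phi> \<in> hom A A" "\<psi> \<in> hom A A" "\<And>x. x \<in> carrier A \<Longrightarrow> \<psi> (\<phi> x) = x"
  shows "left_inverse (\<lambda>s v. of_int (ex s (\<psi> (gen v))) :: 'k::field) (\<lambda>s v. of_int (ex s (\<phi> (gen v))))"
  unfolding left_inverse_def
proof (intro ballI)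
  fix s v assume sv: "s \<in> V" "v \<in> V"
  have "(\<Sum>t\<in>V. ex s (\<psi> (gen t)) * ex t (\<phi> (gen v))) = ex s (\<psi> (\<phi> (gen v)))"
    using ex_hom_image[OF assms(2), of "\<phi> (gen v)" s] hom_in_carrier[OF assms(1)] sv by simp
  also have "\<dots> = (if s = v then 1 else 0)" using assms(3) sv by (auto simp: ex_gen)
  finally have "of_int (\<Sum>t\<in>V. ex s (\<psi> (gen t)) * ex t (\<phi> (gen v))) = (of_int (if s = v then 1 else 0) :: 'k)"
    by simp
  then show "(\<Sum>t\<in>V. of_int (ex s (\<psi> (gen t))) * (of_int (ex t (\<phi> (gen v))) :: 'k)) = (if s = v then 1 else 0)"
    by simp
qed

end

text \<open>Absence of domination is required in a strong form: two neighbours of \<open>v\<close>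
  alone have only \<open>v\<close> in the intersection of their stars. The exponent matrix needs the
  weaker form with all neighbours; \<open>hom_gen_conj\<close> needs the pair.\<close>

locale asym_raag = raag +
  assumes no_dom: "v \<in> V \<Longrightarrow> \<exists>u\<in>link v. \<exists>u'\<in>link v. \<forall>w\<in>V. u \<in> star w \<longrightarrow> u' \<in> star w \<longrightarrow> w = v"
    and asym: "graph_aut V E f \<Longrightarrow> v \<in> V \<Longrightarrow> f v = v"
begin

text \<open>The exponent matrices \<open>M\<close> and \<open>N\<close> are inverse to each other.
  Comparing degrees in both directions shows that each column has a single non-zero entry; the
  resulting permutation preserves edges by the vanishing minors, hence is the identity. The diagonal
  entries are invertible integers.\<close>

lemma hom_exponents:
  assumes h: "\<phi> \<in> hom A A" "\<psi> \<in> hom A A"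
    and inv: "\<And>x. x \<in> carrier A \<Longrightarrow> \<psi> (\<phi> x) = x" "\<And>x. x \<in> carrier A \<Longrightarrow> \<phi> (\<psi> x) = x"
    and v: "v \<in> V"
  shows "s \<in> V \<Longrightarrow> s \<noteq> v \<Longrightarrow> ex s (\<phi> (gen v)) = 0" and "ex v (\<phi> (gen v)) = 1 \<or> ex v (\<phi> (gen v)) = -1"
proof -
  define M :: "'a \<Rightarrow> 'a \<Rightarrow> rat" where "M s v = of_int (ex s (\<phi> (gen v)))" for s v
  define N :: "'a \<Rightarrow> 'a \<Rightarrow> rat" where "N s v = of_int (ex s (\<psi> (gen v)))" for s v
  have NM: "left_inverse N M" and MN: "left_inverse M N"
    unfolding M_def N_def using left_inverse_hom h inv by blast+
  have cM: "commuting_columns M" and cN: "commuting_columns N"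
    unfolding M_def N_def using commuting_columns_hom h by blast+
  have dom: "i = s" if "s \<in> V" "i \<in> V" "\<And>w. w \<in> link s \<Longrightarrow> i \<in> star w" for i s
    using no_dom[OF that(1)] that(2,3) star_sym by blast
  \<comment> \<open>A diagonal entry of the product is 1, so some summand is non-zero. Having both
    factors non-zero gives the degree inequality for each of the two matrices.\<close>
  have "\<exists>s\<in>V. N v s \<noteq> 0 \<and> M s v \<noteq> 0" if "v \<in> V" for v
  proof (rule ccontr)
    assume "\<not> ?thesis"
    then have "(\<Sum>t\<in>V. N v t * M t v) = 0" by (intro sum.neutral) auto
    then show False using NM that by (auto simp: left_inverse_def)
  qed
  then obtain \<sigma> where \<sigma>: "\<And>v. v \<in> V \<Longrightarrow> \<sigma> v \<in> V \<and> N v (\<sigma> v) \<noteq> 0 \<and> M (\<sigma> v) v \<noteq> 0" by metis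
  have deg: "card (link v) = card (link (\<sigma> v))" if "v \<in> V" for v
    using nonzero_entry_degree(1)[OF NM cM _ that, of "\<sigma> v"] nonzero_entry_degree(1)[OF MN cN that, of "\<sigma> v"]
      \<sigma>[OF that] dom that by (meson le_antisym)
  have M0: "M i v = 0" if "v \<in> V" "i \<in> V" "i \<noteq> \<sigma> v" for i v
    using nonzero_entry_degree(2)[OF NM cM _ that(1), of "\<sigma> v" i] \<sigma>[OF that(1)] deg[OF that(1)] dom that by metis
  have N0: "N i (\<sigma> v) = 0" if "v \<in> V" "i \<in> V" "i \<noteq> v" for i v
    using nonzero_entry_degree(2)[OF MN cN that(1), of "\<sigma> v" i] \<sigma>[OF that(1)] deg[OF that(1)] dom that by metis
  have inj: "inj_on \<sigma> V"
    by (rule inj_onI) (metis N0 \<sigma>)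
  have bij: "bij_betw \<sigma> V V"
    using inj \<sigma> endo_inj_surj[OF finite_V _ inj] by (auto simp: bij_betw_def image_subset_iff)
  \<comment> \<open>If the images were not adjacent, the minor would vanish, yet for a monomial
    matrix it is a product of two non-zero entries.\<close>
  have edge: "(\<sigma> u, \<sigma> w) \<in> E" if uw: "(u, w) \<in> E" for u w
  proof (rule ccontr)
    assume n: "(\<sigma> u, \<sigma> w) \<notin> E"
    have V: "u \<in> V" "w \<in> V" "u \<noteq> w" using uw E_subset E_irrefl by auto
    then have ne: "\<sigma> u \<noteq> \<sigma> w" using inj by (auto dest: inj_onD)
    then have "M (\<sigma> u) u * M (\<sigma> w) w = M (\<sigma> w) u * M (\<sigma> u) w"
      using cM uw n \<sigma> V unfolding commuting_columns_def by blast
    then show False using M0[of u "\<sigma> w"] \<sigma> V ne by auto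
  qed
  have edge': "(u, w) \<in> E" if "(\<sigma> u, \<sigma> w) \<in> E" "u \<in> V" "w \<in> V" for u w
  proof (rule ccontr)
    assume n: "(u, w) \<notin> E"
    have ne: "u \<noteq> w" using that E_irrefl by auto
    then have "N u (\<sigma> u) * N w (\<sigma> w) = N w (\<sigma> u) * N u (\<sigma> w)"
      using cN n that unfolding commuting_columns_def by blast
    then show False using N0[of u w] \<sigma> that ne by auto
  qed
  have "graph_aut V E \<sigma>" unfolding graph_aut_def using bij edge edge' by blast
  then have id: "\<sigma> v = v" if "v \<in> V" for v using asym that by blast
  have z: "ex s (\<phi> (gen v)) = 0" if "s \<in> V" "s \<noteq> v" for s
    using M0[OF v that(1)] that id[OF v] by (simp add: M_def)
  then show "s \<in> V \<Longrightarrow> s \<noteq> v \<Longrightarrow> ex s (\<phi> (gen v)) = 0" by blast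
  have "1 = (\<Sum>t\<in>V. ex v (\<psi> (gen t)) * ex t (\<phi> (gen v)))"
    using ex_hom_image[OF h(2), of "\<phi> (gen v)" v] inv(1) hom_in_carrier[OF h(1)] v by (simp add: ex_gen)
  also have "\<dots> = (\<Sum>t\<in>{v}. ex v (\<psi> (gen t)) * ex t (\<phi> (gen v)))"
    using v finite_V z by (intro sum.mono_neutral_right) auto
  finally have "ex v (\<psi> (gen v)) * ex v (\<phi> (gen v)) = 1" by simp
  then show "ex v (\<phi> (gen v)) = 1 \<or> ex v (\<phi> (gen v)) = -1" by (auto simp: zmult_eq_1_iff)
qed

text \<open>The image of \<open>v\<close> is conjugate into the special subgroups of the links of
  two neighbours \<open>u\<close> and \<open>u'\<close>. Retracting onto the second link puts a
  conjugate into the special subgroup of their intersection, which contains at most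
  \<open>v\<close>; the exponent sum then identifies the power.\<close>

lemma hom_gen_conj:
  assumes h: "\<phi> \<in> hom A A" "\<psi> \<in> hom A A"
    and inv: "\<And>x. x \<in> carrier A \<Longrightarrow> \<psi> (\<phi> x) = x" "\<And>x. x \<in> carrier A \<Longrightarrow> \<phi> (\<psi> x) = x"
    and v: "v \<in> V"
  shows "\<exists>c\<in>carrier A. \<phi> (gen v) = cj c (gen v [^]\<^bsub>A\<^esub> ex v (\<phi> (gen v)))"
proof -
  let ?g = "\<phi> (gen v)"
  have g: "?g \<in> carrier A" using hom_in_carrier[OF h(1)] v by simp
  obtain u u' where u: "u \<in> link v" "u' \<in> link v" "\<And>w. w \<in> V \<Longrightarrow> u \<in> star w \<Longrightarrow> u' \<in> star w \<Longrightarrow> w = v"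
    using no_dom[OF v] by blast
  have cn: "\<exists>c\<in>carrier A. cj c ?g \<in> SP (link u)" if u: "u \<in> link v" for u
  proof -
    have uV: "u \<in> V" "u \<noteq> v" using u E_subset E_irrefl by (auto simp: link_def)
    have hu: "\<phi> (gen u) \<in> carrier A" using hom_in_carrier[OF h(1)] uV by simp
    have "gen v \<bullet> gen u = gen u \<bullet> gen v" using u gen_commute by (auto simp: link_def)
    then have "?g \<bullet> \<phi> (gen u) = \<phi> (gen u) \<bullet> ?g"
      using hom_mult[OF h(1), of "gen v" "gen u"] hom_mult[OF h(1), of "gen u" "gen v"] v uV by simp
    then show ?thesis
      using conj_into_link[OF uV(1) g hu] hom_exponents(1)[OF h inv v uV] hom_exponents(2)[OF h inv uV(1)] by auto
  qed
  obtain c where c: "c \<in> carrier A" "cj c ?g \<in> SP (link u)" using cn u by blast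
  obtain d where d: "d \<in> carrier A" "cj d ?g \<in> SP (link u')" using cn u by blast
  define x where "x = cj c ?g"
  have x: "x \<in> carrier A" using c g by (simp add: x_def)
  have "?g = cj (iv c) x" using c g by (simp add: x_def)
  then have dx: "cj d ?g = cj (d \<bullet> iv c) x" using c d x by (simp add: A.conj_by_mult)
  define x' where "x' = ret (link u') x"
  define e where "e = ret (link u') (d \<bullet> iv c)"
  have ec: "e \<in> carrier A" using c d by (simp add: e_def)
  have "cj d ?g = ret (link u') (cj (d \<bullet> iv c) x)" using ret_SP[OF d(2)] dx by simp
  then have de: "cj d ?g = cj e x'" using c d x by (simp add: ret_conj e_def x'_def)
  have "x' \<in> SP (link u' \<inter> link u)" unfolding x'_def using c(2) by (intro SP_ret) (simp add: x_def)
  moreover have "link u' \<inter> link u \<subseteq> {v}"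
  proof
    fix w assume w: "w \<in> link u' \<inter> link u"
    then have "w \<in> V" "u \<in> star w" "u' \<in> star w" using link_subset E_sym by (auto simp: link_def star_def)
    then show "w \<in> {v}" using u(3) by simp
  qed
  ultimately have "x' \<in> SP {v}" using SP_mono by blast
  then obtain k :: int where k: "x' = gen v [^]\<^bsub>A\<^esub> k" using SP_single v by blast
  have xc: "x' \<in> carrier A" using x by (simp add: x'_def)
  have "?g = cj (iv d) (cj e x')" using de d g by (simp add: A.conj_by_eq_iff[symmetric] flip: de)
  then have ge: "?g = cj (iv d \<bullet> e) x'" using d ec xc by (simp add: A.conj_by_mult)
  then have "ex v ?g = k" using d ec xc v by (simp add: k ex_int_pow ex_gen)
  then show ?thesis using ge d ec k by (intro bexI[of _ "iv d \<bullet> e"]) auto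
qed

end

section \<open>Rigid sets of vertices\<close>

lemma periodic_mod:
  fixes n :: nat
  assumes "\<And>i. f (i + n) = f i"
  shows "f (i mod n + j) = f (i + j)"
proof -
  have "f (r + q * n) = f r" for r q
  proof (induction q)
    case (Suc q)
    have "f (r + Suc q * n) = f ((r + q * n) + n)" by (simp add: algebra_simps)
    then show ?case using assms Suc by metis
  qed simp
  from this[of "i mod n + j" "i div n"] show ?thesis by (simp add: algebra_simps)
qed

text \<open>Choosing at residues only makes the family periodic, so that the product of its
  consecutive differences around a cycle closes up.\<close>

lemma periodic_choice:
  fixes n :: nat
  assumes "\<And>i. \<exists>x. Q i x" "\<And>i x. Q (i mod n) x \<Longrightarrow> Q i x"
  shows "\<exists>f. (\<forall>i. Q i (f i)) \<and> (\<forall>i. f (i + n) = f i)"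
proof -
  obtain g where g: "\<And>i. Q i (g i)" using assms(1) by metis
  show ?thesis by (rule exI[of _ "\<lambda>i. g (i mod n)"]) (use assms(2) g in auto)
qed

context raag begin

lemma PSA_hom: "\<phi> \<in> PSA V E \<Longrightarrow> \<phi> \<in> hom A A"
  by (simp add: PSA_def auto_def)

lemma PSA_conj: "\<phi> \<in> PSA V E \<Longrightarrow> v \<in> V \<Longrightarrow> \<exists>g\<in>carrier A. \<phi> (gen v) = cj g (gen v)"
  by (simp add: PSA_def A.conj_by_def)

definition rigid :: "'a set \<Rightarrow> bool" where
  "rigid S \<longleftrightarrow> (\<forall>\<phi>\<in>PSA V E. \<exists>p\<in>carrier A. \<forall>v\<in>S. \<phi> (gen v) = cj p (gen v))"

lemma conj_gen_eq_iff:
  assumes "v \<in> V" "k \<in> carrier A" "k' \<in> carrier A"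
  shows "cj k (gen v) = cj k' (gen v) \<longleftrightarrow> iv k' \<bullet> k \<in> SP (star v)"
  using assms by (simp add: A.conj_by_eq_conj_by_iff centralizer_gen_iff)

lemma conj_gen_SP:
  assumes "v \<in> V" "k \<in> carrier A" "z \<in> SP (star v)"
  shows "cj (k \<bullet> z) (gen v) = cj k (gen v)"
  using assms SP_closed[OF assms(3)] by (simp add: conj_gen_eq_iff)

lemma SP_Inter_star:
  assumes "F \<subseteq> V" "z \<in> carrier A" "\<And>x. x \<in> F \<Longrightarrow> z \<in> SP (star x)"
  shows "z \<in> SP {w \<in> V. \<forall>x\<in>F. w \<in> star x}"
proof -
  have "finite F" using assms(1) finite_V finite_subset by blast
  then show ?thesis using assms(3)
  proof (induction F rule: finite_induct)
    case empty
    then show ?case using assms(2) SP_V by simp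
  next
    case (insert x F)
    then have "z \<in> SP (star x \<inter> {w \<in> V. \<forall>x\<in>F. w \<in> star x})" by (intro SP_Int) auto
    moreover have "star x \<inter> {w \<in> V. \<forall>x\<in>F. w \<in> star x} = {w \<in> V. \<forall>x\<in>insert x F. w \<in> star x}" by auto
    ultimately show ?case by simp
  qed
qed

text \<open>The quotient of the two conjugators centralises every common generator, so it lies in
  the subgroup generated by an intersection of stars that is empty.\<close>

lemma rigid_glue:
  assumes "rigid S" "rigid T" "S \<union> T \<subseteq> V" "\<And>w. w \<in> V \<Longrightarrow> \<exists>x\<in>S \<inter> T. w \<notin> star x"
  shows "rigid (S \<union> T)"
  unfolding rigid_def
proof
  fix \<phi> assume "\<phi> \<in> PSA V E"
  then obtain p q where p: "p \<in> carrier A" "\<And>v. v \<in> S \<Longrightarrow> \<phi> (gen v) = cj p (gen v)"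
    and q: "q \<in> carrier A" "\<And>v. v \<in> T \<Longrightarrow> \<phi> (gen v) = cj q (gen v)"
    using assms(1,2) unfolding rigid_def by meson
  have "iv q \<bullet> p \<in> SP (star x)" if "x \<in> S \<inter> T" for x
  proof -
    have "x \<in> V" "cj p (gen x) = cj q (gen x)" using that p(2)[of x] q(2)[of x] assms(3) by auto
    then show ?thesis using conj_gen_eq_iff p q by simp
  qed
  then have "iv q \<bullet> p \<in> SP {w \<in> V. \<forall>x\<in>S \<inter> T. w \<in> star x}"
    using assms(3) p q by (intro SP_Inter_star) auto
  moreover have "{w \<in> V. \<forall>x\<in>S \<inter> T. w \<in> star x} = {}" using assms(4) by blast
  ultimately have "iv q \<bullet> p = \<one>\<^bsub>A\<^esub>" using SP_empty by simp
  then have "p = q" using p q by (metis A.inv_equality A.inv_inv A.inv_closed)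
  then show "\<exists>p\<in>carrier A. \<forall>v\<in>S \<union> T. \<phi> (gen v) = cj p (gen v)" using p q by blast
qed

text \<open>After undoing the first conjugator, the conjugate of \<open>w\<close> commutes with
  \<open>v\<close> and lies in the subgroup of the star of \<open>v\<close>. Retracting its
  conjugator onto that star gives an equivalent one which also fixes \<open>v\<close>, so the first
  conjugator can absorb it.\<close>

lemma edge_common_conj:
  assumes \<phi>: "\<phi> \<in> PSA V E" and vw: "(v, w) \<in> E"
  shows "\<exists>k\<in>carrier A. \<phi> (gen v) = cj k (gen v) \<and> \<phi> (gen w) = cj k (gen w)"
proof -
  have V: "v \<in> V" "w \<in> V" "w \<in> star v" using vw E_subset by (auto simp: star_def link_def)
  obtain g where g: "g \<in> carrier A" "\<phi> (gen v) = cj g (gen v)" using PSA_conj \<phi> V by blast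
  obtain g' where g': "g' \<in> carrier A" "\<phi> (gen w) = cj g' (gen w)" using PSA_conj \<phi> V by blast
  define y where "y = cj (iv g \<bullet> g') (gen w)"
  have y: "y \<in> carrier A" "\<phi> (gen w) = cj g y" using g g' V by (auto simp: y_def A.conj_by_mult)
  have "\<phi> (gen w) \<bullet> \<phi> (gen v) = \<phi> (gen v) \<bullet> \<phi> (gen w)"
    using hom_mult[OF PSA_hom[OF \<phi>], of "gen v" "gen w"] hom_mult[OF PSA_hom[OF \<phi>], of "gen w" "gen v"]
      gen_commute[OF vw] V by simp
  then have "cj g y \<bullet> cj g (gen v) = cj g (gen v) \<bullet> cj g y" by (simp only: g y)
  then have "y \<bullet> gen v = gen v \<bullet> y"
    using A.commutes_conj_by[of "iv g" "cj g y" "cj g (gen v)"] g y V by simp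
  then have yS: "y \<in> SP (star v)" using centralizer_gen V y by blast
  define h where "h = ret (star v) (iv g \<bullet> g')"
  have h: "h \<in> SP (star v)" unfolding h_def using g g' by (intro ret_in_SP) simp
  have hc: "h \<in> carrier A" using h SP_closed by simp
  have "y = ret (star v) y" using ret_SP[OF yS] by simp
  also have "\<dots> = cj h (gen w)" using g g' V by (simp add: y_def ret_conj h_def ret_gen)
  finally have "\<phi> (gen w) = cj (g \<bullet> h) (gen w)" using y g hc V by (simp add: A.conj_by_mult)
  moreover have "\<phi> (gen v) = cj (g \<bullet> h) (gen v)" using g h V conj_gen_SP by simp
  ultimately show ?thesis using g hc by blast
qed

text \<open>Edge conjugators of consecutive edges of a cycle differ by elements of vertex stars. Retracting the
  cyclic product of these differences onto one star kills or simplifies all other factors.\<close>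

lemma periodic_cycle_rigid:
  fixes v :: "nat \<Rightarrow> 'a"
  assumes n: "5 \<le> n" and per: "\<And>i. v (i + n) = v i"
    and edge: "\<And>i. (v i, v (i + 1)) \<in> E"
    and c1: "\<And>i. star (v i) \<inter> star (v (i + 1)) \<subseteq> {v i, v (i + 1)}"
    and c2: "\<And>i. star (v i) \<inter> star (v (i + 2)) \<subseteq> {v (i + 1)}"
    and c3: "\<And>i j. 3 \<le> j \<Longrightarrow> j \<le> n - 3 \<Longrightarrow> star (v i) \<inter> star (v (i + j)) = {}"
    and dist: "\<And>i j. 0 < j \<Longrightarrow> j < n \<Longrightarrow> v (i + j) \<noteq> v i"
  shows "rigid (range v)"
  unfolding rigid_def
proof
  fix \<phi> assume \<phi>: "\<phi> \<in> PSA V E"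
  have vV: "v i \<in> V" for i using edge E_subset by blast
  have perm: "v (i mod n) = v i" for i using periodic_mod[of v n i 0] per by simp
  have perm1: "v (i mod n + j) = v (i + j)" for i j
    using periodic_mod[of v n i j] per by simp
  define good where "good k i \<longleftrightarrow> k \<in> carrier A \<and> \<phi> (gen (v i)) = cj k (gen (v i))" for k i
  have good_per: "good k (i mod n) \<longleftrightarrow> good k i" "good k (i mod n + j) \<longleftrightarrow> good k (i + j)" for k i j
    by (simp_all add: good_def perm perm1)
  have good_diff: "iv k \<bullet> k' \<in> SP (star (v i))" if "good k i" "good k' i" for k k' i
    using that conj_gen_eq_iff[OF vV[of i], of k' k] by (simp add: good_def)
  have good_mult: "good (k \<bullet> z) i" if "good k i" "z \<in> SP (star (v i))" for k z i
    using that conj_gen_SP[OF vV[of i], of k z] SP_closed by (simp add: good_def)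
  have nb: "v i \<in> star (v i)" "v (i + 1) \<in> star (v i)" "v i \<in> star (v (i + 1))" for i
    using edge[of i] E_sym by (auto simp: star_def link_def)
  have pair: "z \<in> SP (star (v i))" "z \<in> SP (star (v (i + 1)))" if "z \<in> SP {v i, v (i + 1)}" for z i
  proof -
    have "{v i, v (i + 1)} \<subseteq> star (v i)" "{v i, v (i + 1)} \<subseteq> star (v (i + 1))"
      using nb[of i] nb(1)[of "i + 1"] by auto
    then show "z \<in> SP (star (v i))" "z \<in> SP (star (v (i + 1)))" using that SP_mono by blast+
  qed
  have "\<exists>f. (\<forall>i. good (f i) i \<and> good (f i) (i + 1)) \<and> (\<forall>i. f (i + n) = f i)"
  proof (rule periodic_choice)
    show "\<exists>x. good x i \<and> good x (i + 1)" for i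
      using edge_common_conj[OF \<phi> edge[of i]] unfolding good_def by blast
  qed (simp only: good_per)
  then obtain k where k: "\<And>i. good (k i) i" "\<And>i. good (k i) (i + 1)" "\<And>i. k (i + n) = k i" by blast
  have kc: "k i \<in> carrier A" for i using k(1)[of i] by (simp add: good_def)
  have "\<exists>m. good m i \<and> good m (i + 1) \<and> good m (i + 2)" for i
  proof -
    \<comment> \<open>The conjugators of the edges are viewed in the star of the vertex shared by
      edges \<open>i\<close> and \<open>i + 1\<close>.\<close>
    define R where "R = ret (star (v (i + 1)))"
    define K where "K j = R (k j)" for j
    have Kc: "K j \<in> carrier A" for j using kc by (simp add: K_def R_def)
    have step: "iv (K j) \<bullet> K (j + 1) \<in> SP (star (v (i + 1)) \<inter> star (v (j + 1)))" for j
    proof -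
      have "iv (k j) \<bullet> k (j + 1) \<in> SP (star (v (j + 1)))" using good_diff k by blast
      from SP_ret[OF this, of "star (v (i + 1))"] show ?thesis using kc by (simp add: K_def R_def)
    qed
    have prod: "K j \<bullet> (iv (K j) \<bullet> K j') = K j'" for j j' using Kc by simp
    \<comment> \<open>The part of the product just after the shared vertex: its stars meet the
      chosen one only in \<open>v (i + 1)\<close> and \<open>v (i + 2)\<close>.\<close>
    define \<alpha> where "\<alpha> = iv (K (i + 1)) \<bullet> K (i + 3)"
    have \<alpha>: "\<alpha> \<in> SP {v (i + 1), v (i + 2)}"
    proof -
      have 1: "iv (K (i + 1)) \<bullet> K (i + 2) \<in> SP {v (i + 1), v (i + 2)}"
        using step[of "i + 1"] SP_mono[OF c1[of "i + 1"]] by simp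
      have 2: "iv (K (i + 2)) \<bullet> K (i + 3) \<in> SP {v (i + 2)}"
        using step[of "i + 2"] SP_mono[OF c2[of "i + 1"]] by (simp add: numeral_eq_Suc)
      have "iv (K (i + 1)) \<bullet> K (i + 2) \<bullet> (iv (K (i + 2)) \<bullet> K (i + 3)) \<in> SP {v (i + 1), v (i + 2)}"
        by (rule SP_mult[OF 1 SP_mono[OF _ 2]]) simp
      then show ?thesis using Kc by (simp add: \<alpha>_def A.m_assoc)
    qed
    \<comment> \<open>Vertices at distance at least 3 along the cycle have stars disjoint from the
      chosen one, so these factors vanish.\<close>
    have const: "K (i + 3) = K (i + 3 + r)" if "3 + r \<le> n - 2" for r
      using that
    proof (induction r)
      case (Suc r)
      have "star (v (i + 1)) \<inter> star (v (i + 1 + (3 + r))) = {}" using Suc by (intro c3) auto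
      then have "iv (K (i + 3 + r)) \<bullet> K (i + 3 + r + 1) \<in> SP {}" using step[of "i + 3 + r"] by (simp add: algebra_simps)
      then have "iv (K (i + 3 + r)) \<bullet> K (i + 3 + r + 1) = \<one>\<^bsub>A\<^esub>" using SP_empty by simp
      then have "K (i + 3 + r + 1) = K (i + 3 + r)" using prod[of "i + 3 + r" "i + 3 + r + 1"] Kc by simp
      then show ?case using Suc by simp
    qed simp
    \<comment> \<open>The part just before the shared vertex, after wrapping around the cycle; here
      only \<open>v i\<close> and \<open>v (i + 1)\<close> survive.\<close>
    define \<beta> where "\<beta> = iv (K (i + 3)) \<bullet> K i"
    have \<beta>: "\<beta> \<in> SP {v i, v (i + 1)}"
    proof -
      have e: "K (i + 3) = K (i + n - 2)" 
      proof -
        have "i + 3 + (n - 5) = i + n - 2" using n by simp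
        then show ?thesis using const[of "n - 5"] n by simp
      qed
      have "star (v (i + n - 1)) \<inter> star (v (i + n - 1 + 2)) \<subseteq> {v (i + n - 1 + 1)}" by (rule c2)
      moreover have "i + n - 1 + 2 = (i + 1) + n" "i + n - 1 + 1 = i + n" "i + n - 2 + 1 = i + n - 1" using n by auto
      ultimately have "star (v (i + 1)) \<inter> star (v (i + n - 2 + 1)) \<subseteq> {v i}" using per by (metis Int_commute)
      then have 1: "iv (K (i + n - 2)) \<bullet> K (i + n - 1) \<in> SP {v i}"
        using step[of "i + n - 2"] SP_mono \<open>i + n - 2 + 1 = i + n - 1\<close> by metis
      have "star (v (i + 1)) \<inter> star (v (i + n - 1 + 1)) \<subseteq> {v i, v (i + 1)}"
        using c1[of i] per[of i] \<open>i + n - 1 + 1 = i + n\<close> by auto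
      then have 2: "iv (K (i + n - 1)) \<bullet> K i \<in> SP {v i, v (i + 1)}"
        using step[of "i + n - 1"] SP_mono \<open>i + n - 1 + 1 = i + n\<close> k(3)[of i] by (metis K_def)
      have "iv (K (i + n - 2)) \<bullet> K (i + n - 1) \<bullet> (iv (K (i + n - 1)) \<bullet> K i) \<in> SP {v i, v (i + 1)}"
        by (rule SP_mult[OF SP_mono[OF _ 1] 2]) simp
      then show ?thesis using Kc by (simp add: \<beta>_def e A.m_assoc)
    qed
    have ac: "\<alpha> \<in> carrier A" "\<beta> \<in> carrier A" using \<alpha> \<beta> SP_closed by auto
    \<comment> \<open>This difference is fixed by the retraction, so the closed product determines
      it from \<open>\<alpha>\<close> and \<open>\<beta>\<close>. Moving each factor to its own side
      gives one conjugator for three consecutive vertices.\<close>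
    have "iv (k i) \<bullet> k (i + 1) \<in> SP (star (v (i + 1)))" using good_diff k by blast
    then have "iv (k i) \<bullet> k (i + 1) = iv (K i) \<bullet> K (i + 1)"
      using ret_SP kc by (fastforce simp: K_def R_def)
    also have "\<dots> = iv \<beta> \<bullet> iv \<alpha>" using Kc by (simp add: \<alpha>_def \<beta>_def A.inv_mult_group A.m_assoc)
    finally have "k i \<bullet> (iv (k i) \<bullet> k (i + 1)) \<bullet> \<alpha> = k i \<bullet> (iv \<beta> \<bullet> iv \<alpha>) \<bullet> \<alpha>" by simp
    then have eq: "k (i + 1) \<bullet> \<alpha> = k i \<bullet> iv \<beta>" using kc ac by (simp add: A.m_assoc)
    have "good (k i \<bullet> iv \<beta>) i" using k(1) pair(1) \<beta> SP_inv good_mult by blast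
    moreover have "good (k (i + 1) \<bullet> \<alpha>) (i + 1)" "good (k (i + 1) \<bullet> \<alpha>) (i + 2)"
      using k(1,2)[of "i + 1"] pair[of \<alpha> "i + 1"] \<alpha> good_mult by (auto simp: numeral_2_eq_2)
    ultimately show ?thesis using eq by metis
  qed
  then have "\<exists>f. (\<forall>i. good (f i) i \<and> good (f i) (i + 1) \<and> good (f i) (i + 2)) \<and> (\<forall>i. f (i + n) = f i)"
    by (intro periodic_choice) (simp_all only: good_per)
  then obtain m where m: "\<And>i. good (m i) i" "\<And>i. good (m i) (i + 1)" "\<And>i. good (m i) (i + 2)"
    "\<And>i. m (i + n) = m i" by blast
  have mc: "m i \<in> carrier A" for i using m(1)[of i] by (simp add: good_def)
  have mper: "m (i mod n + 1) = m (i + 1)" "m (i mod n) = m i" for i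
    using periodic_mod[of m n i 0] periodic_mod[of m n i 1] m(4) by simp_all
  \<comment> \<open>Conjugators of consecutive triples share two adjacent vertices, so their
    difference lies in a subgroup generated by one edge.\<close>
  have "\<exists>a b. iv (m i) \<bullet> m (i + 1) = gen (v (i + 1)) [^]\<^bsub>A\<^esub> (a::int) \<bullet> gen (v (i + 2)) [^]\<^bsub>A\<^esub> (b::int)" for i
  proof -
    have "iv (m i) \<bullet> m (i + 1) \<in> SP (star (v (i + 1)))"
      using good_diff[OF m(2)[of i] m(1)[of "i + 1"]] .
    moreover have "iv (m i) \<bullet> m (i + 1) \<in> SP (star (v (i + 2)))"
      using good_diff[OF m(3)[of i], of "m (i + 1)"] m(2)[of "i + 1"] by (simp add: numeral_2_eq_2)
    ultimately have "iv (m i) \<bullet> m (i + 1) \<in> SP {v (i + 1), v (i + 2)}"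
      using SP_Int SP_mono[OF c1[of "i + 1"]] by (auto simp: numeral_2_eq_2)
    then show ?thesis using edge[of "i + 1"] by (intro SP_edge) (simp_all add: numeral_2_eq_2)
  qed
  then have "\<exists>f. (\<forall>i. \<exists>b. iv (m i) \<bullet> m (i + 1) = gen (v (i + 1)) [^]\<^bsub>A\<^esub> (f i::int) \<bullet> gen (v (i + 2)) [^]\<^bsub>A\<^esub> (b::int))
      \<and> (\<forall>i. f (i + n) = f i)"
    by (intro periodic_choice) (simp_all only: mper perm1)
  then obtain a where a: "\<And>i. \<exists>b. iv (m i) \<bullet> m (i + 1) = gen (v (i + 1)) [^]\<^bsub>A\<^esub> (a i::int) \<bullet> gen (v (i + 2)) [^]\<^bsub>A\<^esub> (b::int)"
    and aper: "\<And>i. a (i + n) = a i" by blast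
  \<comment> \<open>Absorbing the power of \<open>v (i + 1)\<close> leaves only a power of
    \<open>v (i + 2)\<close> as difference; \<open>m'\<close> is still correct at
    \<open>v (i + 1)\<close>.\<close>
  define m' where "m' i = m i \<bullet> gen (v (i + 1)) [^]\<^bsub>A\<^esub> a i" for i
  have m'c: "m' i \<in> carrier A" for i using mc vV by (simp add: m'_def)
  have m'per: "m' (i + n) = m' i" for i using m(4) aper per[of "i + 1"] by (simp add: m'_def)
  have "\<exists>e::int. m' (i + 1) = m' i \<bullet> gen (v (i + 2)) [^]\<^bsub>A\<^esub> e" for i
  proof -
    obtain b where b: "iv (m i) \<bullet> m (i + 1) = gen (v (i + 1)) [^]\<^bsub>A\<^esub> (a i::int) \<bullet> gen (v (i + 2)) [^]\<^bsub>A\<^esub> (b::int)"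
      using a by blast
    have "m (i + 1) = m i \<bullet> (iv (m i) \<bullet> m (i + 1))" using mc by simp
    also have "\<dots> = m' i \<bullet> gen (v (i + 2)) [^]\<^bsub>A\<^esub> b" unfolding b using mc vV by (simp add: m'_def A.m_assoc)
    finally have "m' (i + 1) = m' i \<bullet> (gen (v (i + 2)) [^]\<^bsub>A\<^esub> b \<bullet> gen (v (i + 2)) [^]\<^bsub>A\<^esub> a (i + 1))"
      using m'c vV by (simp add: m'_def[of "Suc i"] numeral_2_eq_2 A.m_assoc)
    then show ?thesis using A.int_pow_mult[OF gen_closed[OF vV[of "i + 2"]], of b "a (i + 1)"]
      by (intro exI[of _ "b + a (i + 1)"]) simp
  qed
  then obtain e where e: "\<And>i. m' (i + 1) = m' i \<bullet> gen (v (i + 2)) [^]\<^bsub>A\<^esub> (e i::int)" by metis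
  have ee: "ex w (m' (i + 1)) = ex w (m' i) + (if v (i + 2) = w then e i else 0)" for w i
    unfolding e using m'c vV by (simp add: ex_int_pow ex_gen)
  \<comment> \<open>Within one period \<open>v (i + 2)\<close> occurs in a single difference, while
    its exponent sum in \<open>m'\<close> returns to its value after a full turn.\<close>
  have "e i = 0" for i
  proof -
    have "ex (v (i + 2)) (m' (i + 1 + r)) = ex (v (i + 2)) (m' (i + 1))" if "r < n" for r
      using that
    proof (induction r)
      case (Suc r)
      have "v (i + 2 + Suc r) \<noteq> v (i + 2)" using dist Suc by blast
      then show ?case using ee[of "v (i + 2)" "i + 1 + r"] Suc by (simp add: numeral_2_eq_2)
    qed simp
    from this[of "n - 1"] have "ex (v (i + 2)) (m' (i + n)) = ex (v (i + 2)) (m' (i + 1))" using n by simp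
    then show ?thesis using ee[of "v (i + 2)" i] m'per by simp
  qed
  then have m'eq: "m' (Suc i) = m' i" for i using e[of i] m'c vV by simp
  have m'0: "m' i = m' 0" for i by (induction i) (auto simp: m'eq)
  have gd: "good (m' i) (i + 1)" for i
    unfolding m'_def using m(2)[of i] SP_int_pow[OF vV] nb(1) by (intro good_mult) auto
  have g: "good (m' 0) (Suc i)" for i using gd[of i] m'0[of i] by simp
  have "good (m' 0) i" for i
    using g[of "i + n - 1"] n good_per(1)[of "m' 0" "i + n"] good_per(1)[of "m' 0" i] by simp
  then show "\<exists>p\<in>carrier A. \<forall>x\<in>range v. \<phi> (gen x) = cj p (gen x)"
    using m'c[of 0] by (intro bexI[of _ "m' 0"]) (auto simp: good_def)
qed

text \<open>A vertex outside the cycle sees at most one of its vertices, so stars of distinct cycle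
  vertices can only meet on the cycle. What remains is arithmetic with indices modulo
  \<open>n\<close>.\<close>

lemma cycle_rigid:
  fixes v :: "nat \<Rightarrow> 'a"
  assumes n: "5 \<le> n" and inj: "inj_on v {..<n}"
    and edge: "\<And>i. Suc i < n \<Longrightarrow> (v i, v (Suc i)) \<in> E" and close: "(v (n - 1), v 0) \<in> E"
    and induced: "\<And>i j. i < j \<Longrightarrow> j < n \<Longrightarrow> (v i, v j) \<in> E \<Longrightarrow> j = Suc i \<or> (i = 0 \<and> j = n - 1)"
    and outside: "\<And>w i j. w \<notin> v ` {..<n} \<Longrightarrow> i < n \<Longrightarrow> j < n \<Longrightarrow> (w, v i) \<in> E \<Longrightarrow> (w, v j) \<in> E \<Longrightarrow> i = j"
  shows "rigid (v ` {..<n})"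
proof -
  define w where "w i = v (i mod n)" for i
  have n0: "n > 0" using n by simp
  have rng: "range w = v ` {..<n}"
  proof
    show "range w \<subseteq> v ` {..<n}" using n0 by (auto simp: w_def)
    show "v ` {..<n} \<subseteq> range w"
    proof
      fix x assume "x \<in> v ` {..<n}"
      then obtain i where "i < n" "x = v i" by auto
      then have "x = w i" by (simp add: w_def)
      then show "x \<in> range w" by simp
    qed
  qed
  have w_eq: "w a = w b \<longleftrightarrow> a mod n = b mod n" for a b
    using inj n0 by (auto simp: w_def dest: inj_onD)
  have mod_shift: "(i + a) mod n = (i + b) mod n \<longleftrightarrow> a mod n = b mod n" for i a b
  proof (induction a b rule: linorder_wlog)
    case (le a b)
    have "(i + b) mod n = (i + a) mod n \<longleftrightarrow> b mod n = a mod n"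
      using le by (simp add: mod_eq_dvd_iff_nat)
    then show ?case by metis
  qed metis
  have wE: "(w i, w (i + 1)) \<in> E" for i
  proof (cases "Suc (i mod n) < n")
    case True
    then have "(i + 1) mod n = Suc (i mod n)" by (simp add: mod_Suc)
    then show ?thesis using edge[OF True] by (simp add: w_def)
  next
    case False
    then have e: "i mod n = n - 1" using n0 mod_less_divisor[of n i] by linarith
    then have "(i + 1) mod n = 0" using n0 by (simp add: mod_Suc)
    then show ?thesis using close e by (simp add: w_def)
  qed
  have adj: "b mod n = (a + 1) mod n \<or> b mod n = (a + (n - 1)) mod n" if ab: "(w a, w b) \<in> E" for a b
  proof -
    let ?a = "a mod n" and ?b = "b mod n"
    have lt: "?a < n" "?b < n" using n0 by auto
    have suc: "y mod n = (x + 1) mod n" if "y mod n = Suc (x mod n)" for x y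
      using that n0 mod_less_divisor[of n y] by (simp add: mod_Suc)
    have wrap: "y mod n = (x + 1) mod n" if "y mod n = 0" "x mod n = n - 1" for x y
      using that n0 by (simp add: mod_Suc)
    have pred: "y mod n = (x + (n - 1)) mod n" if "x mod n = (y + 1) mod n" for x y
    proof -
      have "(x + (n - 1)) mod n = (x mod n + (n - 1)) mod n" by (simp add: mod_add_left_eq)
      also have "\<dots> = (y + 1 + (n - 1)) mod n" unfolding that by (simp add: mod_add_left_eq)
      also have "\<dots> = y mod n" using n0 by simp
      finally show ?thesis by simp
    qed
    have "?a \<noteq> ?b" using ab E_irrefl by (auto simp: w_def)
    then consider "?a < ?b" | "?b < ?a" by linarith
    then show ?thesis
    proof cases
      case 1
      then have "?b = Suc ?a \<or> (?a = 0 \<and> ?b = n - 1)" using induced lt ab by (simp add: w_def)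
      then show ?thesis using suc[of b a] pred[of a b] wrap[of a b] by metis
    next
      case 2
      then have "?a = Suc ?b \<or> (?b = 0 \<and> ?a = n - 1)" using induced lt ab E_sym by (simp add: w_def)
      then show ?thesis using suc[of a b] pred[of a b] wrap[of b a] by metis
    qed
  qed
  have on_cycle: "\<exists>s\<in>{0, 1, n - 1}. x = w (a + s)" if x: "x \<in> star (w a)" "x \<in> range w" for x a
  proof -
    obtain b where b: "x = w b" using x(2) by blast
    show ?thesis using x(1) adj[of a b] unfolding b star_def link_def w_eq[symmetric] by force
  qed
  have dist: "w (i + j) \<noteq> w i" if "0 < j" "j < n" for i j
    using that mod_shift[of i j 0] by (simp add: w_eq)
  \<comment> \<open>The offset \<open>n - 1\<close> stands for -1. A common vertex has an offset
    from 0, 1, -1 at both ends; as the sums are below \<open>2 * n\<close>, the congruence leaves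
    two equations.\<close>
  have common: "\<exists>r\<in>{0, 1, n - 1}. \<exists>s\<in>{0, 1, n - 1}. x = w (i + r) \<and> (r = j + s \<or> r + n = j + s)"
    if j: "0 < j" "j < n" and x: "x \<in> star (w i)" "x \<in> star (w (i + j))" for x i j
  proof -
    have xr: "x \<in> range w"
    proof (rule ccontr)
      assume nx: "x \<notin> range w"
      then have "(x, w i) \<in> E" "(x, w (i + j)) \<in> E" using x E_sym by (auto simp: star_def link_def)
      then have "i mod n = (i + j) mod n" using outside[of x] nx n0 unfolding rng w_def by simp
      then show False using dist[OF j, of i] by (simp add: w_def)
    qed
    obtain r where r: "r \<in> {0, 1, n - 1}" "x = w (i + r)" using on_cycle[OF x(1) xr] by blast
    obtain s where s: "s \<in> {0, 1, n - 1}" "x = w (i + j + s)" using on_cycle[OF x(2) xr] by blast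
    have "(i + r) mod n = (i + (j + s)) mod n" using r s by (simp add: w_eq add.assoc)
    then have m: "r mod n = (j + s) mod n" by (simp only: mod_shift)
    have rn: "r < n" "s < n" using r s n by auto
    have "r = j + s \<or> r + n = j + s"
    proof (cases "j + s < n")
      case True
      then show ?thesis using m rn by simp
    next
      case False
      then have "(j + s) mod n = j + s - n" using rn j by (simp add: mod_if)
      then show ?thesis using m rn False by simp
    qed
    then show ?thesis using r s by blast
  qed
  have "rigid (range w)"
  proof (rule periodic_cycle_rigid[OF n])
    show "w (i + n) = w i" for i by (simp add: w_def)
    show "star (w i) \<inter> star (w (i + 1)) \<subseteq> {w i, w (i + 1)}" for i
      using common[of 1 _ i] n by fastforce
    show "star (w i) \<inter> star (w (i + 2)) \<subseteq> {w (i + 1)}" for i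
      using common[of 2 _ i] n by fastforce
    show "star (w i) \<inter> star (w (i + j)) = {}" if "3 \<le> j" "j \<le> n - 3" for i j
      using common[of j _ i] n that by fastforce
  qed (use wE dist in auto)
  then show ?thesis by (simp add: rng)
qed

end

section \<open>Outer automorphisms\<close>

text \<open>Applied with \<open>g\<close> the sign vector of an automorphism and \<open>f\<close>
  its coset.\<close>

lemma finite_image_factor:
  assumes "finite (g ` S)" "\<And>x y. x \<in> S \<Longrightarrow> y \<in> S \<Longrightarrow> g x = g y \<Longrightarrow> f x = f y"
  shows "finite (f ` S)"
proof -
  have "f x = f (inv_into S g (g x))" if "x \<in> S" for x
    using that assms(2)[OF that inv_into_into[of "g x" g S]] f_inv_into_f[of "g x" g S] by auto
  then have "f ` S \<subseteq> (\<lambda>s. f (inv_into S g s)) ` (g ` S)" by blast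
  then show ?thesis using assms(1) finite_subset by blast
qed

context group begin

lemma carrier_AutoGroup: "carrier (AutoGroup G) = auto G" by (simp add: AutoGroup_def)

lemma auto_hom: "\<phi> \<in> auto G \<Longrightarrow> \<phi> \<in> hom G G" by (simp add: auto_def)

lemma auto_closed: "\<phi> \<in> auto G \<Longrightarrow> x \<in> carrier G \<Longrightarrow> \<phi> x \<in> carrier G"
  using hom_in_carrier[OF auto_hom] by blast

lemma auto_eqI:
  assumes "\<phi> \<in> auto G" "\<psi> \<in> auto G" "\<And>x. x \<in> carrier G \<Longrightarrow> \<phi> x = \<psi> x"
  shows "\<phi> = \<psi>"
  using assms by (auto simp: auto_def Bij_def intro: extensionalityI)

lemma mult_AutoGroup:
  assumes "\<phi> \<in> auto G" "\<psi> \<in> auto G" "x \<in> carrier G"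
  shows "(\<phi> \<otimes>\<^bsub>AutoGroup G\<^esub> \<psi>) x = \<phi> (\<psi> x)"
  using assms by (simp add: AutoGroup_def BijGroup_def auto_def compose_def)

lemma inv_AutoGroup_closed: "\<phi> \<in> auto G \<Longrightarrow> inv\<^bsub>AutoGroup G\<^esub> \<phi> \<in> auto G"
  using group.inv_closed[OF AutoGroup, of \<phi>] by (simp add: carrier_AutoGroup)

lemma inv_AutoGroup:
  assumes "\<phi> \<in> auto G" "x \<in> carrier G"
  shows "(inv\<^bsub>AutoGroup G\<^esub> \<phi>) (\<phi> x) = x" "\<phi> ((inv\<^bsub>AutoGroup G\<^esub> \<phi>) x) = x"
proof -
  interpret AG: group "AutoGroup G" by (rule AutoGroup)
  note i = inv_AutoGroup_closed[OF assms(1)]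
  have one: "\<one>\<^bsub>AutoGroup G\<^esub> x = x" using assms(2) by (simp add: AutoGroup_def BijGroup_def)
  show "(inv\<^bsub>AutoGroup G\<^esub> \<phi>) (\<phi> x) = x" "\<phi> ((inv\<^bsub>AutoGroup G\<^esub> \<phi>) x) = x"
    using mult_AutoGroup[OF i assms(1,2)] mult_AutoGroup[OF assms(1) i assms(2)] AG.l_inv[of \<phi>] AG.r_inv[of \<phi>]
      one assms by (simp_all add: carrier_AutoGroup)
qed

lemma autoI:
  assumes "\<phi> \<in> hom G G" "\<psi> \<in> hom G G"
    "\<And>x. x \<in> carrier G \<Longrightarrow> \<phi> (\<psi> x) = x" "\<And>x. x \<in> carrier G \<Longrightarrow> \<psi> (\<phi> x) = x"
  shows "restrict \<phi> (carrier G) \<in> auto G"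
proof -
  have "bij_betw \<phi> (carrier G) (carrier G)"
    by (rule bij_betw_byWitness[where f' = \<psi>])
      (use assms(3,4) hom_in_carrier[OF assms(1)] hom_in_carrier[OF assms(2)] in auto)
  then have "bij_betw (restrict \<phi> (carrier G)) (carrier G) (carrier G)"
    by (rule bij_betw_cong[THEN iffD1, rotated]) auto
  moreover have "restrict \<phi> (carrier G) \<in> hom G G"
    using assms(1) by (auto simp: hom_def Pi_iff)
  ultimately show ?thesis by (simp add: auto_def Bij_def)
qed

definition inner :: "'a \<Rightarrow> 'a \<Rightarrow> 'a" where "inner g = restrict (conj_by g) (carrier G)"

lemma inner_auto: "g \<in> carrier G \<Longrightarrow> inner g \<in> auto G"
  unfolding inner_def by (rule autoI[of _ "conj_by (inv g)"]) (auto simp: conj_by_hom)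

lemma inner_apply: "x \<in> carrier G \<Longrightarrow> inner g x = conj_by g x" by (simp add: inner_def)

lemma inn_eq: "inn G = inner ` carrier G"
proof -
  have "inner g = (\<lambda>x\<in>carrier G. g \<otimes> x \<otimes> inv g)" for g by (auto simp: inner_def conj_by_def fun_eq_iff)
  then show ?thesis unfolding inn_def by auto
qed

lemma inner_mult:
  assumes "g \<in> carrier G" "h \<in> carrier G"
  shows "inner g \<otimes>\<^bsub>AutoGroup G\<^esub> inner h = inner (g \<otimes> h)"
proof (rule auto_eqI)
  interpret AG: group "AutoGroup G" by (rule AutoGroup)
  show "inner g \<otimes>\<^bsub>AutoGroup G\<^esub> inner h \<in> auto G"
    using AG.m_closed inner_auto assms by (simp add: carrier_AutoGroup)
qed (use assms in \<open>auto simp: inner_auto mult_AutoGroup inner_apply conj_by_mult\<close>)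

lemma inn_normal: "inn G \<lhd> AutoGroup G"
proof -
  interpret AG: group "AutoGroup G" by (rule AutoGroup)
  have one: "inner \<one> = \<one>\<^bsub>AutoGroup G\<^esub>"
    by (auto simp: inner_def AutoGroup_def BijGroup_def fun_eq_iff)
  have inv: "inv\<^bsub>AutoGroup G\<^esub> (inner g) = inner (inv g)" if "g \<in> carrier G" for g
    using that inner_mult[of "inv g" g] inner_auto by (intro AG.inv_equality) (auto simp: one carrier_AutoGroup)
  have "subgroup (inn G) (AutoGroup G)"
    by (rule AG.subgroupI) (auto simp: inn_eq carrier_AutoGroup inner_auto inv inner_mult)
  moreover have "\<phi> \<otimes>\<^bsub>AutoGroup G\<^esub> inner g \<otimes>\<^bsub>AutoGroup G\<^esub> inv\<^bsub>AutoGroup G\<^esub> \<phi> = inner (\<phi> g)"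
    if "\<phi> \<in> auto G" "g \<in> carrier G" for \<phi> g
  proof (rule auto_eqI)
    have c: "inner g \<in> auto G" "inv\<^bsub>AutoGroup G\<^esub> \<phi> \<in> auto G" "\<phi> \<otimes>\<^bsub>AutoGroup G\<^esub> inner g \<in> auto G"
      using inner_auto that inv_AutoGroup_closed AG.m_closed by (auto simp: carrier_AutoGroup)
    then show "\<phi> \<otimes>\<^bsub>AutoGroup G\<^esub> inner g \<otimes>\<^bsub>AutoGroup G\<^esub> inv\<^bsub>AutoGroup G\<^esub> \<phi> \<in> auto G"
      using AG.m_closed by (simp add: carrier_AutoGroup)
    show "inner (\<phi> g) \<in> auto G" using that by (simp add: inner_auto auto_closed)
    fix x assume x: "x \<in> carrier G"
    have y: "(inv\<^bsub>AutoGroup G\<^esub> \<phi>) x \<in> carrier G" using c x auto_closed by blast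
    show "(\<phi> \<otimes>\<^bsub>AutoGroup G\<^esub> inner g \<otimes>\<^bsub>AutoGroup G\<^esub> inv\<^bsub>AutoGroup G\<^esub> \<phi>) x = inner (\<phi> g) x"
      using c x y that hom_conj_by[OF is_group is_group auto_hom, of \<phi> g "(inv\<^bsub>AutoGroup G\<^esub> \<phi>) x"]
      by (simp add: mult_AutoGroup inner_apply inv_AutoGroup)
  qed
  ultimately show ?thesis
    by (auto simp: AG.normal_inv_iff carrier_AutoGroup inn_eq auto_closed)
qed

end

section \<open>Pure symmetric automorphisms modulo inner ones\<close>

context raag begin

abbreviation "AG \<equiv> AutoGroup A"
abbreviation "outer \<phi> \<equiv> inn A #>\<^bsub>AG\<^esub> \<phi>"

sublocale AG: group AG by (rule A.AutoGroup)

lemma outer_mult: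
  assumes "\<phi> \<in> auto A" "\<psi> \<in> auto A"
  shows "outer \<phi> \<otimes>\<^bsub>OutGroup A\<^esub> outer \<psi> = outer (\<phi> \<otimes>\<^bsub>AG\<^esub> \<psi>)"
  using normal.rcos_sum[OF A.inn_normal] assms by (simp add: OutGroup_def A.carrier_AutoGroup)

lemma PSA_auto: "\<phi> \<in> PSA V E \<Longrightarrow> \<phi> \<in> auto A" by (simp add: PSA_def)

lemma PSA_I:
  assumes "\<phi> \<in> auto A" "\<And>v. v \<in> V \<Longrightarrow> \<exists>g\<in>carrier A. \<phi> (gen v) = cj g (gen v)"
  shows "\<phi> \<in> PSA V E"
  using assms by (simp add: PSA_def A.conj_by_def)

lemma hom_conj: "\<phi> \<in> hom A A \<Longrightarrow> g \<in> carrier A \<Longrightarrow> x \<in> carrier A \<Longrightarrow> \<phi> (cj g x) = cj (\<phi> g) (\<phi> x)"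
  using hom_conj_by[OF A.is_group A.is_group] .

lemma PSA_mult:
  assumes "\<phi> \<in> PSA V E" "\<psi> \<in> PSA V E"
  shows "\<phi> \<otimes>\<^bsub>AG\<^esub> \<psi> \<in> PSA V E"
proof (rule PSA_I)
  note au = PSA_auto[OF assms(1)] PSA_auto[OF assms(2)]
  show "\<phi> \<otimes>\<^bsub>AG\<^esub> \<psi> \<in> auto A" using AG.m_closed au by (simp add: A.carrier_AutoGroup)
  fix v assume v: "v \<in> V"
  obtain g where g: "g \<in> carrier A" "\<psi> (gen v) = cj g (gen v)" using PSA_conj assms v by blast
  obtain h where h: "h \<in> carrier A" "\<phi> (gen v) = cj h (gen v)" using PSA_conj assms v by blast
  have pg: "\<phi> g \<in> carrier A" using A.auto_closed au g by blast
  have "(\<phi> \<otimes>\<^bsub>AG\<^esub> \<psi>) (gen v) = \<phi> (cj g (gen v))" using au v g by (simp add: A.mult_AutoGroup)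
  also have "\<dots> = cj (\<phi> g) (cj h (gen v))" using hom_conj[OF A.auto_hom[OF au(1)]] g h v by simp
  also have "\<dots> = cj (\<phi> g \<bullet> h) (gen v)" using pg h v by (simp add: A.conj_by_mult)
  finally show "\<exists>g\<in>carrier A. (\<phi> \<otimes>\<^bsub>AG\<^esub> \<psi>) (gen v) = cj g (gen v)" using pg h by blast
qed

end

section \<open>Finite index\<close>

context asym_raag begin

lemma auto_sign:
  assumes "\<phi> \<in> auto A" "v \<in> V"
  shows "ex v (\<phi> (gen v)) = 1 \<or> ex v (\<phi> (gen v)) = -1"
    and "\<exists>c\<in>carrier A. \<phi> (gen v) = cj c (gen v [^]\<^bsub>A\<^esub> ex v (\<phi> (gen v)))"
proof -
  note i = A.inv_AutoGroup[OF assms(1)] A.inv_AutoGroup_closed[OF assms(1)]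
  note h = A.auto_hom[OF assms(1)] A.auto_hom[OF i(3)]
  show "ex v (\<phi> (gen v)) = 1 \<or> ex v (\<phi> (gen v)) = -1"
    using hom_exponents(2)[OF h i(1,2) assms(2)] .
  show "\<exists>c\<in>carrier A. \<phi> (gen v) = cj c (gen v [^]\<^bsub>A\<^esub> ex v (\<phi> (gen v)))"
    using hom_gen_conj[OF h i(1,2) assms(2)] .
qed

text \<open>Both automorphisms send \<open>v\<close> to a conjugate of the same element x, which is
  \<open>v\<close> or its inverse. So the quotient sends x to a conjugate of x, and therefore
  \<open>v\<close> to a conjugate of \<open>v\<close>.\<close>

lemma same_sign_PSA:
  assumes \<phi>: "\<phi> \<in> auto A" and \<psi>: "\<psi> \<in> auto A"
    and sgn: "\<And>v. v \<in> V \<Longrightarrow> ex v (\<phi> (gen v)) = ex v (\<psi> (gen v))"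
  shows "\<psi> \<otimes>\<^bsub>AG\<^esub> inv\<^bsub>AG\<^esub> \<phi> \<in> PSA V E"
proof (rule PSA_I)
  let ?\<chi> = "inv\<^bsub>AG\<^esub> \<phi>"
  note i = A.inv_AutoGroup[OF \<phi>] A.inv_AutoGroup_closed[OF \<phi>]
  show "\<psi> \<otimes>\<^bsub>AG\<^esub> ?\<chi> \<in> auto A" using AG.m_closed \<psi> i(3) by (simp add: A.carrier_AutoGroup)
  fix v assume v: "v \<in> V"
  define s where "s = ex v (\<phi> (gen v))"
  define x where "x = gen v [^]\<^bsub>A\<^esub> s"
  have s: "s = 1 \<or> s = -1" using auto_sign(1)[OF \<phi> v] by (simp add: s_def)
  then have x: "x = gen v \<or> x = iv (gen v)" using v by (auto simp: x_def A.int_pow_neg A.int_pow_1)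
  have xc: "x \<in> carrier A" using v by (simp add: x_def)
  obtain c where c: "c \<in> carrier A" "\<phi> (gen v) = cj c x" using auto_sign(2)[OF \<phi> v] by (auto simp: s_def x_def)
  obtain d where d: "d \<in> carrier A" "\<psi> (gen v) = cj d x"
    using auto_sign(2)[OF \<psi> v] sgn[OF v] by (auto simp: s_def x_def)
  let ?c = "?\<chi> c"
  have cc: "?c \<in> carrier A" "?\<chi> x \<in> carrier A" "?\<chi> (gen v) \<in> carrier A" "\<psi> (iv ?c) \<in> carrier A"
    using A.auto_closed i(3) \<psi> c xc v by auto
  have "gen v = ?\<chi> (cj c x)" using i(1)[of "gen v"] c v by simp
  then have "gen v = cj ?c (?\<chi> x)" using hom_conj[OF A.auto_hom[OF i(3)]] c xc by simp
  then have \<chi>x: "?\<chi> x = cj (iv ?c) (gen v)" using cc v A.conj_by_eq_iff[of ?c "?\<chi> x" "gen v"] by simp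
  interpret \<chi>: group_hom A A ?\<chi>
    using A.auto_hom[OF i(3)] by (simp add: group_hom_def group_hom_axioms_def A.is_group)
  interpret \<psi>: group_hom A A \<psi>
    using A.auto_hom[OF \<psi>] by (simp add: group_hom_def group_hom_axioms_def A.is_group)
  have "\<psi> (?\<chi> x) = cj (\<psi> (iv ?c)) (cj d x)"
    unfolding \<chi>x using hom_conj[OF A.auto_hom[OF \<psi>]] cc v d by simp
  then have e: "\<psi> (?\<chi> x) = cj (\<psi> (iv ?c) \<bullet> d) x" using cc d xc by (simp add: A.conj_by_mult)
  have ec: "\<psi> (iv ?c) \<bullet> d \<in> carrier A" using cc d by simp
  have "\<psi> (?\<chi> (gen v)) = cj (\<psi> (iv ?c) \<bullet> d) (gen v)"
  proof (cases "x = gen v")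
    case True then show ?thesis using e by simp
  next
    case False
    then have xi: "x = iv (gen v)" using x by simp
    then have "iv (\<psi> (?\<chi> (gen v))) = iv (cj (\<psi> (iv ?c) \<bullet> d) (gen v))"
      using e cc v ec by (simp add: A.conj_by_inv)
    then show ?thesis using cc v ec A.inv_eq_imp_eq[of "\<psi> (?\<chi> (gen v))"] by (metis A.conj_by_closed A.inv_inv \<psi>.hom_closed gen_closed)
  qed
  then show "\<exists>g\<in>carrier A. (\<psi> \<otimes>\<^bsub>AG\<^esub> ?\<chi>) (gen v) = cj g (gen v)"
    using A.mult_AutoGroup[OF \<psi> i(3)] v ec by auto
qed

text \<open>The coset of an automorphism depends only on its signs on the finitely many
  generators.\<close>

lemma finite_index: "finite (rcosets\<^bsub>OutGroup A\<^esub> (PSO_set V E))"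
proof -
  define C where "C \<phi> = PSO_set V E #>\<^bsub>OutGroup A\<^esub> outer \<phi>" for \<phi>
  define sg where "sg \<phi> = (\<lambda>v\<in>V. ex v (\<phi> (gen v)))" for \<phi>
  have C: "C \<phi> = (\<lambda>\<psi>. outer (\<psi> \<otimes>\<^bsub>AG\<^esub> \<phi>)) ` PSA V E" if "\<phi> \<in> auto A" for \<phi>
  proof -
    have "C \<phi> = (\<lambda>z. z \<otimes>\<^bsub>OutGroup A\<^esub> outer \<phi>) ` PSO_set V E"
      by (auto simp: C_def r_coset_def[of "OutGroup A"])
    also have "\<dots> = (\<lambda>\<psi>. outer \<psi> \<otimes>\<^bsub>OutGroup A\<^esub> outer \<phi>) ` PSA V E" by (simp add: PSO_set_def image_image)
    also have "\<dots> = (\<lambda>\<psi>. outer (\<psi> \<otimes>\<^bsub>AG\<^esub> \<phi>)) ` PSA V E"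
      by (rule image_cong) (simp_all add: outer_mult PSA_auto that)
    finally show ?thesis .
  qed
  have sub: "C \<phi> \<subseteq> C \<psi>" if \<phi>: "\<phi> \<in> auto A" and \<psi>: "\<psi> \<in> auto A" and eq: "sg \<phi> = sg \<psi>" for \<phi> \<psi>
  proof
    fix z assume "z \<in> C \<phi>"
    then obtain \<alpha> where \<alpha>: "\<alpha> \<in> PSA V E" "z = outer (\<alpha> \<otimes>\<^bsub>AG\<^esub> \<phi>)" using C[OF \<phi>] by blast
    let ?\<delta> = "\<phi> \<otimes>\<^bsub>AG\<^esub> inv\<^bsub>AG\<^esub> \<psi>"
    have "ex v (\<psi> (gen v)) = ex v (\<phi> (gen v))" if "v \<in> V" for v
      using fun_cong[OF eq, of v] that by (simp add: sg_def)
    then have \<delta>: "?\<delta> \<in> PSA V E" using same_sign_PSA[OF \<psi> \<phi>] by blast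
    have "\<phi> \<in> carrier AG" "\<psi> \<in> carrier AG" "\<alpha> \<in> carrier AG"
      using \<phi> \<psi> PSA_auto[OF \<alpha>(1)] by (simp_all add: A.carrier_AutoGroup)
    then have "\<alpha> \<otimes>\<^bsub>AG\<^esub> \<phi> = (\<alpha> \<otimes>\<^bsub>AG\<^esub> ?\<delta>) \<otimes>\<^bsub>AG\<^esub> \<psi>" by (simp add: AG.m_assoc)
    then have "z = outer ((\<alpha> \<otimes>\<^bsub>AG\<^esub> ?\<delta>) \<otimes>\<^bsub>AG\<^esub> \<psi>)" using \<alpha>(2) by simp
    then show "z \<in> C \<psi>" unfolding C[OF \<psi>] using PSA_mult[OF \<alpha>(1) \<delta>] by (rule image_eqI)
  qed
  have "sg ` auto A \<subseteq> V \<rightarrow>\<^sub>E {1, -1}" unfolding sg_def using auto_sign(1) by fastforce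
  then have "finite (sg ` auto A)" using finite_V finite_PiE[of V "\<lambda>_. {1, -1}"] finite_subset by blast
  then have "finite (C ` auto A)"
    by (rule finite_image_factor) (intro equalityI sub; simp)
  moreover have "rcosets\<^bsub>OutGroup A\<^esub> (PSO_set V E) = C ` auto A"
    by (auto simp: RCOSETS_def C_def OutGroup_def carrier_FactGroup A.carrier_AutoGroup)
  ultimately show ?thesis by simp
qed

end

section \<open>Twists along a separating set\<close>

text \<open>\<open>S1\<close> and \<open>S2\<close> are the two sides, overlapping in the separating
  set. By \<open>common\<close>, the elements centralising the overlap form exactly the image of the
  given group. \<open>triv1\<close> and \<open>triv2\<close> make the centraliser of each relevant
  side trivial, so that a twist is determined by its outer class.\<close>

locale raag_twist = asym_raag V E for V :: "'a set" and E +
  fixes V0 :: "'b set" and E0 :: "('b \<times> 'b) set" and \<iota> :: "'b \<Rightarrow> 'a" and S1 S2 :: "'a set"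
  assumes graph0: "simple_graph V0 E0"
    and \<iota>_inj: "inj_on \<iota> V0" and \<iota>_sub: "\<iota> ` V0 \<subseteq> S1 - S2"
    and \<iota>_edge: "i \<in> V0 \<Longrightarrow> j \<in> V0 \<Longrightarrow> (\<iota> i, \<iota> j) \<in> E \<longleftrightarrow> (i, j) \<in> E0"
    and cover: "S1 \<union> S2 = V"
    and sep: "x \<in> S1 - S2 \<Longrightarrow> y \<in> S2 - S1 \<Longrightarrow> (x, y) \<notin> E"
    and rigid1: "rigid S1" and rigid2: "rigid S2"
    and common: "{w \<in> V. \<forall>x\<in>S1 \<inter> S2. w \<in> star x} = \<iota> ` V0"
    and triv1: "w \<in> V \<Longrightarrow> \<exists>x\<in>S1. w \<notin> star x"
    and triv2: "w \<in> V \<Longrightarrow> \<exists>x\<in>S2 - S1. w \<notin> star x"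
begin

abbreviation "A0 \<equiv> RAAG V0 E0"
abbreviation "gen0 \<equiv> raag_gen V0 E0"

lemma raag0: "raag V0 E0" using graph0 by (simp add: raag_def)

lemma group0: "group A0"
proof -
  interpret L: raag V0 E0 by (rule raag0)
  show ?thesis by (rule L.A.is_group)
qed

lemma gen0_closed: "x \<in> V0 \<Longrightarrow> gen0 x \<in> carrier A0" using raag.gen_closed[OF raag0] .

lemma \<iota>_V: "x \<in> V0 \<Longrightarrow> \<iota> x \<in> V" using \<iota>_sub cover by auto

definition emb where "emb = raag_lift A (\<lambda>x. gen (\<iota> x))"

lemma emb_hom: "emb \<in> hom A0 A" and emb_gen: "x \<in> V0 \<Longrightarrow> emb (gen0 x) = gen (\<iota> x)"
proof -
  have 1: "(\<lambda>x. gen (\<iota> x)) \<in> V0 \<rightarrow> carrier A" using \<iota>_V by auto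
  have 2: "gen (\<iota> x) \<bullet> gen (\<iota> y) = gen (\<iota> y) \<bullet> gen (\<iota> x)" if "(x, y) \<in> E0" for x y
  proof (rule gen_commute)
    have "x \<in> V0" "y \<in> V0" using that graph0 by (auto simp: simple_graph_def)
    then show "(\<iota> x, \<iota> y) \<in> E" using that \<iota>_edge by simp
  qed
  show "emb \<in> hom A0 A" unfolding emb_def by (rule raag.raag_lift_hom[OF raag0 A.is_group 1 2])
  show "x \<in> V0 \<Longrightarrow> emb (gen0 x) = gen (\<iota> x)"
    unfolding emb_def by (rule raag.raag_lift_gen[OF raag0 A.is_group 1 2])
qed

lemma emb_closed: "x \<in> carrier A0 \<Longrightarrow> emb x \<in> carrier A" using hom_in_carrier[OF emb_hom] .

lemma emb_group_hom: "group_hom A0 A emb"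
  by (simp add: group_hom_def group_hom_axioms_def A.is_group group0 emb_hom)

text \<open>Killing the vertices outside the image gives a left inverse.\<close>

lemma emb_inj: "inj_on emb (carrier A0)"
proof -
  let ?f = "\<lambda>v. if v \<in> \<iota> ` V0 then gen0 (inv_into V0 \<iota> v) else \<one>\<^bsub>A0\<^esub>"
  have one0: "\<one>\<^bsub>A0\<^esub> \<in> carrier A0" using group.is_monoid[OF group0] by (simp add: monoid.one_closed)
  have 1: "?f \<in> V \<rightarrow> carrier A0" using gen0_closed inv_into_into[of _ \<iota> V0] one0 by auto
  have 2: "?f v \<otimes>\<^bsub>A0\<^esub> ?f w = ?f w \<otimes>\<^bsub>A0\<^esub> ?f v" if "(v, w) \<in> E" for v w
  proof (cases "v \<in> \<iota> ` V0 \<and> w \<in> \<iota> ` V0")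
    case True
    then obtain x y where xy: "x \<in> V0" "y \<in> V0" "v = \<iota> x" "w = \<iota> y" by auto
    then have "(x, y) \<in> E0" using that \<iota>_edge by auto
    then show ?thesis using raag.gen_commute[OF raag0] xy \<iota>_inj by simp
  next
    case False
    have "?f v \<in> carrier A0" "?f w \<in> carrier A0" using 1 that E_subset by blast+
    then show ?thesis using False group.is_monoid[OF group0] by (auto simp: monoid.l_one monoid.r_one)
  qed
  let ?r = "raag_lift A0 ?f"
  have r: "?r \<in> hom A A0" by (rule raag_lift_hom[OF group0 1 2])
  have rg: "v \<in> V \<Longrightarrow> ?r (gen v) = ?f v" for v by (rule raag_lift_gen[OF group0 1 2])
  have "(?r \<circ> emb) x = id x" if "x \<in> carrier A0" for x
  proof (rule raag.hom_eqI[OF raag0 group0 hom_compose[OF emb_hom r] _ _ that])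
    show "id \<in> hom A0 A0" by (auto simp: hom_def)
    show "(?r \<circ> emb) (gen0 x) = id (gen0 x)" if "x \<in> V0" for x
      using that by (simp add: emb_gen rg \<iota>_V \<iota>_inj)
  qed
  then show ?thesis by (auto intro: inj_on_inverseI)
qed

lemma emb_SP: "x \<in> carrier A0 \<Longrightarrow> emb x \<in> SP (\<iota> ` V0)"
proof -
  assume x: "x \<in> carrier A0"
  have "(ret (\<iota> ` V0) \<circ> emb) x = emb x"
    by (rule raag.hom_eqI[OF raag0 A.is_group hom_compose[OF emb_hom ret_hom] emb_hom _ x])
      (auto simp: emb_gen ret_gen \<iota>_V)
  then show ?thesis using emb_closed[OF x] by (simp add: SP_def)
qed

lemma emb_surj: "y \<in> SP (\<iota> ` V0) \<Longrightarrow> y \<in> emb ` carrier A0"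
proof (induction rule: SP_induct)
  interpret h: group_hom A0 A emb by (rule emb_group_hom)
  case one
  then show ?case using h.hom_one h.G.one_closed by (metis imageI)
next
  interpret h: group_hom A0 A emb by (rule emb_group_hom)
  case (gen v y)
  then obtain a x where "a \<in> V0" "v = \<iota> a" "x \<in> carrier A0" "y = emb x" by auto
  then show ?case using gen0_closed by (intro image_eqI[of _ _ "gen0 a \<otimes>\<^bsub>A0\<^esub> x"]) (auto simp: emb_gen)
next
  interpret h: group_hom A0 A emb by (rule emb_group_hom)
  case (inv v y)
  then obtain a x where "a \<in> V0" "v = \<iota> a" "x \<in> carrier A0" "y = emb x" by auto
  then show ?case using gen0_closed by (intro image_eqI[of _ _ "inv\<^bsub>A0\<^esub> gen0 a \<otimes>\<^bsub>A0\<^esub> x"]) (auto simp: emb_gen)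
qed

abbreviation "Z \<equiv> SP (\<iota> ` V0)"

lemma Z_closed: "g \<in> Z \<Longrightarrow> g \<in> carrier A" by (rule SP_closed)

lemma Z_commute: "g \<in> Z \<Longrightarrow> w \<in> S1 \<inter> S2 \<Longrightarrow> cj g (gen w) = gen w"
proof -
  assume g: "g \<in> Z" and w: "w \<in> S1 \<inter> S2"
  have wV: "w \<in> V" using w cover by auto
  have "\<iota> ` V0 \<subseteq> star w" using common w by blast
  then have "g \<bullet> gen w = gen w \<bullet> g" using SP_commute_gen[OF g wV] by auto
  then show ?thesis using g wV by (simp add: A.conj_by_fix_iff Z_closed)
qed

definition tw where "tw g = raag_lift A (\<lambda>v. if v \<in> S2 - S1 then cj g (gen v) else gen v)"

text \<open>An edge leaving \<open>S2 - S1\<close> ends in the overlap, whose generators are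
  centralised by \<open>g\<close>; so such a relation may be conjugated as a whole.\<close>

lemma tw_hom: "g \<in> Z \<Longrightarrow> tw g \<in> hom A A"
  and tw_gen: "g \<in> Z \<Longrightarrow> v \<in> V \<Longrightarrow> tw g (gen v) = (if v \<in> S2 - S1 then cj g (gen v) else gen v)"
proof -
  assume g: "g \<in> Z"
  let ?f = "\<lambda>v. if v \<in> S2 - S1 then cj g (gen v) else gen v"
  have 1: "?f \<in> V \<rightarrow> carrier A" using Z_closed[OF g] by auto
  have half: "cj g (gen v) \<bullet> gen w = gen w \<bullet> cj g (gen v)" if "(v, w) \<in> E" "v \<in> S2 - S1" "w \<notin> S2 - S1" for v w
  proof -
    have V: "v \<in> V" "w \<in> V" using that E_subset by auto
    have "w \<in> S1 \<inter> S2" using that V cover sep[of w v] E_sym by blast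
    then have "cj g (gen w) = gen w" using Z_commute g by blast
    then show ?thesis
      using A.commutes_conj_by[OF Z_closed[OF g], of "gen v" "gen w"] V gen_commute[OF that(1)] by simp
  qed
  have 2: "?f v \<bullet> ?f w = ?f w \<bullet> ?f v" if vw: "(v, w) \<in> E" for v w
  proof -
    have V: "v \<in> V" "w \<in> V" using that E_subset by auto
    consider "v \<in> S2 - S1" "w \<in> S2 - S1" | "v \<in> S2 - S1" "w \<notin> S2 - S1" | "v \<notin> S2 - S1" "w \<in> S2 - S1"
      | "v \<notin> S2 - S1" "w \<notin> S2 - S1" by blast
    then show ?thesis
    proof cases
      case 1
      then show ?thesis
        using A.commutes_conj_by[OF Z_closed[OF g], of "gen v" "gen w"] V gen_commute[OF vw] by simp
    next
      case 2
      then show ?thesis using half[OF vw 2] by auto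
    next
      case 3
      then show ?thesis using half[OF E_sym[OF vw] 3(2,1)] by auto
    next
      case 4
      then show ?thesis using gen_commute[OF vw] by auto
    qed
  qed
  show "tw g \<in> hom A A" unfolding tw_def by (rule raag_lift_hom[OF A.is_group 1 2])
  show "v \<in> V \<Longrightarrow> tw g (gen v) = ?f v" unfolding tw_def by (rule raag_lift_gen[OF A.is_group 1 2])
qed

lemma tw_Z: "g \<in> Z \<Longrightarrow> h \<in> Z \<Longrightarrow> tw g h = h"
proof -
  assume g: "g \<in> Z"
  interpret t: group_hom A A "tw g" using tw_hom[OF g] by (simp add: group_hom_def group_hom_axioms_def A.is_group)
  have gen: "tw g (gen v) = gen v" if "v \<in> \<iota> ` V0" "v \<in> V" for v using tw_gen[OF g] that \<iota>_sub by auto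
  show "h \<in> Z \<Longrightarrow> tw g h = h"
    by (induction rule: SP_induct) (simp_all add: gen Z_closed)
qed

text \<open>The order is reversed because \<open>tw g\<close> fixes \<open>h\<close> and acts inside
  the conjugate: h x h^-1 becomes h g x g^-1 h^-1 for a twisted generator x.\<close>

lemma tw_tw:
  assumes "g \<in> Z" "h \<in> Z" "x \<in> carrier A"
  shows "tw g (tw h x) = tw (h \<bullet> g) x"
proof -
  have hg: "h \<bullet> g \<in> Z" using assms SP_mult by blast
  have "(tw g \<circ> tw h) x = tw (h \<bullet> g) x"
  proof (rule hom_eqI[OF A.is_group hom_compose[OF tw_hom[OF assms(2)] tw_hom[OF assms(1)]] tw_hom[OF hg] _ assms(3)])
    fix v assume v: "v \<in> V"
    show "(tw g \<circ> tw h) (gen v) = tw (h \<bullet> g) (gen v)"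
      using v assms hom_conj[OF tw_hom[OF assms(1)] Z_closed[OF assms(2)], of "gen v"]
      by (auto simp: tw_gen hg tw_Z A.conj_by_mult Z_closed)
  qed
  then show ?thesis by simp
qed

lemma tw_one: "x \<in> carrier A \<Longrightarrow> tw \<one>\<^bsub>A\<^esub> x = x"
proof -
  assume x: "x \<in> carrier A"
  have i: "id \<in> hom A A" by (auto simp: hom_def)
  have "tw \<one>\<^bsub>A\<^esub> x = id x"
    by (rule hom_eqI[OF A.is_group tw_hom i _ x]) (auto simp: tw_gen)
  then show ?thesis by simp
qed

definition twist where "twist g = restrict (tw g) (carrier A)"

lemma twist_apply: "x \<in> carrier A \<Longrightarrow> twist g x = tw g x" by (simp add: twist_def)

lemma twist_auto: "g \<in> Z \<Longrightarrow> twist g \<in> auto A"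
  unfolding twist_def
  by (rule A.autoI[of _ "tw (iv g)"]) (auto simp: tw_hom tw_tw SP_inv Z_closed tw_one)

lemma twist_PSA: "g \<in> Z \<Longrightarrow> twist g \<in> PSA V E"
proof (rule PSA_I)
  fix v assume g: "g \<in> Z" and v: "v \<in> V"
  show "\<exists>h\<in>carrier A. twist g (gen v) = cj h (gen v)"
    using g v Z_closed[OF g] tw_gen[OF g v] by (cases "v \<in> S2 - S1") (auto simp: twist_apply intro: bexI[of _ "\<one>\<^bsub>A\<^esub>"])
qed (rule twist_auto)

lemma twist_mult:
  assumes "g \<in> Z" "h \<in> Z"
  shows "twist g \<otimes>\<^bsub>AG\<^esub> twist h = twist (h \<bullet> g)"
proof (rule A.auto_eqI)
  show "twist g \<otimes>\<^bsub>AG\<^esub> twist h \<in> auto A"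
    using AG.m_closed twist_auto assms by (simp add: A.carrier_AutoGroup)
  show "twist (h \<bullet> g) \<in> auto A" using twist_auto SP_mult assms by blast
  fix x assume x: "x \<in> carrier A"
  have "tw h x \<in> carrier A" using hom_in_carrier[OF tw_hom[OF assms(2)] x] .
  then show "(twist g \<otimes>\<^bsub>AG\<^esub> twist h) x = twist (h \<bullet> g) x"
    using x assms by (simp add: A.mult_AutoGroup twist_auto twist_apply tw_tw)
qed

lemma trivial_of_fixing:
  assumes "T \<subseteq> V" "\<And>w. w \<in> V \<Longrightarrow> \<exists>x\<in>T. w \<notin> star x" "q \<in> carrier A" "\<And>x. x \<in> T \<Longrightarrow> q \<in> SP (star x)"
  shows "q = \<one>\<^bsub>A\<^esub>"
proof -
  have "q \<in> SP {w \<in> V. \<forall>x\<in>T. w \<in> star x}" using SP_Inter_star[OF assms(1,3,4)] .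
  moreover have "{w \<in> V. \<forall>x\<in>T. w \<in> star x} = {}" using assms(2) by blast
  ultimately show ?thesis using SP_empty by simp
qed

text \<open>Twists fix all generators in \<open>S1\<close>, so the inner automorphism between them
  centralises \<open>S1\<close> and is trivial. Then \<open>g\<close> and \<open>h\<close> conjugate
  the generators in \<open>S2 - S1\<close> in the same way.\<close>

lemma outer_twist_inj:
  assumes g: "g \<in> Z" and h: "h \<in> Z" and eq: "outer (twist g) = outer (twist h)"
  shows "g = h"
proof -
  note gc = Z_closed[OF g] and hc = Z_closed[OF h]
  have "twist g \<in> outer (twist h)"
    unfolding eq[symmetric] using AG.rcos_self[OF _ normal_imp_subgroup[OF A.inn_normal]] twist_auto[OF g]
    by (simp add: A.carrier_AutoGroup)
  then obtain q where q: "q \<in> carrier A" "twist g = A.inner q \<otimes>\<^bsub>AG\<^esub> twist h"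
    by (auto simp: r_coset_def A.inn_eq)
  have app: "twist g (gen v) = cj q (twist h (gen v))" if "v \<in> V" for v
    using that q twist_auto[OF h] A.auto_closed[OF twist_auto[OF h]]
    by (simp add: A.mult_AutoGroup A.inner_auto A.inner_apply)
  have "q \<in> SP (star x)" if "x \<in> S1" for x
  proof -
    have x: "x \<in> V" using that cover by auto
    have "gen x = cj q (gen x)" using app[OF x] that x by (simp add: twist_apply tw_gen g h)
    then have "q \<bullet> gen x = gen x \<bullet> q" using q x A.conj_by_fix_iff by (metis gen_closed)
    then show ?thesis using centralizer_gen x q by blast
  qed
  then have q1: "q = \<one>\<^bsub>A\<^esub>" using trivial_of_fixing[of S1 q] triv1 cover q by blast
  have "iv h \<bullet> g \<in> SP (star x)" if "x \<in> S2 - S1" for x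
  proof -
    have x: "x \<in> V" using that cover by auto
    have "cj g (gen x) = cj h (gen x)" using app[OF x] that x gc hc by (simp add: twist_apply tw_gen g h q1)
    then show ?thesis using conj_gen_eq_iff[OF x gc hc] by simp
  qed
  moreover have "S2 - S1 \<subseteq> V" "iv h \<bullet> g \<in> carrier A" using cover gc hc by auto
  ultimately have "iv h \<bullet> g = \<one>\<^bsub>A\<^esub>" using trivial_of_fixing[OF _ triv2] by blast
  then show "g = h" using gc hc by (metis A.inv_equality A.inv_inv A.inv_closed)
qed

text \<open>Rigidity gives conjugators \<open>p\<close> on \<open>S1\<close> and \<open>q\<close> on
  \<open>S2\<close>. Undoing \<open>p\<close> leaves the twist by p^-1 q, which lies in
  \<open>Z\<close> because the two conjugators agree on the overlap.\<close>

lemma outer_twist_surj: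
  assumes "\<phi> \<in> PSA V E"
  shows "\<exists>g\<in>Z. outer \<phi> = outer (twist g)"
proof -
  note au = PSA_auto[OF assms]
  obtain p where p: "p \<in> carrier A" "\<And>v. v \<in> S1 \<Longrightarrow> \<phi> (gen v) = cj p (gen v)"
    using rigid1 assms unfolding rigid_def by meson
  obtain q where q: "q \<in> carrier A" "\<And>v. v \<in> S2 \<Longrightarrow> \<phi> (gen v) = cj q (gen v)"
    using rigid2 assms unfolding rigid_def by meson
  define g where "g = iv p \<bullet> q"
  have gc: "g \<in> carrier A" using p q by (simp add: g_def)
  have "g \<in> SP (star x)" if "x \<in> S1 \<inter> S2" for x
  proof -
    have "x \<in> V" "cj q (gen x) = cj p (gen x)" using that cover p(2)[of x] q(2)[of x] by auto
    then show ?thesis using conj_gen_eq_iff[of x q p] p q by (simp add: g_def)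
  qed
  then have gZ: "g \<in> Z" using SP_Inter_star[of "S1 \<inter> S2" g] gc cover common by auto
  let ?\<psi> = "A.inner (iv p) \<otimes>\<^bsub>AG\<^esub> \<phi>"
  have ic: "A.inner (iv p) \<in> auto A" using p by (simp add: A.inner_auto)
  have \<psi>: "?\<psi> \<in> auto A" using AG.m_closed ic au by (simp add: A.carrier_AutoGroup)
  have "?\<psi> = twist g"
  proof (rule A.auto_eqI[OF \<psi> twist_auto[OF gZ]])
    fix x assume "x \<in> carrier A"
    then show "?\<psi> x = twist g x"
    proof (rule hom_eqI[OF A.is_group A.auto_hom[OF \<psi>] A.auto_hom[OF twist_auto[OF gZ]], rotated])
      fix v assume v: "v \<in> V"
      have "?\<psi> (gen v) = cj (iv p) (\<phi> (gen v))"
        using ic au v A.auto_closed[OF au] by (simp add: A.mult_AutoGroup A.inner_apply)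
      moreover have "cj (iv p) (cj p (gen v)) = gen v" "cj (iv p) (cj q (gen v)) = cj g (gen v)"
        using p q v by (simp_all add: g_def A.conj_by_mult)
      ultimately show "?\<psi> (gen v) = twist g (gen v)"
        using v p(2)[of v] q(2)[of v] cover by (auto simp: twist_apply tw_gen gZ)
    qed
  qed
  moreover have "outer ?\<psi> = outer \<phi>"
  proof -
    have "A.inner (iv p) \<in> inn A" using p by (simp add: A.inn_eq)
    then have "outer (A.inner (iv p)) = inn A"
      using AG.coset_join2[OF _ normal_imp_subgroup[OF A.inn_normal]] ic by (simp add: A.carrier_AutoGroup)
    moreover have "inn A \<subseteq> carrier AG" using A.inner_auto by (auto simp: A.inn_eq A.carrier_AutoGroup)
    ultimately show ?thesis
      using AG.coset_mult_assoc[of "inn A" "A.inner (iv p)" \<phi>] ic au by (simp add: A.carrier_AutoGroup)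
  qed
  ultimately show ?thesis using gZ by metis
qed

theorem RAAG_iso_PSO: "A0 \<cong> PSO V E"
proof -
  interpret h: group_hom A0 A emb by (rule emb_group_hom)
  \<comment> \<open>The inverse compensates for the reversed composition of twists.\<close>
  define F where "F x = outer (twist (iv (emb x)))" for x
  have Z: "iv (emb x) \<in> Z" if "x \<in> carrier A0" for x using emb_SP[OF that] SP_inv by blast
  have "F \<in> hom A0 (PSO V E)"
    unfolding hom_def
  proof (intro CollectI conjI ballI funcsetI)
    show "F x \<in> carrier (PSO V E)" if "x \<in> carrier A0" for x
      using twist_PSA[OF Z[OF that]] by (auto simp: PSO_def PSO_set_def F_def)
    fix x y assume xy: "x \<in> carrier A0" "y \<in> carrier A0"
    have "F x \<otimes>\<^bsub>PSO V E\<^esub> F y = outer (twist (iv (emb x)) \<otimes>\<^bsub>AG\<^esub> twist (iv (emb y)))"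
      using outer_mult twist_auto Z xy by (simp add: PSO_def F_def)
    also have "\<dots> = F (x \<otimes>\<^bsub>A0\<^esub> y)"
      using xy Z by (simp add: twist_mult F_def A.inv_mult_group)
    finally show "F (x \<otimes>\<^bsub>A0\<^esub> y) = F x \<otimes>\<^bsub>PSO V E\<^esub> F y" by simp
  qed
  moreover have "bij_betw F (carrier A0) (carrier (PSO V E))"
    unfolding bij_betw_def
  proof
    show "inj_on F (carrier A0)"
    proof (rule inj_onI)
      fix x y assume xy: "x \<in> carrier A0" "y \<in> carrier A0" and "F x = F y"
      then have "iv (emb x) = iv (emb y)" using outer_twist_inj Z by (simp add: F_def)
      then have "emb x = emb y" using xy by (metis A.inv_inv emb_closed)
      then show "x = y" using emb_inj xy by (auto dest: inj_onD)
    qed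
    show "F ` carrier A0 = carrier (PSO V E)"
    proof
      show "F ` carrier A0 \<subseteq> carrier (PSO V E)"
        using twist_PSA[OF Z] by (auto simp: PSO_def PSO_set_def F_def)
      show "carrier (PSO V E) \<subseteq> F ` carrier A0"
      proof
        fix z assume "z \<in> carrier (PSO V E)"
        then obtain \<phi> where "\<phi> \<in> PSA V E" "z = outer \<phi>" by (auto simp: PSO_def PSO_set_def)
        then obtain g where g: "g \<in> Z" "z = outer (twist g)" using outer_twist_surj by blast
        obtain x where x: "x \<in> carrier A0" "iv g = emb x" using emb_surj[OF SP_inv[OF g(1)]] by blast
        then have "iv (emb x) = g" using Z_closed[OF g(1)] by (metis A.inv_inv)
        then show "z \<in> F ` carrier A0" using x g by (intro image_eqI[of _ _ x]) (auto simp: F_def)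
      qed
    qed
  qed
  ultimately show ?thesis by (auto simp: is_iso_def iso_def)
qed

end

section \<open>The graph\<close>

lemma card_subset_triple: "S \<subseteq> {a, b, c} \<Longrightarrow> card S \<le> 3"
  using card_mono[of "{a, b, c}" S] card_length[of "[a, b, c]"] by simp

datatype vertex = XV nat | DV nat | EV nat | FV nat | PV nat

text \<open>The hubs \<open>XV 0\<close> and \<open>XV 1\<close> form the separating pair and \<open>XV j\<close> for \<open>j \<ge> 2\<close> are the vertices of
  the given graph. Each hub \<open>XV j\<close> is tied by two feet \<open>EV j\<close>, \<open>FV j\<close> to the path \<open>DV\<close>; the feet are
  so far apart that the cycles through consecutive hubs overlap in a long path. Twists act on the path \<open>PV\<close>,
  which is attached to the separating pair at 0, 4 and at 1, 6, the uneven spacing excluding a reflection.\<close>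

locale gadget =
  fixes N :: nat and R :: "(nat \<times> nat) set"
  assumes N2: "2 \<le> N" and R_sub: "R \<subseteq> {2..<N} \<times> {2..<N}" and R_sym: "sym R" and R_irrefl: "irrefl R"
begin

text \<open>Edges are listed in one direction, except those of \<open>R\<close>; \<open>adj\<close>
  symmetrises. The feet use positions 0 to \<open>N - 1\<close> and \<open>N + 2\<close> to
  \<open>2 * N + 1\<close> of the path, so no path vertex carries two feet.\<close>

fun arc :: "vertex \<Rightarrow> vertex \<Rightarrow> bool" where
  "arc (XV i) (XV j) = (i < 2 \<and> 2 \<le> j \<and> j < N \<or> (i, j) \<in> R)"
| "arc (XV i) (EV j) = (i = j \<and> j < N)"
| "arc (XV i) (FV j) = (i = j \<and> j < N)"
| "arc (XV i) (PV k) = (i = 0 \<and> (k = 0 \<or> k = 4) \<or> i = 1 \<and> (k = 1 \<or> k = 6))"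
| "arc (DV i) (DV j) = (j = Suc i \<and> j < 2 * N + 2)"
| "arc (EV i) (DV j) = (i = j \<and> i < N)"
| "arc (FV i) (DV j) = (j = i + N + 2 \<and> i < N)"
| "arc (PV i) (PV j) = (j = Suc i \<and> j < 7)"
| "arc _ _ = False"

definition adj :: "vertex \<Rightarrow> vertex \<Rightarrow> bool" where "adj u v \<longleftrightarrow> arc u v \<or> arc v u"

fun vert :: "vertex \<Rightarrow> bool" where
  "vert (XV j) = (j < N)" | "vert (DV j) = (j < 2 * N + 2)" | "vert (EV j) = (j < N)"
| "vert (FV j) = (j < N)" | "vert (PV k) = (k < 7)"

lemma R_D: "(i, j) \<in> R \<Longrightarrow> 2 \<le> i \<and> i < N \<and> 2 \<le> j \<and> j < N \<and> (j, i) \<in> R \<and> i \<noteq> j"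
  using R_sub R_sym R_irrefl by (auto simp: sym_def irrefl_def)

lemma R_range: "(i, j) \<in> R \<Longrightarrow> 2 \<le> i \<and> i < N \<and> 2 \<le> j \<and> j < N \<and> i \<noteq> j"
  using R_D by blast

lemma adj_sym: "adj u v \<Longrightarrow> adj v u" by (auto simp: adj_def)

lemma adj_irrefl: "\<not> adj u u" using R_D by (cases u) (auto simp: adj_def)

lemma adj_vert: "adj u v \<Longrightarrow> vert u \<and> vert v"
  using N2 by (cases u; cases v) (auto simp: adj_def dest: R_D)

lemma adj_D: "adj (DV j) w \<longleftrightarrow> (w = DV (Suc j) \<and> Suc j < 2 * N + 2) \<or> (0 < j \<and> w = DV (j - 1) \<and> j < 2 * N + 2) \<or>
    (w = EV j \<and> j < N) \<or> (N + 2 \<le> j \<and> w = FV (j - (N + 2)) \<and> j < 2 * N + 2)"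
  by (cases w) (auto simp: adj_def)

lemma adj_E: "adj (EV j) w \<longleftrightarrow> j < N \<and> (w = XV j \<or> w = DV j)"
  by (cases w) (auto simp: adj_def)

lemma adj_F: "adj (FV j) w \<longleftrightarrow> j < N \<and> (w = XV j \<or> w = DV (j + N + 2))"
  by (cases w) (auto simp: adj_def)

lemma adj_P: "adj (PV k) w \<longleftrightarrow> (w = PV (Suc k) \<and> Suc k < 7) \<or> (0 < k \<and> w = PV (k - 1) \<and> k < 7) \<or>
    (w = XV 0 \<and> (k = 0 \<or> k = 4)) \<or> (w = XV 1 \<and> (k = 1 \<or> k = 6))"
  by (cases w) (auto simp: adj_def)

lemma adj_X: "adj (XV i) w \<longleftrightarrow> (\<exists>j. w = XV j \<and> (i < 2 \<and> 2 \<le> j \<and> j < N \<or> j < 2 \<and> 2 \<le> i \<and> i < N \<or> (i, j) \<in> R)) \<or>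
    (i < N \<and> (w = EV i \<or> w = FV i)) \<or> (i = 0 \<and> (w = PV 0 \<or> w = PV 4)) \<or> (i = 1 \<and> (w = PV 1 \<or> w = PV 6))"
  by (cases w) (auto simp: adj_def dest: R_D)

lemmas adj_simps = adj_D adj_E adj_F adj_P

text \<open>The witnesses are the two neighbours of \<open>v\<close> on one of the long induced
  cycles.\<close>

lemma no_domination:
  assumes "vert v"
  shows "\<exists>u u'. adj v u \<and> adj v u' \<and> (\<forall>w. (u = w \<or> adj u w) \<longrightarrow> (u' = w \<or> adj u' w) \<longrightarrow> w = v)"
proof (cases v)
  case (XV j)
  show ?thesis using assms XV
    by - (rule exI[of _ "EV j"], rule exI[of _ "FV j"], auto simp: adj_X adj_simps)
next
  case (EV j)
  show ?thesis using assms EV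
    by - (rule exI[of _ "XV j"], rule exI[of _ "DV j"], auto simp: adj_X adj_simps)
next
  case (FV j)
  show ?thesis using assms FV
    by - (rule exI[of _ "XV j"], rule exI[of _ "DV (j + N + 2)"], auto simp: adj_X adj_simps)
next
  case (DV j)
  consider "j = 0" | "j = 2 * N + 1" | "0 < j" "j < 2 * N + 1" using assms DV by fastforce
  then show ?thesis
  proof cases
    case 1
    then show ?thesis using DV N2
      by - (rule exI[of _ "DV 1"], rule exI[of _ "EV 0"], auto simp: adj_simps)
  next
    case 2
    then show ?thesis using DV N2
      by - (rule exI[of _ "DV (2 * N)"], rule exI[of _ "FV (N - 1)"], auto simp: adj_simps)
  next
    case 3
    then show ?thesis using DV
      by - (rule exI[of _ "DV (j - 1)"], rule exI[of _ "DV (Suc j)"], auto simp: adj_simps)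
  qed
next
  case (PV k)
  consider "k = 0" | "k = 6" | "0 < k" "k < 6" using assms PV by fastforce
  then show ?thesis
  proof cases
    case 1
    then show ?thesis using PV
      by - (rule exI[of _ "PV 1"], rule exI[of _ "XV 0"], auto simp: adj_X adj_simps dest!: R_range)
  next
    case 2
    then show ?thesis using PV
      by - (rule exI[of _ "PV 5"], rule exI[of _ "XV 1"], auto simp: adj_X adj_simps)
  next
    case 3
    then show ?thesis using PV
      by - (rule exI[of _ "PV (k - 1)"], rule exI[of _ "PV (Suc k)"], auto simp: adj_simps)
  qed
qed

text \<open>The separating hubs are recognised by their degree. Another hub has at most
  \<open>N - 1\<close> hub neighbours and two feet, hence degree at most \<open>N + 1\<close>,
  however dense the given graph is.\<close>

lemma card_nbr_X01:
  assumes "i < 2"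
  shows "card (Collect (adj (XV i))) = N + 2"
proof -
  have eq: "Collect (adj (XV i)) = XV ` {2..<N} \<union> {EV i, FV i, PV (if i = 0 then 0 else 1), PV (if i = 0 then 4 else 6)}"
    using assms N2 by (auto simp: adj_X dest!: R_range)
  have "card (XV ` {2..<N}) = N - 2" by (subst card_image) (auto intro: inj_onI)
  then show ?thesis unfolding eq using N2 by (subst card_Un_disjoint) auto
qed

lemma card_nbr_other:
  assumes "vert v" "v \<noteq> XV 0" "v \<noteq> XV 1"
  shows "card (Collect (adj v)) \<le> N + 1"
proof (cases v)
  case (XV j)
  then have j: "2 \<le> j" "j < N" using assms by (auto simp: less_2_cases_iff not_less[symmetric])
  have "Collect (adj v) \<subseteq> XV ` ({..<N} - {j}) \<union> {EV j, FV j}"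
    using j N2 XV by (auto simp: adj_X dest!: R_range)
  then have "card (Collect (adj v)) \<le> card (XV ` ({..<N} - {j}) \<union> {EV j, FV j})" by (intro card_mono) auto
  also have "\<dots> \<le> card (XV ` ({..<N} - {j})) + card {EV j, FV j}" by (rule card_Un_le)
  also have "\<dots> \<le> N + 1" using card_image_le[of "{..<N} - {j}" XV] j by simp
  finally show ?thesis .
next
  case (DV j)
  have "Collect (adj v) \<subseteq> {DV (j - 1), DV (Suc j), if j < N then EV j else FV (j - (N + 2))}"
    using DV by (auto simp: adj_simps)
  then have "card (Collect (adj v)) \<le> 3" by (rule card_subset_triple)
  then show ?thesis using N2 by simp
next
  case (EV j)
  have "Collect (adj v) \<subseteq> {XV j, DV j}" using EV by (auto simp: adj_simps)
  then have "card (Collect (adj v)) \<le> card {XV j, DV j}" by (intro card_mono) auto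
  then show ?thesis using N2 by simp
next
  case (FV j)
  have "Collect (adj v) \<subseteq> {XV j, DV (j + N + 2)}" using FV by (auto simp: adj_simps)
  then have "card (Collect (adj v)) \<le> card {XV j, DV (j + N + 2)}" by (intro card_mono) auto
  then show ?thesis using N2 by simp
next
  case (PV k)
  have "Collect (adj v) \<subseteq> {PV (k - 1), PV (Suc k), if k = 0 \<or> k = 4 then XV 0 else XV 1}"
    using PV by (auto simp: adj_simps)
  then have "card (Collect (adj v)) \<le> 3" by (rule card_subset_triple)
  then show ?thesis using N2 by simp
qed

text \<open>Degrees identify the separating pair, and the remaining hubs are its common neighbours,
  so the set of hubs is preserved. A vertex characterised in terms of hubs then anchors the path
  \<open>PV\<close>; this fixes both separating hubs, and fixedness spreads along the path
  \<open>DV\<close> to all feet and hubs.\<close>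

lemma automorphism_trivial:
  assumes bij: "bij_betw f (Collect vert) (Collect vert)"
    and adj_f: "\<And>u w. vert u \<Longrightarrow> vert w \<Longrightarrow> adj (f u) (f w) \<longleftrightarrow> adj u w"
    and v: "vert v"
  shows "f v = v"
proof -
  have fv: "vert u \<Longrightarrow> vert (f u)" for u using bij by (auto simp: bij_betw_def)
  have inj: "f u = f w \<Longrightarrow> vert u \<Longrightarrow> vert w \<Longrightarrow> u = w" for u w using bij by (auto simp: bij_betw_def dest: inj_onD)
  have pre: "\<exists>u. vert u \<and> f u = w" if "vert w" for w using bij that by (metis bij_betw_imp_surj_on imageE mem_Collect_eq)
  have fadj: "adj u w \<Longrightarrow> adj (f u) (f w)" for u w using adj_f adj_vert by blast
  have pre_nb: "\<exists>u. adj x u \<and> f u = w" if "adj (f x) w" "vert x" for x w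
    using pre[of w] that adj_vert[OF that(1)] adj_f by metis
  have nbr: "Collect (adj (f u)) = f ` Collect (adj u)" if "vert u" for u
    using pre_nb[of u] fadj[of u] that by blast
  have card: "card (Collect (adj (f u))) = card (Collect (adj u))" if "vert u" for u
    unfolding nbr[OF that] using inj adj_vert by (intro card_image inj_onI) blast
  have f01: "f (XV i) = XV 0 \<or> f (XV i) = XV 1" if "i < 2" for i
    using card[of "XV i"] card_nbr_X01[OF that] card_nbr_other[OF fv[of "XV i"]] that N2 by fastforce
  have f01': "f (XV 0) \<noteq> f (XV 1)" using inj[of "XV 0" "XV 1"] N2 by auto
  have fX: "\<exists>j. f (XV i) = XV j" if "i < N" for i
  proof (cases "i < 2")
    case True then show ?thesis using f01 by blast
  next
    case False
    then have "adj (f (XV 0)) (f (XV i))" "adj (f (XV 1)) (f (XV i))" using fadj that by (auto simp: adj_X)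
    then have "adj (XV 0) (f (XV i))" "adj (XV 1) (f (XV i))" using f01[of 0] f01[of 1] f01' by auto
    then show ?thesis by (cases "f (XV i)") (auto simp: adj_X)
  qed
  have fin: "finite (XV ` {..<N})" by simp
  have "f (XV i) \<in> XV ` {..<N}" if "i < N" for i using fX[OF that] fv[of "XV i"] that by auto
  then have "f ` XV ` {..<N} \<subseteq> XV ` {..<N}" by auto
  moreover have "inj_on f (XV ` {..<N})" by (rule inj_onI) (use inj in force)
  ultimately have img: "f ` XV ` {..<N} = XV ` {..<N}" using endo_inj_surj[OF fin] by blast
  have fX_iff: "(\<exists>j. f u = XV j) \<longleftrightarrow> (\<exists>j. u = XV j)" if "vert u" for u
  proof
    assume "\<exists>j. f u = XV j"
    then obtain j where j: "f u = XV j" by blast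
    then have "XV j \<in> f ` XV ` {..<N}" using fv[OF that] img by auto
    then show "\<exists>j. u = XV j" using inj[of u] j that by auto
  qed (use fX that in auto)
  have nX: "(\<exists>j. adj (f u) (XV j)) \<longleftrightarrow> (\<exists>j. adj u (XV j))" if "vert u" for u
    using pre_nb[OF _ that] fadj[of u] fX_iff adj_vert by metis
  have nfix: "adj x (f w)" if "f x = x" "adj x w" for x w using fadj[OF that(2)] that by simp
  have ne: "f u \<noteq> w" if "f w = w" "u \<noteq> w" "vert u" "vert w" for u w using inj that by metis
  have P5: "f (PV 5) = PV 5"
  proof -
    \<comment> \<open>Among the vertices that are not hubs, \<open>PV 5\<close> is the only one
      without a hub neighbour all of whose neighbours have one. This uses the uneven spacing 0, 4
      and 1, 6.\<close>
    let ?Q = "\<lambda>v. (\<nexists>j. v = XV j) \<and> (\<nexists>j. adj v (XV j)) \<and> (\<forall>u. adj v u \<longrightarrow> (\<exists>j. adj u (XV j)))"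
    have Q: "v = PV 5" if "?Q v" "vert v" for v
    proof (cases v)
      case (DV j)
      have "adj v (DV (if j = 0 then 1 else j - 1))" using that(2) DV by (auto simp: adj_simps)
      then have "\<exists>i. adj (DV (if j = 0 then 1 else j - 1)) (XV i)" using that(1) by blast
      then show ?thesis by (auto simp: adj_simps)
    next
      case (PV k)
      have "k < 7" using that PV by simp
      then consider "k \<in> {0, 1, 4, 6}" | "k = 2" | "k = 3" | "k = 5" by fastforce
      then show ?thesis
      proof cases
        case 1 then show ?thesis using that(1) PV by (auto simp: adj_simps)
      next
        case 2
        then have "adj v (PV 3)" using PV by (simp add: adj_simps)
        then show ?thesis using that(1) by (fastforce simp: adj_simps)
      next
        case 3
        then have "adj v (PV 2)" using PV by (simp add: adj_simps)
        then show ?thesis using that(1) by (fastforce simp: adj_simps)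
      qed (simp add: PV)
    qed (use that in \<open>auto simp: adj_simps\<close>)
    have v5: "vert (PV 5)" by simp
    have "\<exists>j. adj w (XV j)" if w: "adj (f (PV 5)) w" for w
    proof -
      obtain u where u: "adj (PV 5) u" "f u = w" using pre_nb[OF w v5] by blast
      then have "u = PV 4 \<or> u = PV 6" by (auto simp: adj_simps)
      then have "\<exists>j. adj u (XV j)" by (auto simp: adj_simps)
      then show ?thesis using nX[of u] u adj_vert by blast
    qed
    moreover have "\<nexists>j. adj (f (PV 5)) (XV j)" using nX[OF v5] by (auto simp: adj_simps)
    moreover have "\<nexists>j. f (PV 5) = XV j" using fX_iff[OF v5] by auto
    ultimately show ?thesis using Q[of "f (PV 5)"] fv[OF v5] by blast
  qed
  have nP: "f (PV k) \<noteq> XV j" if "k < 7" for k j using fX_iff[of "PV k"] that by auto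
  have a4: "adj (PV 5) (f (PV 4))" "adj (PV 5) (f (PV 6))" 
    by (rule nfix[OF P5]; simp add: adj_simps)+
  \<comment> \<open>\<open>PV 6\<close> is an end of the path: besides \<open>PV 5\<close> it only
    has a hub as neighbour, which leaves no room for the image of \<open>PV 3\<close>.\<close>
  have P4: "f (PV 4) = PV 4"
  proof (rule ccontr)
    assume "f (PV 4) \<noteq> PV 4"
    then have "f (PV 4) = PV 6" using a4 by (auto simp: adj_simps)
    moreover have "adj (f (PV 4)) (f (PV 3))" by (intro fadj) (simp add: adj_simps)
    ultimately show False using nP[of 3 1] ne[OF P5, of "PV 3"] by (auto simp: adj_simps)
  qed
  have P6: "f (PV 6) = PV 6" using a4(2) ne[OF P4, of "PV 6"] by (auto simp: adj_simps)
  have X0: "f (XV 0) = XV 0"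
    using f01[of 0] nfix[OF P4, of "XV 0"] by (auto simp: adj_simps)
  have X1: "f (XV 1) = XV 1" using f01[of 1] f01' X0 by auto
  have P3: "f (PV 3) = PV 3"
    using nfix[OF P4, of "PV 3"] ne[OF P5, of "PV 3"] nP[of 3 0] by (auto simp: adj_simps)
  have P2: "f (PV 2) = PV 2"
    using nfix[OF P3, of "PV 2"] ne[OF P4, of "PV 2"] by (auto simp: adj_simps)
  have P1: "f (PV 1) = PV 1"
    using nfix[OF P2, of "PV 1"] ne[OF P3, of "PV 1"] by (auto simp: adj_simps)
  have P0: "f (PV 0) = PV 0"
    using nfix[OF P1, of "PV 0"] ne[OF P2, of "PV 0"] nP[of 0 1] by (auto simp: adj_simps numeral_2_eq_2)
  have N0: "0 < N" using N2 by simp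
  have E0: "f (EV 0) = EV 0 \<or> f (EV 0) = FV 0"
    using nfix[OF X0, of "EV 0"] ne[OF P0, of "EV 0"] ne[OF P4, of "EV 0"] fX_iff[of "EV 0"] N0 by (auto simp: adj_X)
  have aD0: "adj (f (EV 0)) (f (DV 0))" using N0 by (intro fadj) (simp add: adj_simps)
  have D0X: "f (DV 0) \<noteq> XV 0" using ne[OF X0, of "DV 0"] N0 by auto
  \<comment> \<open>Exchanging the feet would send the end \<open>DV 0\<close> to
    \<open>DV (N + 2)\<close>, which has two neighbours on the path, whereas only
    \<open>DV 1\<close> is available to be mapped to them.\<close>
  have E0': "f (EV 0) = EV 0"
  proof (rule ccontr)
    assume "f (EV 0) \<noteq> EV 0"
    then have e: "f (EV 0) = FV 0" using E0 by blast
    then have d: "f (DV 0) = DV (N + 2)" using aD0 D0X by (auto simp: adj_simps)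
    have "f (DV 1) = DV w" if "w = N + 1 \<or> w = N + 3" for w
    proof -
      have "adj (f (DV 0)) (DV w)" using d that N2 by (auto simp: adj_simps)
      then obtain u where u: "adj (DV 0) u" "f u = DV w" using pre_nb[of "DV 0"] by auto
      then show ?thesis using e by (auto simp: adj_simps)
    qed
    from this[of "N + 1"] this[of "N + 3"] show False by simp
  qed
  have D0: "f (DV 0) = DV 0" using aD0 E0' D0X by (auto simp: adj_simps)
  have D1: "f (DV 1) = DV 1" using nfix[OF D0, of "DV 1"] ne[OF E0', of "DV 1"] N0 by (auto simp: adj_simps)
  \<comment> \<open>Two consecutive fixed vertices are carried along: the second one leaves two path
    candidates for the next image, and the first one excludes going back.\<close>
  have Dall: "f (DV j) = DV j \<and> (Suc j < 2 * N + 2 \<longrightarrow> f (DV (Suc j)) = DV (Suc j))" if "j < 2 * N + 2" for j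
    using that
  proof (induction j)
    case 0 then show ?case using D0 D1 by simp
  next
    case (Suc j)
    then have s: "f (DV j) = DV j" "f (DV (Suc j)) = DV (Suc j)" by auto
    have "f (DV (Suc (Suc j))) = DV (Suc (Suc j))" if l: "Suc (Suc j) < 2 * N + 2"
    proof -
      have a: "adj (DV (Suc j)) (f (DV (Suc (Suc j))))" using l by (intro nfix[OF s(2)]) (simp add: adj_simps)
      have "\<nexists>i. adj (f (DV (Suc (Suc j)))) (XV i)" using nX[of "DV (Suc (Suc j))"] l by (auto simp: adj_simps)
      then show ?thesis using a ne[OF s(1), of "DV (Suc (Suc j))"] l by (auto simp: adj_simps)
    qed
    then show ?case using s by simp
  qed
  have Eall: "f (EV j) = EV j" if "j < N" for j
  proof -
    have "adj (DV j) (f (EV j))" using that Dall[of j] by (intro nfix) (auto simp: adj_simps)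
    then show ?thesis
      using ne[of "DV (Suc j)" "EV j"] ne[of "DV (j - 1)" "EV j"] Dall[of j] Dall[of "j - 1"] that by (auto simp: adj_simps)
  qed
  have Fall: "f (FV j) = FV j" if "j < N" for j
  proof -
    have "adj (DV (j + N + 2)) (f (FV j))" using that Dall[of "j + N + 2"] by (intro nfix) (auto simp: adj_simps)
    then show ?thesis
      using ne[of "DV (Suc (j + N + 2))" "FV j"] ne[of "DV (j + N + 1)" "FV j"] Dall[of "j + N + 2"] Dall[of "j + N + 1"] that
      by (auto simp: adj_simps)
  qed
  have Xall: "f (XV j) = XV j" if "j < N" for j
    using nfix[OF Eall[OF that], of "XV j"] fX[OF that] that by (auto simp: adj_simps)
  have Pall: "f (PV k) = PV k" if "k < 7" for k
  proof -
    have "k = 0 \<or> k = 1 \<or> k = 2 \<or> k = 3 \<or> k = 4 \<or> k = 5 \<or> k = 6" using that by linarith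
    then show ?thesis using P0 P1 P2 P3 P4 P5 P6 by (elim disjE) simp_all
  qed
  show ?thesis using v Dall Eall Fall Xall Pall by (cases v) auto
qed

end

text \<open>The residue modulo 5 records the constructor.\<close>

fun enc :: "vertex \<Rightarrow> nat" where
  "enc (XV j) = 5 * j" | "enc (DV j) = 5 * j + 1" | "enc (EV j) = 5 * j + 2"
| "enc (FV j) = 5 * j + 3" | "enc (PV j) = 5 * j + 4"

lemma enc_eq_iff [simp]: "enc u = enc v \<longleftrightarrow> u = v"
  by (cases u; cases v; simp; presburger)

declare enc.simps [simp del]

section \<open>The gadget on the natural numbers and the rigidity of its two sides\<close>

context gadget begin

definition VV :: "nat set" where "VV = enc ` Collect vert"
definition EE :: "(nat \<times> nat) set" where "EE = {(enc u, enc v) | u v. adj u v}"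

lemma EE_iff [simp]: "(enc u, enc v) \<in> EE \<longleftrightarrow> adj u v" by (auto simp: EE_def)

lemma EE_E: "(a, enc v) \<in> EE \<Longrightarrow> \<exists>u. a = enc u \<and> adj u v" by (auto simp: EE_def)

lemma VV_iff [simp]: "enc u \<in> VV \<longleftrightarrow> vert u" by (auto simp: VV_def)

lemma simple_graph_VV: "simple_graph VV EE"
proof -
  have "Collect vert \<subseteq> XV ` {..<N} \<union> DV ` {..<2 * N + 2} \<union> EV ` {..<N} \<union> FV ` {..<N} \<union> PV ` {..<7}"
  proof
    fix v assume "v \<in> Collect vert"
    then show "v \<in> XV ` {..<N} \<union> DV ` {..<2 * N + 2} \<union> EV ` {..<N} \<union> FV ` {..<N} \<union> PV ` {..<7}"
      by (cases v) auto
  qed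
  then have "finite (Collect vert)" by (rule finite_subset) auto
  moreover have "sym EE" by (auto simp: EE_def sym_def intro: adj_sym)
  moreover have "irrefl EE" using adj_irrefl by (auto simp: EE_def irrefl_def)
  moreover have "EE \<subseteq> VV \<times> VV" using adj_vert by (auto simp: EE_def VV_def)
  ultimately show ?thesis by (simp add: simple_graph_def VV_def)
qed

sublocale G: raag VV EE by (simp add: raag_def simple_graph_VV)

lemma star_iff: "enc u \<in> G.star (enc w) \<longleftrightarrow> u = w \<or> adj w u"
  by (auto simp: G.star_def G.link_def)

lemma link_iff: "enc u \<in> G.link (enc w) \<longleftrightarrow> adj w u"
  by (auto simp: G.link_def)

lemma graph_aut_trivial:
  assumes "graph_aut VV EE f" "a \<in> VV"
  shows "f a = a"
proof -
  define g where "g v = inv_into UNIV enc (f (enc v))" for v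
  have inj: "inj enc" by (auto intro: injI)
  have bij: "bij_betw f VV VV" using assms by (simp add: graph_aut_def)
  have eg: "enc (g v) = f (enc v)" if "vert v" for v
  proof -
    have "f (enc v) \<in> VV" using bij that by (auto simp: bij_betw_def)
    then show ?thesis unfolding g_def by (intro f_inv_into_f) (auto simp: VV_def)
  qed
  have "bij_betw enc (Collect vert) VV" using inj by (auto simp: VV_def bij_betw_def intro: inj_on_subset)
  then have "bij_betw (f \<circ> enc) (Collect vert) VV" using bij bij_betw_trans by blast
  then have "bij_betw (enc \<circ> g) (Collect vert) (enc ` Collect vert)"
    unfolding VV_def by (rule bij_betw_cong[THEN iffD1, rotated]) (simp add: eg)
  then have "inj_on g (Collect vert)" "enc ` g ` Collect vert = enc ` Collect vert"
    by (auto simp: bij_betw_def image_comp dest: inj_on_imageI2)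
  then have "bij_betw g (Collect vert) (Collect vert)"
    using inj_image_eq_iff[OF inj] by (simp add: bij_betw_def)
  moreover have "adj (g u) (g w) \<longleftrightarrow> adj u w" if "vert u" "vert w" for u w
  proof -
    have "(f (enc u), f (enc w)) \<in> EE \<longleftrightarrow> (enc u, enc w) \<in> EE"
      using assms(1) that unfolding graph_aut_def by (metis VV_iff)
    then show ?thesis using eg that by (metis EE_iff)
  qed
  moreover obtain v where v: "vert v" "a = enc v" using assms(2) by (auto simp: VV_def)
  ultimately have "g v = v" using automorphism_trivial by blast
  then show ?thesis using eg[OF v(1)] v by simp
qed

lemma asym_VV: "asym_raag VV EE"
proof
  fix a assume "a \<in> VV"
  then obtain v where v: "vert v" "a = enc v" by (auto simp: VV_def)
  obtain u u' where u: "adj v u" "adj v u'" "\<And>w. u = w \<or> adj u w \<Longrightarrow> u' = w \<or> adj u' w \<Longrightarrow> w = v"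
    using no_domination[OF v(1)] by blast
  have "b = a" if "b \<in> VV" "enc u \<in> G.star b" "enc u' \<in> G.star b" for b
    using that u(3) adj_sym by (auto simp: VV_def star_iff v)
  then show "\<exists>u\<in>G.link a. \<exists>u'\<in>G.link a. \<forall>w\<in>VV. u \<in> G.star w \<longrightarrow> u' \<in> G.star w \<longrightarrow> w = a"
    using u(1,2) v by (intro bexI[of _ "enc u"] bexI[of _ "enc u'"]) (auto simp: link_iff)
qed (rule graph_aut_trivial)

lemma rigid_cycle:
  assumes n: "5 \<le> n" and inj: "\<And>i j. i < n \<Longrightarrow> j < n \<Longrightarrow> c i = c j \<Longrightarrow> i = j"
    and edge: "\<And>i. Suc i < n \<Longrightarrow> adj (c i) (c (Suc i))" and close: "adj (c (n - 1)) (c 0)"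
    and induced: "\<And>i j. i < j \<Longrightarrow> j < n \<Longrightarrow> adj (c i) (c j) \<Longrightarrow> j = Suc i \<or> (i = 0 \<and> j = n - 1)"
    and outside: "\<And>w i j. w \<notin> c ` {..<n} \<Longrightarrow> i < n \<Longrightarrow> j < n \<Longrightarrow> adj (c i) w \<Longrightarrow> adj (c j) w \<Longrightarrow> i = j"
  shows "G.rigid (enc ` c ` {..<n})"
proof -
  have "G.rigid ((enc \<circ> c) ` {..<n})"
  proof (rule G.cycle_rigid[OF n])
    show "inj_on (enc \<circ> c) {..<n}" using inj by (auto intro!: inj_onI)
    fix a i j assume a: "a \<notin> (enc \<circ> c) ` {..<n}" and ij: "i < n" "j < n"
      and e: "(a, (enc \<circ> c) i) \<in> EE" "(a, (enc \<circ> c) j) \<in> EE"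
    obtain w where w: "a = enc w" "adj w (c i)" using EE_E[of a "c i"] e(1) by auto
    then have "adj w (c j)" using e(2) by simp
    moreover have "w \<notin> c ` {..<n}" using a w by auto
    ultimately show "i = j" using outside[of w i j] w ij adj_sym by blast
  qed (use edge close induced in auto)
  then show ?thesis by (simp add: image_comp)
qed

definition hub_cycle :: "nat \<Rightarrow> vertex set" where
  "hub_cycle j = {XV j, EV j, FV j} \<union> {DV i | i. j \<le> i \<and> i \<le> j + N + 2}"

lemma hub_cycle_rigid:
  assumes j: "j < N"
  shows "G.rigid (enc ` hub_cycle j)"
proof -
  \<comment> \<open>Once around: the hub, its first foot, \<open>N + 3\<close> path vertices at
    indices 2 to \<open>N + 4\<close>, and the second foot.\<close>
  define c where "c i = (if i = 0 then XV j else if i = 1 then EV j else if i = N + 5 then FV j else DV (j + i - 2))" for i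
  have img: "c ` {..<N + 6} = hub_cycle j"
  proof
    show "c ` {..<N + 6} \<subseteq> hub_cycle j" by (auto simp: c_def hub_cycle_def)
    have "XV j = c 0" "EV j = c 1" "FV j = c (N + 5)" by (auto simp: c_def)
    moreover have "DV i = c (i - j + 2)" "i - j + 2 < N + 6" if "j \<le> i" "i \<le> j + N + 2" for i
      using that by (auto simp: c_def)
    ultimately show "hub_cycle j \<subseteq> c ` {..<N + 6}" unfolding hub_cycle_def by fastforce
  qed
  have "G.rigid (enc ` c ` {..<N + 6})"
  proof (rule rigid_cycle)
    show "adj (c i) (c (Suc i))" if "Suc i < N + 6" for i
      using that j by (auto simp: c_def adj_simps adj_X)
    show "adj (c (N + 6 - 1)) (c 0)" using j by (auto simp: c_def adj_simps)
    show "i = k" if "i < N + 6" "k < N + 6" "c i = c k" for i k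
      using that by (auto simp: c_def split: if_splits)
    show "k = Suc i \<or> (i = 0 \<and> k = N + 6 - 1)" if "i < k" "k < N + 6" "adj (c i) (c k)" for i k
      using that by (auto simp: c_def adj_simps adj_X split: if_splits)
    show "i = k" if "w \<notin> c ` {..<N + 6}" "i < N + 6" "k < N + 6" "adj (c i) w" "adj (c k) w" for w i k
      using that unfolding img
      by (cases w) (auto simp: c_def hub_cycle_def adj_simps adj_X split: if_splits)
  qed simp
  then show ?thesis by (simp add: img)
qed

text \<open>Two cycles, of length 6 through \<open>XV 0\<close> and of length 7 through
  \<open>XV 1\<close>, share the segment from \<open>PV 1\<close> to \<open>PV 4\<close>, whose ends
  have disjoint stars.\<close>

lemma link_cycles_rigid: "G.rigid (enc ` ({XV 0, XV 1} \<union> PV ` {..<7}))"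
proof -
  define c where "c i = (if i = 0 then XV 0 else PV (i - 1))" for i :: nat
  define d where "d i = (if i = 0 then XV 1 else PV i)" for i :: nat
  have six: "{..<6::nat} = {0, 1, 2, 3, 4, 5}" and seven: "{..<7::nat} = {0, 1, 2, 3, 4, 5, 6}" by auto
  have imgc: "c ` {..<6} = {XV 0, PV 0, PV 1, PV 2, PV 3, PV 4}" unfolding six by (auto simp: c_def)
  have imgd: "d ` {..<7} = {XV 1, PV 1, PV 2, PV 3, PV 4, PV 5, PV 6}" unfolding seven by (auto simp: d_def)
  have 1: "G.rigid (enc ` c ` {..<6})"
  proof (rule rigid_cycle)
    show "adj (c i) (c (Suc i))" if "Suc i < 6" for i
      using that by (auto simp: c_def adj_simps adj_X)
    show "adj (c (6 - 1)) (c 0)" by (auto simp: c_def adj_simps)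
    show "i = k" if "i < 6" "k < 6" "c i = c k" for i k
      using that by (auto simp: c_def split: if_splits)
    show "k = Suc i \<or> (i = 0 \<and> k = 6 - 1)" if "i < k" "k < 6" "adj (c i) (c k)" for i k
      using that by (auto simp: c_def adj_simps adj_X split: if_splits)
    show "i = k" if "w \<notin> c ` {..<6}" "i < 6" "k < 6" "adj (c i) w" "adj (c k) w" for w i k
      using that unfolding imgc
      by (cases w) (auto simp: c_def adj_simps adj_X split: if_splits dest: R_range)
  qed simp
  have 2: "G.rigid (enc ` d ` {..<7})"
  proof (rule rigid_cycle)
    show "adj (d i) (d (Suc i))" if "Suc i < 7" for i
      using that by (auto simp: d_def adj_simps adj_X)
    show "adj (d (7 - 1)) (d 0)" by (auto simp: d_def adj_simps)
    show "i = k" if "i < 7" "k < 7" "d i = d k" for i k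
      using that by (auto simp: d_def split: if_splits)
    show "k = Suc i \<or> (i = 0 \<and> k = 7 - 1)" if "i < k" "k < 7" "adj (d i) (d k)" for i k
      using that by (auto simp: d_def adj_simps adj_X split: if_splits)
    show "i = k" if "w \<notin> d ` {..<7}" "i < 7" "k < 7" "adj (d i) w" "adj (d k) w" for w i k
      using that unfolding imgd
      by (cases w) (auto simp: d_def adj_simps adj_X split: if_splits dest: R_range)
  qed simp
  have "G.rigid (enc ` c ` {..<6} \<union> enc ` d ` {..<7})"
  proof (rule G.rigid_glue[OF 1 2])
    show "enc ` c ` {..<6} \<union> enc ` d ` {..<7} \<subseteq> VV" unfolding imgc imgd using N2 by auto
    fix a assume "a \<in> VV"
    then obtain w where w: "a = enc w" by (auto simp: VV_def)
    have "\<not> (PV 1 = w \<or> adj (PV 1) w) \<or> \<not> (PV 4 = w \<or> adj (PV 4) w)" by (auto simp: adj_simps)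
    then have "a \<notin> G.star (enc (PV 1)) \<or> a \<notin> G.star (enc (PV 4))" unfolding w star_iff by auto
    then show "\<exists>x\<in>enc ` c ` {..<6} \<inter> enc ` d ` {..<7}. a \<notin> G.star x" unfolding imgc imgd by auto
  qed
  moreover have "c ` {..<6} \<union> d ` {..<7} = {XV 0, XV 1} \<union> PV ` {..<7}" (is "?l = ?r")
  proof
    show "?l \<subseteq> ?r" unfolding imgc imgd by auto
    have "PV ` {..<7} = {PV 0, PV 1, PV 2, PV 3, PV 4, PV 5, PV 6}" unfolding seven by simp
    then show "?r \<subseteq> ?l" unfolding imgc imgd by blast
  qed
  ultimately show ?thesis by (metis image_Un)
qed

text \<open>The side containing the given graph, which twists leave alone; \<open>S2\<close> is the
  other side. Both include the separating pair.\<close>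

definition S1 :: "vertex set" where
  "S1 = XV ` {..<N} \<union> EV ` {..<N} \<union> FV ` {..<N} \<union> DV ` {..<2 * N + 2}"

definition S2 :: "vertex set" where "S2 = {XV 0, XV 1} \<union> PV ` {..<7}"

lemma far_D: "\<not> (DV i = w \<or> adj (DV i) w) \<or> \<not> (DV (i + 3) = w \<or> adj (DV (i + 3)) w)"
  by (auto simp: adj_simps)

text \<open>Hub cycles are glued on one at a time. Consecutive ones share \<open>N + 2\<close> path
  vertices; as \<open>2 \<le> N\<close>, these include two at distance 3, whose stars are
  disjoint.\<close>

lemma S1_rigid: "G.rigid (enc ` S1)"
proof -
  have "G.rigid (enc ` (\<Union>j\<le>m. hub_cycle j))" if "m < N" for m
    using that
  proof (induction m)
    case 0
    then show ?case using hub_cycle_rigid[of 0] by simp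
  next
    case (Suc m)
    let ?U = "\<Union>j\<le>m. hub_cycle j"
    have IH: "G.rigid (enc ` ?U)" using Suc by simp
    have "G.rigid (enc ` ?U \<union> enc ` hub_cycle (Suc m))"
    proof (rule G.rigid_glue[OF IH hub_cycle_rigid[OF Suc.prems]])
      show "enc ` ?U \<union> enc ` hub_cycle (Suc m) \<subseteq> VV" using Suc.prems by (auto simp: hub_cycle_def)
      fix a assume "a \<in> VV"
      then obtain w where w: "a = enc w" by (auto simp: VV_def)
      have "a \<notin> G.star (enc (DV (m + 1))) \<or> a \<notin> G.star (enc (DV (m + 1 + 3)))"
        using far_D[of "m + 1" w] unfolding w star_iff by auto
      moreover have "DV (m + 1) \<in> hub_cycle m" "DV (m + 1 + 3) \<in> hub_cycle m"
        "DV (m + 1) \<in> hub_cycle (Suc m)" "DV (m + 1 + 3) \<in> hub_cycle (Suc m)"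
        using N2 by (auto simp: hub_cycle_def)
      ultimately show "\<exists>x\<in>enc ` ?U \<inter> enc ` hub_cycle (Suc m). a \<notin> G.star x" by blast
    qed
    moreover have "(\<Union>j\<le>Suc m. hub_cycle j) = ?U \<union> hub_cycle (Suc m)" by (simp add: atMost_Suc Un_commute)
    ultimately show ?case by (simp add: image_Un)
  qed
  from this[of "N - 1"] have "G.rigid (enc ` (\<Union>j\<le>N - 1. hub_cycle j))" using N2 by simp
  moreover have "(\<Union>j\<le>N - 1. hub_cycle j) = S1"
  proof
    show "(\<Union>j\<le>N - 1. hub_cycle j) \<subseteq> S1" using N2 by (auto simp: hub_cycle_def S1_def)
    have "DV i \<in> (\<Union>j\<le>N - 1. hub_cycle j)" if "i < 2 * N + 2" for i
    proof -
      \<comment> \<open>The last hub cycle covers all positions from \<open>N - 1\<close> to the end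
        of the path.\<close>
      have "DV i \<in> hub_cycle (if i < N then i else N - 1)" using that N2 by (auto simp: hub_cycle_def)
      moreover have "(if i < N then i else N - 1) \<le> N - 1" by auto
      ultimately show ?thesis by blast
    qed
    moreover have "{XV j, EV j, FV j} \<subseteq> (\<Union>j\<le>N - 1. hub_cycle j)" if "j < N" for j
    proof -
      have "{XV j, EV j, FV j} \<subseteq> hub_cycle j" by (auto simp: hub_cycle_def)
      moreover have "j \<le> N - 1" using that by simp
      ultimately show ?thesis by blast
    qed
    ultimately show "S1 \<subseteq> (\<Union>j\<le>N - 1. hub_cycle j)" by (auto simp: S1_def)
  qed
  ultimately show ?thesis by simp
qed

end

theorem theorem3p5:
  fixes V :: "'a set" and E :: "('a \<times> 'a) set"
  assumes "simple_graph V E"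
  shows "\<exists>(V' :: nat set) (E' :: (nat \<times> nat) set).
           simple_graph V' E' \<and>
           RAAG V E \<cong> PSO V' E' \<and>
           finite (rcosets\<^bsub>OutGroup (RAAG V' E')\<^esub> (PSO_set V' E')) \<and>
           (\<forall>f. graph_aut V' E' f \<longrightarrow> (\<forall>v\<in>V'. f v = v))"
proof -
  have fin: "finite V" and sub: "E \<subseteq> V \<times> V" and sym: "sym E" and irr: "irrefl E"
    using assms by (auto simp: simple_graph_def)
  \<comment> \<open>Indices 0 and 1 are reserved for the separating pair; the given vertices are
    numbered from 2.\<close>
  define N where "N = card V + 2"
  obtain e0 where e0: "bij_betw e0 V {0..<card V}" using ex_bij_betw_finite_nat[OF fin] by blast
  define e where "e x = e0 x + 2" for x
  have e_inj: "inj_on e V" using e0 by (auto simp: bij_betw_def e_def inj_on_def)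
  have "e ` V = (\<lambda>i. i + 2) ` {0..<card V}" using e0 by (auto simp: bij_betw_def e_def image_iff)
  also have "\<dots> = {2..<N}" unfolding N_def by (simp only: image_add_atLeastLessThan' add_0)
  finally have e_img: "e ` V = {2..<N}" .
  define R where "R = {(e x, e y) | x y. (x, y) \<in> E}"
  have R_iff: "(e x, e y) \<in> R \<longleftrightarrow> (x, y) \<in> E" if "x \<in> V" "y \<in> V" for x y
    using that sub e_inj by (auto simp: R_def dest: inj_onD)
  interpret gadget N R
  proof
    show "2 \<le> N" by (simp add: N_def)
    show "R \<subseteq> {2..<N} \<times> {2..<N}" using sub e_img by (auto simp: R_def)
    show "sym R" using sym by (auto simp: R_def sym_def)
    show "irrefl R" using irr sub e_inj by (auto simp: R_def irrefl_def dest: inj_onD)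
  qed
  interpret T: asym_raag VV EE by (rule asym_VV)
  interpret T: raag_twist VV EE V E "\<lambda>x. enc (XV (e x))" "enc ` S1" "enc ` S2"
  proof
    show "simple_graph V E" by fact
    show "inj_on (\<lambda>x. enc (XV (e x))) V" using e_inj by (auto simp: inj_on_def)
    have e2: "x \<in> V \<Longrightarrow> 2 \<le> e x \<and> e x < N" for x using e_img by auto
    show "(\<lambda>x. enc (XV (e x))) ` V \<subseteq> enc ` S1 - enc ` S2"
      using e2 by (fastforce simp: S1_def S2_def)
    show "(enc (XV (e x)), enc (XV (e y))) \<in> EE \<longleftrightarrow> (x, y) \<in> E" if "x \<in> V" "y \<in> V" for x y
      using R_iff[OF that] e2[OF that(1)] e2[OF that(2)] R_D by (auto simp: adj_X)
    have "v \<in> S1 \<union> S2 \<longleftrightarrow> vert v" for v using N2 by (cases v) (auto simp: S1_def S2_def)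
    then have "S1 \<union> S2 = Collect vert" by blast
    then show "enc ` S1 \<union> enc ` S2 = VV" unfolding VV_def by (simp flip: image_Un)
    show "(a, b) \<notin> EE" if ab: "a \<in> enc ` S1 - enc ` S2" "b \<in> enc ` S2 - enc ` S1" for a b
    proof -
      obtain u v where uv: "a = enc u" "u \<notin> S2" "b = enc v" "v \<in> S2" "v \<notin> S1" using ab by auto
      have "XV 0 \<in> S1" "XV 1 \<in> S1" using N2 by (auto simp: S1_def)
      then obtain k where k: "v = PV k" using uv(4,5) unfolding S2_def by blast
      \<comment> \<open>All neighbours of a vertex of the path \<open>PV\<close> are on that path or
        in the separating pair.\<close>
      have "u \<in> S2" if "adj v u" using that unfolding k by (auto simp: adj_simps S2_def)
      then show ?thesis using uv adj_sym by auto
    qed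
    show "G.rigid (enc ` S1)" by (rule S1_rigid)
    show "G.rigid (enc ` S2)" using link_cycles_rigid by (simp add: S2_def)
    have int: "enc ` S1 \<inter> enc ` S2 = {enc (XV 0), enc (XV 1)}" using N2 by (auto simp: S1_def S2_def)
    \<comment> \<open>The two separating hubs are not adjacent and their feet and path neighbours
      are distinct, so their stars share only the hubs of the given graph.\<close>
    have XX: "enc w \<in> G.star (enc (XV 0)) \<and> enc w \<in> G.star (enc (XV 1)) \<longleftrightarrow> w \<in> XV ` {2..<N}" for w
    proof (cases w)
      case (XV j)
      have "w \<in> XV ` {2..<N} \<longleftrightarrow> 2 \<le> j \<and> j < N" using XV by auto
      moreover have "(0, j) \<notin> R" "(1, j) \<notin> R" using R_range[of 0 j] R_range[of 1 j] by auto
      ultimately show ?thesis unfolding star_iff using XV by (auto simp: adj_X)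
    qed (auto simp: star_iff adj_X)
    show "{w \<in> VV. \<forall>x\<in>enc ` S1 \<inter> enc ` S2. w \<in> G.star x} = (\<lambda>x. enc (XV (e x))) ` V"
    proof -
      have "{w \<in> VV. \<forall>x\<in>enc ` S1 \<inter> enc ` S2. w \<in> G.star x} = enc ` {w. vert w \<and> w \<in> XV ` {2..<N}}"
        unfolding int XX[symmetric] VV_def by auto
      also have "{w. vert w \<and> w \<in> XV ` {2..<N}} = XV ` {2..<N}" by auto
      also have "enc ` XV ` {2..<N} = (\<lambda>x. enc (XV (e x))) ` V" unfolding e_img[symmetric] by (simp add: image_image)
      finally show ?thesis .
    qed
    show "\<exists>x\<in>enc ` S1. a \<notin> G.star x" if a: "a \<in> VV" for a
    proof -
      obtain w where w: "a = enc w" using a by (auto simp: VV_def)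
      have "a \<notin> G.star (enc (DV 0)) \<or> a \<notin> G.star (enc (DV 3))"
        using far_D[of 0 w] unfolding w star_iff by auto
      moreover have "DV 0 \<in> S1" "DV 3 \<in> S1" using N2 by (auto simp: S1_def)
      ultimately show ?thesis by blast
    qed
    show "\<exists>x\<in>enc ` S2 - enc ` S1. a \<notin> G.star x" if a: "a \<in> VV" for a
    proof -
      obtain w where w: "a = enc w" using a by (auto simp: VV_def)
      have "\<not> (PV 1 = w \<or> adj (PV 1) w) \<or> \<not> (PV 4 = w \<or> adj (PV 4) w)" by (auto simp: adj_simps)
      then have "a \<notin> G.star (enc (PV 1)) \<or> a \<notin> G.star (enc (PV 4))" unfolding w star_iff by auto
      moreover have "enc (PV 1) \<in> enc ` S2 - enc ` S1" "enc (PV 4) \<in> enc ` S2 - enc ` S1"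
        by (auto simp: S1_def S2_def)
      ultimately show ?thesis by blast
    qed
  qed
  show ?thesis
    using simple_graph_VV T.RAAG_iso_PSO T.finite_index graph_aut_trivial by blast
qed

end
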